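(* There is a universal constant $c>0$ such that the following holds. Let $n_1,n_2,m,s_1,s_2,r\in\mathbb{N}$ with $s_1\le n_1$, $s_2\le n_2$, $r\le\min\{s_1,s_2\}$, and let $\sigma>0$, $D>0$. Let $X=UV^*$ and $Z$ be distributed as in the Bayesian setup described in the context. Let the encoder $f:\mathbb{C}^{n_1\times n_2}\to\mathbb{C}^m$ satisfy the average power constraint $\mathbb{E}\|f(X)\|_2^2\le m$, and let the decoder $g:\mathbb{C}^m\to\mathbb{C}^{n_1\times n_2}$, with $\hat{X}=g(f(X)+Z)=\hat{U}\hat{V}^*$, $\hat{U}\in\mathsf{V}(\mathbb{C}^{n_1},r)$, $\hat{V}\in\mathsf{V}(\mathbb{C}^{n_2},r)$, achieve the reconstruction error $$\mathbb{E}\|\hat{X}-X\|_F^2\le rD.$$ Then $$m\ge\left((s_1+s_2)r-\frac{3r^2}{2}\right)\frac{\log\frac{c}{D}}{\log\left(1+\frac{1}{\sigma^2}\right)}.$$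
   Context: $\mathsf{V}(\mathbb{C}^n,r)=\{V\in\mathbb{C}^{n\times r}:V^*V=I_r\}$ is the complex Stiefel manifold; "uniform" on it means the unitarily invariant probability measure. $\|\cdot\|_F$ is the Frobenius norm. Bayesian setup: $X=UV^*\in\mathbb{C}^{n_1\times n_2}$, where $U\in\mathbb{C}^{n_1\times r}$ and $V\in\mathbb{C}^{n_2\times r}$ are independent random matrices. The row support $S$ of $U$ is uniformly distributed over all subsets of $\{1,\dots,n_1\}$ of cardinality $s_1$, the rows of $U$ outside $S$ vanish, and given $S$ the submatrix $U_S$ of rows in $S$ is uniformly distributed on $\mathsf{V}(\mathbb{C}^{s_1},r)$. Likewise $V$ has uniformly chosen row support of cardinality $s_2$ and nonzero part uniform on $\mathsf{V}(\mathbb{C}^{s_2},r)$. The noise $Z\sim\mathcal{CN}(0,\sigma^2I_m)$ is independent of $X$, with independent real and imaginary parts each distributed as $\mathcal{N}(0,\frac{\sigma^2}{2}I_m)$. The encoder $f$ and decoder $g$ are arbitrary (possibly nonlinear) measurable maps. *)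

theory Defs
  imports
    "HOL-Probability.Probability"
    "Jordan_Normal_Form.Schur_Decomposition"
    "Jordan_Normal_Form.DL_Submatrix"
begin

unbundle no vec_syntax

text \<open>
  All dimensions are natural numbers that are quantified inside the statement, so the matrices
  and vectors are those of \<^typ>\<open>complex mat\<close> and \<^typ>\<open>complex vec\<close> with explicit carriers.
  These carriers are equipped with the Borel \<open>\<sigma>\<close>-algebra of the space of coordinates.
\<close>

definition borel_mat :: "nat \<Rightarrow> nat \<Rightarrow> complex mat measure" where
  "borel_mat n k = vimage_algebra (carrier_mat n k)
     (\<lambda>A. \<lambda>p\<in>{..<n} \<times> {..<k}. A $$ p) (\<Pi>\<^sub>M p\<in>{..<n} \<times> {..<k}. borel)"

definition borel_vec :: "nat \<Rightarrow> complex vec measure" where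
  "borel_vec m = vimage_algebra (carrier_vec m)
     (\<lambda>v. \<lambda>i\<in>{..<m}. v $ i) (\<Pi>\<^sub>M i\<in>{..<m}. borel)"

definition norm2_vec :: "complex vec \<Rightarrow> real" where
  "norm2_vec v = sqrt (\<Sum>i<dim_vec v. (cmod (v $ i))\<^sup>2)"

definition frobenius_norm :: "complex mat \<Rightarrow> real" where
  "frobenius_norm A = sqrt (\<Sum>i<dim_row A. \<Sum>j<dim_col A. (cmod (A $$ (i, j)))\<^sup>2)"

definition stiefel :: "nat \<Rightarrow> nat \<Rightarrow> complex mat set" where
  "stiefel n r = {V \<in> carrier_mat n r. mat_adjoint V * V = 1\<^sub>m r}"

text \<open>
  The predicate \<open>uniform_on_stiefel n r \<mu>\<close> says that \<open>\<mu>\<close> is the invariant probability measure on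
  the Stiefel manifold, regarded as a measure on all \<open>n \<times> r\<close> matrices. The unitary group is
  \<open>stiefel n n\<close>; as it acts transitively by left multiplication, \<open>\<mu>\<close> is unique if \<open>r \<le> n\<close>.
\<close>

definition uniform_on_stiefel :: "nat \<Rightarrow> nat \<Rightarrow> complex mat measure \<Rightarrow> bool" where
  "uniform_on_stiefel n r \<mu> \<longleftrightarrow>
     prob_space \<mu> \<and> sets \<mu> = sets (borel_mat n r) \<and> (AE V in \<mu>. V \<in> stiefel n r) \<and>
     (\<forall>Q\<in>stiefel n n. distr \<mu> (borel_mat n r) (\<lambda>V. Q * V) = \<mu>)"

text \<open>
  The matrix with \<open>n\<close> rows whose rows in \<open>S\<close> are, in increasing order, the rows of \<open>W\<close> and
  whose other rows vanish.
\<close>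

definition place_rows :: "nat \<Rightarrow> nat set \<Rightarrow> complex mat \<Rightarrow> complex mat" where
  "place_rows n S W =
     mat n (dim_col W) (\<lambda>(i, j). if i \<in> S then W $$ (card {k \<in> S. k < i}, j) else 0)"

lemma place_rows_carrier: "W \<in> carrier_mat s r \<Longrightarrow> place_rows n S W \<in> carrier_mat n r"
  by (auto simp: place_rows_def)

lemma submatrix_place_rows:
  assumes "W \<in> carrier_mat s r" "S \<subseteq> {..<n}" "card S = s"
  shows "submatrix (place_rows n S W) S UNIV = W"
proof -
  have [simp]: "{i. i < n \<and> i \<in> S} = S"
    using assms by auto
  have fin: "finite S"
    using assms(2) finite_subset by blast
  have pick: "pick S i < n" "pick S i \<in> S" "card {k \<in> S. k < pick S i} = i" if "i < s" for i
    using assms that pick_in_set_le[of i S] card_pick[of i S] fin by auto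
  show ?thesis
    by (rule eq_matI) (use assms pick in \<open>auto simp: submatrix_def place_rows_def pick_UNIV\<close>)
qed

text \<open>
  The law of a random \<open>n \<times> r\<close> matrix whose row support \<open>S\<close> is uniform over the subsets of
  \<open>{..<n}\<close> of cardinality \<open>s\<close> and whose rows in \<open>S\<close> form, given \<open>S\<close>, a matrix distributed
  according to \<open>\<mu>\<close>.
\<close>

definition row_sparse_law :: "nat \<Rightarrow> nat \<Rightarrow> nat \<Rightarrow> complex mat measure \<Rightarrow> complex mat measure" where
  "row_sparse_law n s r \<mu> =
     distr (uniform_count_measure {S. S \<subseteq> {..<n} \<and> card S = s} \<Otimes>\<^sub>M \<mu>) (borel_mat n r)
       (\<lambda>(S, W). place_rows n S W)"

text \<open>The law of \<open>X = U V\<^sup>*\<close> for independent \<open>U\<close> and \<open>V\<close> with laws \<open>P\<close> and \<open>Q\<close>.\<close>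

definition product_law ::
  "nat \<Rightarrow> nat \<Rightarrow> complex mat measure \<Rightarrow> complex mat measure \<Rightarrow> complex mat measure" where
  "product_law n1 n2 P Q =
     distr (P \<Otimes>\<^sub>M Q) (borel_mat n1 n2) (\<lambda>(U, V). U * mat_adjoint V)"

text \<open>
  Circularly symmetric complex Gaussians of variance \<open>\<sigma>\<^sup>2\<close>. The second parameter of
  \<^const>\<open>normal_density\<close> is the standard deviation, so the real and imaginary parts have
  variance \<open>\<sigma>\<^sup>2 / 2\<close>.
\<close>

definition complex_normal :: "real \<Rightarrow> complex measure" where
  "complex_normal \<sigma> =
     distr (density lborel (normal_density 0 (\<sigma> / sqrt 2)) \<Otimes>\<^sub>M
            density lborel (normal_density 0 (\<sigma> / sqrt 2)))
       borel (\<lambda>(x, y). Complex x y)"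

definition complex_normal_vec :: "nat \<Rightarrow> real \<Rightarrow> complex vec measure" where
  "complex_normal_vec m \<sigma> =
     distr (\<Pi>\<^sub>M i\<in>{..<m}. complex_normal \<sigma>) (borel_vec m) (\<lambda>z. vec m z)"

end

theory Submission
  imports Defs
begin

text \<open>
  Inserting the log-likelihood ratio between the channel law and \<open>CN(0, 1 + \<sigma>\<^sup>2)\<close> into an
  exponential moment of the distortion and applying Jensen's inequality gives
  \<open>- \<theta> E d - m log (1 + 1 / \<sigma>\<^sup>2) \<le> log (sup E exp (- \<theta> d (X, Y)))\<close>, the supremum being over the
  admissible reconstructions \<open>Y\<close>. It remains to bound the Laplace transform of
  \<open>d (X, Y) = \<parallel>X - Y\<parallel>\<^sup>2\<close> with the exponent \<open>(s\<^sub>1 + s\<^sub>2) r - 3 r\<^sup>2 / 2\<close>, half the real dimension of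
  the set of all \<open>U V\<^sup>*\<close>. Given the supports, \<open>\<parallel>X - Y\<parallel>\<^sup>2\<close> dominates a term measuring the distance of
  \<open>V\<close> from a point depending on \<open>U\<close> (dimension \<open>2 s\<^sub>2 r - r\<^sup>2\<close>) plus one measuring the angle between
  the range of \<open>U\<close> and a fixed subspace (dimension \<open>2 (s\<^sub>1 - r) r\<close>). By unitary invariance the
  reference point may be averaged, namely over the orthonormal factor of a Gaussian matrix with
  bounded operator norm. For fixed \<open>U\<close> this leaves the Laplace transform of the squared distance
  of a Gaussian vector from a real subspace.
\<close>

section \<open>Gaussian integrals\<close>

text \<open>\<open>X\<close> is a partial isometry, so for \<open>r > 0\<close> its law has no
  Lebesgue density and no differential entropy; a Laplace transform measures instead how much mass
  can lie near one reconstruction. The pairs \<open>(U, V)\<close> and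
  \<open>(U \<Omega>, V \<Omega>)\<close> give the same \<open>X\<close> for every unitary
  \<open>\<Omega>\<close> of order \<open>r\<close>. This redundancy of dimension r^2 is removed by
  measuring \<open>V\<close> in full for given \<open>U\<close>, but of \<open>U\<close> only its
  range. The difficulty is a constant free of all dimensions. The squared operator norm of a
  Gaussian \<open>s\<close> by \<open>r\<close> matrix is of order \<open>s\<close>, so the Laplace
  bounds are powers of multiples of \<open>s / \<theta>\<close>, and
  \<open>\<theta> = (s1 + s2) / D\<close> turns the base into a multiple of \<open>D\<close>. The
  loss \<open>\<theta> E d\<close> is then at most \<open>(s1 + s2) r\<close>, hence at most four
  times the exponent because \<open>s1 + s2\<close> is at least \<open>2 r\<close>. The numerical
  factors (2 for each use of a Gaussian event of probability 1/2, 2 for moving a reference point to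
  the Stiefel manifold) multiply to 8 and are absorbed, since the exponent is at least 1/2 for
  \<open>r > 0\<close>.\<close>

abbreviation std_normal :: "real measure" where
  "std_normal \<equiv> density lborel std_normal_density"

lemma prob_space_std_normal: "prob_space std_normal"
  by (rule prob_space_normal_density) simp

lemma nn_integral_std_normal_exp_quadratic:
  fixes a h :: real
  assumes "1 + 2 * a > 0"
  shows "(\<integral>\<^sup>+x. ennreal (exp (- a * x\<^sup>2 + h * x)) \<partial>std_normal)
    = ennreal ((1 + 2 * a) powr (-1/2) * exp (h\<^sup>2 / (2 * (1 + 2 * a))))"
proof -
  define t where "t = 1 + 2 * a"
  have t: "t > 0" "a = (t - 1) / 2" using assms by (auto simp: t_def)
  have sq: "t powr (-1/2) = 1 / sqrt t"
    using t by (simp add: powr_minus powr_half_sqrt divide_simps)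
  \<comment> \<open>Completing the square: the integrand is a multiple of the normal density with
    mean \<open>h / t\<close> and variance \<open>1 / t\<close>, whose total mass is 1.\<close>
  have eq: "std_normal_density x * exp (- a * x\<^sup>2 + h * x)
      = (t powr (-1/2) * exp (h\<^sup>2 / (2 * t))) * normal_density (h / t) (1 / sqrt t) x" for x
  proof -
    have "- x\<^sup>2 / 2 + (- a * x\<^sup>2 + h * x) = h\<^sup>2 / (2 * t) + (- (x - h / t)\<^sup>2 / (2 * (1 / sqrt t)\<^sup>2))"
      using t(1) unfolding t(2) by (simp add: power_divide field_simps power2_eq_square)
    then have "exp (- x\<^sup>2 / 2) * exp (- a * x\<^sup>2 + h * x) = exp (h\<^sup>2 / (2 * t)) * exp (- (x - h / t)\<^sup>2 / (2 * (1 / sqrt t)\<^sup>2))"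
      by (simp only: exp_add [symmetric])
    then show ?thesis
      using t(1) sq unfolding t(2) by (simp add: normal_density_def power_divide real_sqrt_divide real_sqrt_mult)
  qed
  have "(\<integral>\<^sup>+x. ennreal (exp (- a * x\<^sup>2 + h * x)) \<partial>std_normal)
     = (\<integral>\<^sup>+x. ennreal (std_normal_density x * exp (- a * x\<^sup>2 + h * x)) \<partial>lborel)"
    by (subst nn_integral_density) (auto simp: ennreal_mult')
  also have "\<dots> = (\<integral>\<^sup>+x. ennreal (t powr (-1/2) * exp (h\<^sup>2 / (2 * t))) * normal_density (h / t) (1 / sqrt t) x \<partial>lborel)"
    by (subst eq) (simp add: ennreal_mult')
  also have "\<dots> = ennreal (t powr (-1/2) * exp (h\<^sup>2 / (2 * t))) * (\<integral>\<^sup>+x. normal_density (h / t) (1 / sqrt t) x \<partial>lborel)"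
    by (rule nn_integral_cmult) auto
  also have "(\<integral>\<^sup>+x. normal_density (h / t) (1 / sqrt t) x \<partial>lborel) = 1"
  proof -
    interpret prob_space "density lborel (normal_density (h / t) (1 / sqrt t))"
      using t by (intro prob_space_normal_density) simp
    show ?thesis using emeasure_space_1 by (simp add: emeasure_density)
  qed
  finally show ?thesis by (simp add: t_def)
qed

abbreviation gaussian :: "'i set \<Rightarrow> ('i \<Rightarrow> real) measure" where
  "gaussian I \<equiv> \<Pi>\<^sub>M i\<in>I. std_normal"

lemma prob_space_gaussian: "prob_space (gaussian I)"
  by (intro prob_space_PiM prob_space_std_normal)

lemma nn_integral_gaussian_exp_linear:
  assumes "finite I" "1 + 2 * a > 0"
  shows "(\<integral>\<^sup>+x. ennreal (exp (\<Sum>i\<in>I. - a * (x i)\<^sup>2 + h i * x i)) \<partial>gaussian I)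
    = ennreal ((1 + 2 * a) powr (- real (card I) / 2) * exp ((\<Sum>i\<in>I. (h i)\<^sup>2) / (2 * (1 + 2 * a))))"
proof -
  interpret product_sigma_finite "\<lambda>_. std_normal"
    using prob_space_std_normal
    by (simp add: product_sigma_finite_def prob_space_imp_sigma_finite)
  have "(\<integral>\<^sup>+x. ennreal (exp (\<Sum>i\<in>I. - a * (x i)\<^sup>2 + h i * x i)) \<partial>gaussian I)
      = (\<integral>\<^sup>+x. (\<Prod>i\<in>I. ennreal (exp (- a * (x i)\<^sup>2 + h i * x i))) \<partial>gaussian I)"
    using assms by (simp add: exp_sum prod_ennreal)
  also have "\<dots> = (\<Prod>i\<in>I. (\<integral>\<^sup>+x. ennreal (exp (- a * x\<^sup>2 + h i * x)) \<partial>std_normal))"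
    using assms by (intro product_nn_integral_prod) auto
  also have "\<dots> = (\<Prod>i\<in>I. ennreal ((1 + 2 * a) powr (-1/2) * exp ((h i)\<^sup>2 / (2 * (1 + 2 * a)))))"
    by (simp only: nn_integral_std_normal_exp_quadratic[OF assms(2)])
  also have "\<dots> = ennreal (\<Prod>i\<in>I. ((1 + 2 * a) powr (-1/2) * exp ((h i)\<^sup>2 / (2 * (1 + 2 * a)))))"
    by (rule prod_ennreal) auto
  also have "(\<Prod>i\<in>I. ((1 + 2 * a) powr (-1/2) * exp ((h i)\<^sup>2 / (2 * (1 + 2 * a)))))
     = (1 + 2 * a) powr (- real (card I) / 2) * exp ((\<Sum>i\<in>I. (h i)\<^sup>2) / (2 * (1 + 2 * a)))"
    using assms by (simp add: prod.distrib exp_sum sum_divide_distrib powr_power)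
  finally show ?thesis .
qed

text \<open>
  The squares are linearised by \<open>exp (b y\<^sup>2) = E exp (\<surd>(2 b) \<xi> y)\<close> with \<open>\<xi>\<close> standard normal, so no
  rotation invariance of the Gaussian measure is needed.
\<close>

lemma nn_integral_gaussian_exp_orthonormal:
  fixes e :: "'j \<Rightarrow> 'i \<Rightarrow> real"
  assumes fin: "finite I" "finite J"
    and orth: "\<And>t u. t \<in> J \<Longrightarrow> u \<in> J \<Longrightarrow> (\<Sum>i\<in>I. e t i * e u i) = (if t = u then 1 else 0)"
    and ab: "1 + 2 * a > 0" "b \<ge> 0" "1 + 2 * a - 2 * b > 0"
  shows "(\<integral>\<^sup>+x. ennreal (exp (- a * (\<Sum>i\<in>I. (x i)\<^sup>2) + b * (\<Sum>t\<in>J. (\<Sum>i\<in>I. e t i * x i)\<^sup>2))) \<partial>gaussian I)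
    = ennreal ((1 + 2 * a) powr (- (real (card I) - real (card J)) / 2)
        * (1 + 2 * a - 2 * b) powr (- real (card J) / 2))"
proof -
  interpret I: prob_space "gaussian I" by (rule prob_space_gaussian)
  interpret J: prob_space "gaussian J" by (rule prob_space_gaussian)
  interpret IJ: pair_sigma_finite "gaussian I" "gaussian J" ..
  define c where "c = sqrt (2 * b)"
  define s where "s = 1 + 2 * a"
  have s: "s > 0" "s - 2 * b > 0" and c: "c\<^sup>2 = 2 * b" using ab by (auto simp: s_def c_def)
  let ?y = "\<lambda>x t. \<Sum>i\<in>I. e t i * x i"
  \<comment> \<open>Integrating out \<open>\<xi>\<close> restores the squares; integrating out
    \<open>x\<close> leaves, by orthonormality, a diagonal quadratic form in \<open>\<xi>\<close>.
    Fubini equates the two.\<close>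
  let ?F = "\<lambda>(x, \<xi>). ennreal (exp (- a * (\<Sum>i\<in>I. (x i)\<^sup>2) + (\<Sum>t\<in>J. c * ?y x t * \<xi> t)))"
  have F: "?F \<in> borel_measurable (gaussian I \<Otimes>\<^sub>M gaussian J)"
    using fin by measurable
  have 1: "(\<integral>\<^sup>+\<xi>. ?F (x, \<xi>) \<partial>gaussian J)
      = ennreal (exp (- a * (\<Sum>i\<in>I. (x i)\<^sup>2) + b * (\<Sum>t\<in>J. (?y x t)\<^sup>2)))" for x
  proof -
    have "(\<integral>\<^sup>+\<xi>. ?F (x, \<xi>) \<partial>gaussian J) = (\<integral>\<^sup>+\<xi>. ennreal (exp (- a * (\<Sum>i\<in>I. (x i)\<^sup>2))) *
        ennreal (exp (\<Sum>t\<in>J. - 0 * (\<xi> t)\<^sup>2 + (c * ?y x t) * \<xi> t)) \<partial>gaussian J)"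
      by (simp add: ennreal_mult'[symmetric] exp_add[symmetric])
    also have "\<dots> = ennreal (exp (- a * (\<Sum>i\<in>I. (x i)\<^sup>2))) *
        (\<integral>\<^sup>+\<xi>. ennreal (exp (\<Sum>t\<in>J. - 0 * (\<xi> t)\<^sup>2 + (c * ?y x t) * \<xi> t)) \<partial>gaussian J)"
      by (intro nn_integral_cmult) (use fin in measurable)
    also have "\<dots> = ennreal (exp (- a * (\<Sum>i\<in>I. (x i)\<^sup>2))) * ennreal (exp ((\<Sum>t\<in>J. (c * ?y x t)\<^sup>2) / 2))"
      by (subst nn_integral_gaussian_exp_linear) (use fin in auto)
    also have "(\<Sum>t\<in>J. (c * ?y x t)\<^sup>2) / 2 = b * (\<Sum>t\<in>J. (?y x t)\<^sup>2)"
      by (simp add: power_mult_distrib c sum_distrib_left[symmetric])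
    finally show ?thesis by (simp add: ennreal_mult'[symmetric] exp_add[symmetric])
  qed
  \<comment> \<open>The coefficient is written \<open>- (- b / s)\<close> to fit the shape of
    \<open>nn_integral_gaussian_exp_linear\<close>, which is applied to \<open>\<xi>\<close> with
    \<open>a = - b / s\<close>; the assumption on \<open>1 + 2 * a - 2 * b\<close> keeps that
    integral finite.\<close>
  have 2: "(\<integral>\<^sup>+x. ?F (x, \<xi>) \<partial>gaussian I)
      = ennreal (s powr (- real (card I) / 2) * exp (\<Sum>t\<in>J. - (- b / s) * (\<xi> t)\<^sup>2 + 0 * \<xi> t))" for \<xi>
  proof -
    let ?h = "\<lambda>i. c * (\<Sum>t\<in>J. \<xi> t * e t i)"
    have lin: "(\<Sum>t\<in>J. c * ?y x t * \<xi> t) = (\<Sum>i\<in>I. ?h i * x i)" for x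
      by (simp add: sum_distrib_left sum_distrib_right mult_ac) (rule sum.swap)
    have "(\<Sum>i\<in>I. (?h i)\<^sup>2) = 2 * b * (\<Sum>i\<in>I. (\<Sum>t\<in>J. \<xi> t * e t i) * (\<Sum>u\<in>J. \<xi> u * e u i))"
      unfolding power_mult_distrib c sum_distrib_left[symmetric] by (simp add: power2_eq_square)
    also have "(\<Sum>i\<in>I. (\<Sum>t\<in>J. \<xi> t * e t i) * (\<Sum>u\<in>J. \<xi> u * e u i))
       = (\<Sum>i\<in>I. \<Sum>t\<in>J. \<Sum>u\<in>J. \<xi> t * \<xi> u * (e t i * e u i))"
      by (simp add: sum_product mult_ac)
    also have "\<dots> = (\<Sum>t\<in>J. \<Sum>u\<in>J. \<xi> t * \<xi> u * (\<Sum>i\<in>I. e t i * e u i))"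
      by (simp add: sum_distrib_left sum.swap[of _ J I])
    also have "\<dots> = (\<Sum>t\<in>J. (\<xi> t)\<^sup>2)"
      using fin by (simp add: orth sum.delta power2_eq_square if_distrib cong: if_cong)
    finally have h: "(\<Sum>i\<in>I. (?h i)\<^sup>2) = 2 * b * (\<Sum>t\<in>J. (\<xi> t)\<^sup>2)" .
    have "(\<integral>\<^sup>+x. ?F (x, \<xi>) \<partial>gaussian I)
       = (\<integral>\<^sup>+x. ennreal (exp (\<Sum>i\<in>I. - a * (x i)\<^sup>2 + ?h i * x i)) \<partial>gaussian I)"
      unfolding prod.case lin sum_distrib_left[of "- a"] sum.distrib ..
    also have "\<dots> = ennreal (s powr (- real (card I) / 2) * exp (2 * b * (\<Sum>t\<in>J. (\<xi> t)\<^sup>2) / (2 * s)))"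
      by (subst nn_integral_gaussian_exp_linear) (use fin ab in \<open>auto simp only: h s_def\<close>)
    also have "2 * b * (\<Sum>t\<in>J. (\<xi> t)\<^sup>2) / (2 * s) = (\<Sum>t\<in>J. - (- b / s) * (\<xi> t)\<^sup>2 + 0 * \<xi> t)"
      by (simp add: sum_distrib_left sum_divide_distrib)
    finally show ?thesis .
  qed
  have "(\<integral>\<^sup>+x. ennreal (exp (- a * (\<Sum>i\<in>I. (x i)\<^sup>2) + b * (\<Sum>t\<in>J. (?y x t)\<^sup>2))) \<partial>gaussian I)
      = (\<integral>\<^sup>+x. (\<integral>\<^sup>+\<xi>. ?F (x, \<xi>) \<partial>gaussian J) \<partial>gaussian I)"
    by (simp only: 1)
  also have "\<dots> = (\<integral>\<^sup>+\<xi>. (\<integral>\<^sup>+x. ?F (x, \<xi>) \<partial>gaussian I) \<partial>gaussian J)"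
    by (rule IJ.Fubini[OF F, symmetric])
  also have "\<dots> = (\<integral>\<^sup>+\<xi>. ennreal (s powr (- real (card I) / 2)) *
      ennreal (exp (\<Sum>t\<in>J. - (- b / s) * (\<xi> t)\<^sup>2 + 0 * \<xi> t)) \<partial>gaussian J)"
    by (simp only: 2 ennreal_mult' powr_ge_zero)
  also have "\<dots> = ennreal (s powr (- real (card I) / 2)) *
      (\<integral>\<^sup>+\<xi>. ennreal (exp (\<Sum>t\<in>J. - (- b / s) * (\<xi> t)\<^sup>2 + 0 * \<xi> t)) \<partial>gaussian J)"
    by (intro nn_integral_cmult) (use fin in measurable)
  also have "\<dots> = ennreal (s powr (- real (card I) / 2)) * ennreal ((1 + 2 * (- b / s)) powr (- real (card J) / 2))"
    by (subst nn_integral_gaussian_exp_linear) (use fin s in \<open>auto simp: field_simps\<close>)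
  also have "\<dots> = ennreal (s powr (- real (card I) / 2) * (1 + 2 * (- b / s)) powr (- real (card J) / 2))"
    by (simp add: ennreal_mult')
  also have "1 + 2 * (- b / s) = (s - 2 * b) / s" using s by (simp add: field_simps)
  also have "s powr (- real (card I) / 2) * ((s - 2 * b) / s) powr (- real (card J) / 2)
     = s powr (- (real (card I) - real (card J)) / 2) * (s - 2 * b) powr (- real (card J) / 2)"
  proof -
    have "s powr (- (real (card I) - real (card J)) / 2) = s powr (- real (card I) / 2 - (- real (card J) / 2))"
      by (simp add: field_simps)
    also have "\<dots> = s powr (- real (card I) / 2) / s powr (- real (card J) / 2)"
      by (rule powr_diff)
    finally show ?thesis using s by (simp add: powr_divide)
  qed
  finally show ?thesis by (simp add: s_def)
qed

section \<open>Real coordinates of complex matrices\<close>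

definition entry_index :: "nat \<Rightarrow> nat \<Rightarrow> (nat \<times> nat \<times> bool) set" where
  "entry_index s r = {..<s} \<times> {..<r} \<times> UNIV"

lemma finite_entry_index [simp]: "finite (entry_index s r)"
  by (simp add: entry_index_def)

lemma card_entry_index: "card (entry_index s r) = 2 * s * r"
  by (simp add: entry_index_def card_cartesian_product)

lemma sum_entry_index:
  fixes F :: "nat \<times> nat \<times> bool \<Rightarrow> real"
  shows "(\<Sum>p\<in>entry_index s r. F p) = (\<Sum>i<s. \<Sum>j<r. F (i, j, False) + F (i, j, True))"
  by (simp add: entry_index_def sum.cartesian_product' UNIV_bool add.commute)

text \<open>\<open>True\<close> marks the imaginary part. Real coordinates are kept because the
  triangular case below singles out the real parts of diagonal entries, which form no complex
  subspace.\<close>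

definition centry :: "(nat \<times> nat \<times> bool \<Rightarrow> real) \<Rightarrow> nat \<Rightarrow> nat \<Rightarrow> complex" where
  "centry x i j = Complex (x (i, j, False)) (x (i, j, True))"

lemma Re_centry [simp]: "Re (centry x i j) = x (i, j, False)"
  and Im_centry [simp]: "Im (centry x i j) = x (i, j, True)"
  by (simp_all add: centry_def)

lemma sum_square_entry_index:
  "(\<Sum>p\<in>entry_index s r. (x p)\<^sup>2) = (\<Sum>i<s. \<Sum>j<r. (cmod (centry x i j))\<^sup>2)"
  by (simp add: sum_entry_index cmod_power2)

lemma measurable_centry [measurable]:
  "(\<lambda>x. centry x i j) \<in> borel_measurable (gaussian (entry_index s r))"
proof -
  have "(\<lambda>x. x p) \<in> borel_measurable (gaussian (entry_index s r))" for p
  proof (cases "p \<in> entry_index s r")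
    \<comment> \<open>Points of a product space are extensional, so a coordinate outside the index
      set is the constant \<open>undefined\<close>.\<close>
    case False
    have "(\<lambda>x. x p) \<in> borel_measurable (gaussian (entry_index s r))
        \<longleftrightarrow> (\<lambda>x. undefined :: real) \<in> borel_measurable (gaussian (entry_index s r))"
      using False by (intro measurable_cong) (auto simp: space_PiM intro: PiE_arb)
    then show ?thesis by simp
  qed measurable
  then show ?thesis
    by (subst borel_measurable_complex_iff) simp
qed

definition part :: "bool \<Rightarrow> complex \<Rightarrow> real" where
  "part b z = (if b then Im z else Re z)"

lemma part_sum: "part b (\<Sum>i\<in>A. f i) = (\<Sum>i\<in>A. part b (f i))"
  unfolding part_def by (cases b) (simp_all only: if_True if_False Re_sum Im_sum)

text \<open>The functionals indexed by \<open>J\<close> are orthonormal in the real coordinates, so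
  the exponent is \<open>- a\<close> times the squared distance of a Gaussian vector from a real
  subspace of dimension \<open>card J\<close>. With \<open>b = a\<close> in
  \<open>nn_integral_gaussian_exp_orthonormal\<close> the directions in \<open>J\<close> contribute
  a power of 1, and only the codimension remains.\<close>

lemma nn_integral_gaussian_exp_complement:
  fixes u :: "nat \<Rightarrow> nat \<Rightarrow> complex"
  assumes orth: "\<And>a b. a < r \<Longrightarrow> b < r \<Longrightarrow> (\<Sum>i<s. cnj (u a i) * u b i) = (if a = b then 1 else 0)"
    and J: "J \<subseteq> entry_index r r" and a: "a \<ge> 0"
  shows "(\<integral>\<^sup>+x. ennreal (exp (- a * ((\<Sum>i<s. \<Sum>j<r. (cmod (centry x i j))\<^sup>2)
        - (\<Sum>(k, j, b)\<in>J. (part b (\<Sum>i<s. cnj (u k i) * centry x i j))\<^sup>2)))) \<partial>gaussian (entry_index s r))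
    = ennreal ((1 + 2 * a) powr (- (real (2 * s * r) - real (card J)) / 2))"
proof -
  \<comment> \<open>Coefficients of the functional indexed by \<open>(k, j, b)\<close>. Read as a
    complex matrix, they are the column \<open>u k\<close>, multiplied by \<open>\<i>\<close> if
    \<open>b\<close> holds, placed in column \<open>j\<close>.\<close>
  define e :: "nat \<times> nat \<times> bool \<Rightarrow> nat \<times> nat \<times> bool \<Rightarrow> real" where
    "e = (\<lambda>(k, j, b) (i, j', b'). if j' = j then
       (if b then (if b' then Re (u k i) else - Im (u k i)) else (if b' then Im (u k i) else Re (u k i))) else 0)"
  have J': "finite J" "\<And>k j b. (k, j, b) \<in> J \<Longrightarrow> k < r \<and> j < r"
    using J finite_subset by (fastforce simp: entry_index_def)+
  have e: "(\<Sum>p\<in>entry_index s r. e (k, j, b) p * x p) = part b (\<Sum>i<s. cnj (u k i) * centry x i j)"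
    if "j < r" for k j b x
  proof -
    have "(\<Sum>p\<in>entry_index s r. e (k, j, b) p * x p)
        = (\<Sum>i<s. \<Sum>j'<r. if j' = j then part b (cnj (u k i) * centry x i j) else 0)"
      unfolding sum_entry_index by (intro sum.cong) (auto simp: e_def part_def)
    also have "\<dots> = (\<Sum>i<s. part b (cnj (u k i) * centry x i j))"
      using that by simp
    also have "\<dots> = part b (\<Sum>i<s. cnj (u k i) * centry x i j)"
      by (simp only: part_sum)
    finally show ?thesis .
  qed
  have orthe: "(\<Sum>p\<in>entry_index s r. e t p * e t' p) = (if t = t' then 1 else 0)" if "t \<in> J" "t' \<in> J" for t t'
  proof -
    obtain k j b k' j' b' where t: "t = (k, j, b)" "t' = (k', j', b')" by (metis prod_cases3)
    have lt: "k < r" "j < r" "k' < r" "j' < r" using J' that t by auto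
    \<comment> \<open>The inner product is the functional \<open>e t\<close> evaluated at the matrix
      that \<open>e t'\<close> encodes. Real and imaginary functionals come out orthogonal because
      \<open>\<i>\<close> has real part 0 and 1 has imaginary part 0.\<close>
    have "(\<Sum>p\<in>entry_index s r. e t p * e t' p)
        = part b (\<Sum>i<s. cnj (u k i) * centry (e t') i j)"
      unfolding t(1) using e[OF lt(2)] .
    also have "(\<Sum>i<s. cnj (u k i) * centry (e t') i j)
        = (\<Sum>i<s. if j = j' then (if b' then \<i> else 1) * (cnj (u k i) * u k' i) else 0)"
      by (intro sum.cong) (auto simp: centry_def e_def t complex_eq_iff)
    also have "\<dots> = (if j = j' then (if b' then \<i> else 1) * (\<Sum>i<s. cnj (u k i) * u k' i) else 0)"
      by (simp add: sum_distrib_left)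
    also have "\<dots> = (if j = j' \<and> k = k' then (if b' then \<i> else 1) else 0)"
      unfolding orth[OF lt(1,3)] by simp
    also have "part b \<dots> = (if t = t' then 1 else 0)"
      by (auto simp: part_def t)
    finally show ?thesis .
  qed
  have "(\<Sum>(k, j, b)\<in>J. (part b (\<Sum>i<s. cnj (u k i) * centry x i j))\<^sup>2)
      = (\<Sum>t\<in>J. (\<Sum>p\<in>entry_index s r. e t p * x p)\<^sup>2)" for x
    by (intro sum.cong) (auto simp: e J')
  then have eq: "- a * ((\<Sum>i<s. \<Sum>j<r. (cmod (centry x i j))\<^sup>2)
        - (\<Sum>(k, j, b)\<in>J. (part b (\<Sum>i<s. cnj (u k i) * centry x i j))\<^sup>2))
     = - a * (\<Sum>p\<in>entry_index s r. (x p)\<^sup>2) + a * (\<Sum>t\<in>J. (\<Sum>p\<in>entry_index s r. e t p * x p)\<^sup>2)" for x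
    by (simp add: sum_square_entry_index algebra_simps)
  show ?thesis
    unfolding eq
    by (subst nn_integral_gaussian_exp_orthonormal) (use J' orthe a in \<open>auto simp: card_entry_index\<close>)
qed

subsection \<open>The operator norm of a Gaussian matrix\<close>

text \<open>A surrogate for the operator norm: by \<open>op_weight_ge\<close> it dominates the
  exponential of an eighth of its square, yet as an integral over an independent Gaussian vector it
  is measurable and has an expectation computable by Fubini.\<close>

definition op_weight :: "nat \<Rightarrow> nat \<Rightarrow> (nat \<times> nat \<times> bool \<Rightarrow> real) \<Rightarrow> ennreal" where
  "op_weight s r x = (\<integral>\<^sup>+w. ennreal (exp (sqrt (\<Sum>i<s. (cmod (\<Sum>j<r. centry x i j * centry w j 0))\<^sup>2) / 2))
     \<partial>gaussian (entry_index r 1))"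

lemma op_weight_measurable_pair:
  "(\<lambda>(x, w). ennreal (exp (sqrt (\<Sum>i<s. (cmod (\<Sum>j<r. centry x i j * centry w j 0))\<^sup>2) / 2)))
    \<in> borel_measurable (gaussian (entry_index s r) \<Otimes>\<^sub>M gaussian (entry_index r 1))"
proof -
  have [measurable]: "(\<lambda>p. centry (fst p) i j) \<in> borel_measurable (gaussian (entry_index s r) \<Otimes>\<^sub>M gaussian (entry_index r 1))"
    for i j using measurable_compose[OF measurable_fst measurable_centry] .
  have [measurable]: "(\<lambda>p. centry (snd p) i j) \<in> borel_measurable (gaussian (entry_index s r) \<Otimes>\<^sub>M gaussian (entry_index r 1))"
    for i j using measurable_compose[OF measurable_snd measurable_centry] .
  show ?thesis unfolding case_prod_beta by measurable
qed

text \<open>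
  Bounding the norm from below by the linear functional that supports it at the maximising
  vector turns the expectation into a moment generating function.
\<close>

lemma op_weight_ge:
  assumes y: "(\<Sum>i<s. (cmod (y i))\<^sup>2) = 1"
  shows "ennreal (exp ((\<Sum>j<r. (cmod (\<Sum>i<s. y i * centry x i j))\<^sup>2) / 8)) \<le> op_weight s r x"
proof -
  define z where "z j = (\<Sum>i<s. y i * centry x i j)" for j
  \<comment> \<open>Real coefficients of half the real part of the pairing of \<open>z\<close> with
    \<open>w\<close>. The halving gives (1/2)^2 / 2 = 1/8 in the moment generating function.\<close>
  define h :: "nat \<times> nat \<times> bool \<Rightarrow> real" where
    "h = (\<lambda>(j, _, b). if b then - Im (z j) / 2 else Re (z j) / 2)"
  let ?W = "\<lambda>w. sqrt (\<Sum>i<s. (cmod (\<Sum>j<r. centry x i j * centry w j 0))\<^sup>2)"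
  have lin: "(\<Sum>p\<in>entry_index r 1. - 0 * (w p)\<^sup>2 + h p * w p) \<le> ?W w / 2" for w
  proof -
    let ?v = "\<lambda>i. \<Sum>j<r. centry x i j * centry w j 0"
    have "(\<Sum>p\<in>entry_index r 1. - 0 * (w p)\<^sup>2 + h p * w p) = (\<Sum>j<r. Re (z j * centry w j 0)) / 2"
      by (simp add: sum_entry_index h_def sum_divide_distrib algebra_simps diff_divide_distrib)
    also have "(\<Sum>j<r. Re (z j * centry w j 0)) = Re (\<Sum>j<r. z j * centry w j 0)" by simp
    also have "(\<Sum>j<r. z j * centry w j 0) = (\<Sum>i<s. y i * ?v i)"
      by (simp add: z_def sum_distrib_left sum_distrib_right mult.assoc) (rule sum.swap)
    also have "Re \<dots> \<le> cmod (\<Sum>i<s. y i * ?v i)" by (rule complex_Re_le_cmod)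
    also have "\<dots> \<le> (\<Sum>i<s. \<bar>cmod (y i)\<bar> * \<bar>cmod (?v i)\<bar>)"
      by (rule sum_norm_le) (simp add: norm_mult)
    also have "\<dots> \<le> L2_set (\<lambda>i. cmod (y i)) {..<s} * L2_set (\<lambda>i. cmod (?v i)) {..<s}"
      by (rule L2_set_mult_ineq)
    also have "\<dots> = ?W w" by (simp add: L2_set_def y)
    finally show ?thesis by simp
  qed
  have "(\<Sum>p\<in>entry_index r 1. (h p)\<^sup>2) / 2 = (\<Sum>j<r. (cmod (z j))\<^sup>2) / 8"
    by (simp add: sum_entry_index h_def cmod_power2 power_divide sum_divide_distrib add_divide_distrib)
  then have "ennreal (exp ((\<Sum>j<r. (cmod (z j))\<^sup>2) / 8))
      = (\<integral>\<^sup>+w. ennreal (exp (\<Sum>p\<in>entry_index r 1. - 0 * (w p)\<^sup>2 + h p * w p)) \<partial>gaussian (entry_index r 1))"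
    by (subst nn_integral_gaussian_exp_linear) auto
  also have "\<dots> \<le> op_weight s r x"
    unfolding op_weight_def using lin by (intro nn_integral_mono ennreal_leI) simp
  finally show ?thesis by (simp add: z_def)
qed

text \<open>After division by \<open>sqrt W\<close>, the product of the matrix with \<open>w\<close>
  has \<open>2 s\<close> independent standard normal real coordinates. A quarter of the square of
  each has exponential moment \<open>sqrt 2\<close>.\<close>

lemma nn_integral_gaussian_exp_rows:
  fixes w :: "nat \<Rightarrow> complex" and r s :: nat
  defines "W \<equiv> \<Sum>j<r. (cmod (w j))\<^sup>2"
  assumes W: "W > 0"
  shows "(\<integral>\<^sup>+x. ennreal (exp ((\<Sum>i<s. (cmod (\<Sum>j<r. centry x i j * w j))\<^sup>2) / (4 * W)))
     \<partial>gaussian (entry_index s r)) = ennreal (2 ^ s)"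
proof -
  define J :: "(nat \<times> nat \<times> bool) set" where "J = entry_index s 1"
  define e :: "nat \<times> nat \<times> bool \<Rightarrow> nat \<times> nat \<times> bool \<Rightarrow> real" where
    "e = (\<lambda>(i, _, b) (i', j, b'). if i' = i then
       (if b then (if b' then Re (w j) else Im (w j)) else (if b' then - Im (w j) else Re (w j))) / sqrt W else 0)"
  have e: "(\<Sum>p\<in>entry_index s r. e (i, l, b) p * x p) = part b (\<Sum>j<r. centry x i j * w j) / sqrt W"
    if "i < s" for i l b x
  proof -
    have "(\<Sum>p\<in>entry_index s r. e (i, l, b) p * x p)
        = (\<Sum>i'<s. \<Sum>j<r. if i' = i then part b (centry x i j * w j) / sqrt W else 0)"
      unfolding sum_entry_index
      by (intro sum.cong refl; cases b)
        (auto simp: e_def part_def mult.commute add.commute diff_divide_distrib add_divide_distrib)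
    also have "\<dots> = (\<Sum>i'<s. if i' = i then (\<Sum>j<r. part b (centry x i j * w j) / sqrt W) else 0)"
      by (intro sum.cong refl) simp
    also have "\<dots> = (\<Sum>j<r. part b (centry x i j * w j) / sqrt W)"
      using that by simp
    also have "\<dots> = part b (\<Sum>j<r. centry x i j * w j) / sqrt W"
      by (simp only: part_sum sum_divide_distrib)
    finally show ?thesis .
  qed
  have Wc: "(\<Sum>j<r. cnj (w j) * w j) = complex_of_real W"
    unfolding W_def of_real_sum by (simp only: complex_norm_square mult.commute)
  have orthe: "(\<Sum>p\<in>entry_index s r. e t p * e t' p) = (if t = t' then 1 else 0)" if "t \<in> J" "t' \<in> J" for t t'
  proof -
    have "\<exists>i b. t = (i, 0, b) \<and> i < s" "\<exists>i b. t' = (i, 0, b) \<and> i < s"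
      using that by (auto simp: J_def entry_index_def)
    then obtain i b i' b' where t: "t = (i, 0, b)" "t' = (i', 0, b')" "i < s" "i' < s"
      by blast
    have "(\<Sum>p\<in>entry_index s r. e t p * e t' p)
        = part b (\<Sum>j<r. centry (e t') i j * w j) / sqrt W"
      unfolding t(1) using e[OF t(3)] .
    also have "(\<Sum>j<r. centry (e t') i j * w j)
        = (\<Sum>j<r. if i = i' then (if b' then \<i> else 1) * (cnj (w j) * w j) / complex_of_real (sqrt W) else 0)"
      using W by (intro sum.cong) (auto simp: centry_def e_def t complex_eq_iff field_simps)
    also have "\<dots> = (if i = i' then (if b' then \<i> else 1) * (\<Sum>j<r. cnj (w j) * w j) / complex_of_real (sqrt W) else 0)"
      by (simp add: sum_distrib_left sum_divide_distrib)
    also have "\<dots> = (if i = i' then (if b' then \<i> else 1) * complex_of_real (sqrt W) else 0)"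
    proof -
      have "complex_of_real W = complex_of_real (sqrt W) * complex_of_real (sqrt W)"
        using W by (simp flip: of_real_mult)
      then show ?thesis using W unfolding Wc by simp
    qed
    also have "part b \<dots> / sqrt W = (if t = t' then 1 else 0)"
      using W by (auto simp: part_def t)
    finally show ?thesis .
  qed
  have eq: "(\<Sum>i<s. (cmod (\<Sum>j<r. centry x i j * w j))\<^sup>2) / (4 * W)
      = - 0 * (\<Sum>p\<in>entry_index s r. (x p)\<^sup>2) + 1 / 4 * (\<Sum>t\<in>J. (\<Sum>p\<in>entry_index s r. e t p * x p)\<^sup>2)" for x
  proof -
    have sq: "(part False z / sqrt W)\<^sup>2 + (part True z / sqrt W)\<^sup>2 = (cmod z)\<^sup>2 / W" for z
      using W by (simp add: part_def power_divide cmod_power2 add_divide_distrib)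
    have "(\<Sum>t\<in>J. (\<Sum>p\<in>entry_index s r. e t p * x p)\<^sup>2)
        = (\<Sum>i<s. (part False (\<Sum>j<r. centry x i j * w j) / sqrt W)\<^sup>2 + (part True (\<Sum>j<r. centry x i j * w j) / sqrt W)\<^sup>2)"
      unfolding J_def sum_entry_index[of _ s 1] by (intro sum.cong) (simp_all add: e)
    also have "\<dots> = (\<Sum>i<s. (cmod (\<Sum>j<r. centry x i j * w j))\<^sup>2 / W)"
      by (simp only: sq)
    finally show ?thesis by (simp add: sum_divide_distrib sum_distrib_left)
  qed
  have "(\<integral>\<^sup>+x. ennreal (exp (- 0 * (\<Sum>p\<in>entry_index s r. (x p)\<^sup>2)
        + 1 / 4 * (\<Sum>t\<in>J. (\<Sum>p\<in>entry_index s r. e t p * x p)\<^sup>2))) \<partial>gaussian (entry_index s r))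
     = ennreal ((1 / 2) powr (- real s))"
    by (subst nn_integral_gaussian_exp_orthonormal) (use orthe in \<open>auto simp: J_def card_entry_index\<close>)
  also have "(1 / 2) powr (- real s) = (2 :: real) ^ s"
    by (simp add: powr_minus powr_realpow power_divide)
  finally show ?thesis unfolding eq .
qed

text \<open>For fixed \<open>w\<close> the inequality of the means separates the exponent into a
  function of \<open>w\<close> alone and a form normalised by the norm of \<open>w\<close>, whose
  moment \<open>2 ^ s\<close> does not depend on \<open>w\<close>. The first part then integrates to
  \<open>2 ^ r\<close>.\<close>

lemma nn_integral_op_weight_le:
  "(\<integral>\<^sup>+x. op_weight s r x \<partial>gaussian (entry_index s r)) \<le> ennreal (2 ^ (r + s))"
proof -
  interpret X: prob_space "gaussian (entry_index s r)" by (rule prob_space_gaussian)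
  interpret W: prob_space "gaussian (entry_index r 1)" by (rule prob_space_gaussian)
  interpret P: pair_sigma_finite "gaussian (entry_index s r)" "gaussian (entry_index r 1)" ..
  let ?N = "\<lambda>x w. \<Sum>i<s. (cmod (\<Sum>j<r. centry x i j * centry w j 0))\<^sup>2"
  let ?E = "\<lambda>w. exp ((\<Sum>p\<in>entry_index r 1. (w p)\<^sup>2) / 4)"
  have inner: "(\<integral>\<^sup>+x. ennreal (exp (sqrt (?N x w) / 2)) \<partial>gaussian (entry_index s r))
      \<le> ennreal (2 ^ s) * ennreal (?E w)" for w
  proof -
    define W where "W = (\<Sum>j<r. (cmod (centry w j 0))\<^sup>2)"
    have WE: "(\<Sum>p\<in>entry_index r 1. (w p)\<^sup>2) = W" by (simp add: sum_square_entry_index W_def)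
    have W0: "W \<ge> 0" by (simp add: W_def sum_nonneg)
    show ?thesis
    proof (cases "W = 0")
      case True
      then have "\<forall>j<r. centry w j 0 = 0"
        unfolding W_def by (subst (asm) sum_nonneg_eq_0_iff) auto
      then have "(\<integral>\<^sup>+x. ennreal (exp (sqrt (?N x w) / 2)) \<partial>gaussian (entry_index s r)) = 1"
        using X.emeasure_space_1 by simp
      also have "\<dots> \<le> ennreal (2 ^ s)" by simp
      finally show ?thesis using True WE by simp
    next
      case False
      then have W: "W > 0" using W0 by simp
      \<comment> \<open>The two terms balance when \<open>?N x w\<close> equals \<open>W^2\<close>.
        The coefficient 1/4 keeps both exponential moments finite, since 1/2 is the critical value
        for a standard normal square.\<close>
      have "sqrt (?N x w) / 2 \<le> W / 4 + ?N x w / (4 * W)" for x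
      proof -
        have N: "?N x w \<ge> 0" by (simp add: sum_nonneg)
        have "0 \<le> (sqrt W - sqrt (?N x w) / sqrt W)\<^sup>2" by simp
        also have "\<dots> = W - 2 * sqrt (?N x w) + ?N x w / W"
          using W N by (simp add: power2_diff power_divide)
        finally show ?thesis by (simp add: field_simps)
      qed
      then have "(\<integral>\<^sup>+x. ennreal (exp (sqrt (?N x w) / 2)) \<partial>gaussian (entry_index s r))
          \<le> (\<integral>\<^sup>+x. ennreal (exp (W / 4)) * ennreal (exp (?N x w / (4 * W))) \<partial>gaussian (entry_index s r))"
        by (intro nn_integral_mono) (simp flip: ennreal_mult' exp_add)
      also have "\<dots> = ennreal (exp (W / 4)) * (\<integral>\<^sup>+x. ennreal (exp (?N x w / (4 * W))) \<partial>gaussian (entry_index s r))"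
        by (rule nn_integral_cmult) measurable
      also have "(\<integral>\<^sup>+x. ennreal (exp (?N x w / (4 * W))) \<partial>gaussian (entry_index s r)) = ennreal (2 ^ s)"
        using nn_integral_gaussian_exp_rows[where w = "\<lambda>j. centry w j 0"] W by (simp add: W_def)
      finally show ?thesis unfolding WE by (simp add: mult.commute)
    qed
  qed
  have "(\<integral>\<^sup>+x. op_weight s r x \<partial>gaussian (entry_index s r))
     = (\<integral>\<^sup>+w. (\<integral>\<^sup>+x. ennreal (exp (sqrt (?N x w) / 2)) \<partial>gaussian (entry_index s r)) \<partial>gaussian (entry_index r 1))"
    unfolding op_weight_def using P.Fubini[OF op_weight_measurable_pair] by simp
  also have "\<dots> \<le> (\<integral>\<^sup>+w. ennreal (2 ^ s) * ennreal (?E w) \<partial>gaussian (entry_index r 1))"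
    by (intro nn_integral_mono inner)
  also have "\<dots> = ennreal (2 ^ s) * (\<integral>\<^sup>+w. ennreal (?E w) \<partial>gaussian (entry_index r 1))"
    by (intro nn_integral_cmult) measurable
  also have "(\<integral>\<^sup>+w. ennreal (?E w) \<partial>gaussian (entry_index r 1))
     = (\<integral>\<^sup>+w. ennreal (exp (\<Sum>p\<in>entry_index r 1. - (- 1 / 4) * (w p)\<^sup>2 + 0 * w p)) \<partial>gaussian (entry_index r 1))"
    by (simp add: sum_divide_distrib)
  also have "\<dots> = ennreal ((1 / 2) powr (- real r))"
    by (subst nn_integral_gaussian_exp_linear) (auto simp: card_entry_index)
  also have "(1 / 2) powr (- real r) = (2 :: real) ^ r"
    by (simp add: powr_minus powr_realpow power_divide)
  finally show ?thesis by (simp add: power_add ennreal_mult' mult.commute)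
qed

text \<open>Markov's inequality for \<open>op_weight\<close>, followed by
  \<open>op_weight_ge\<close> for every normalised \<open>y\<close> at once. What matters later is
  the linear growth in \<open>s\<close>; probability 1/2 suffices because it only costs a factor
  2.\<close>

lemma gaussian_op_bound:
  assumes "0 < r" "r \<le> s"
  shows "\<exists>A\<in>sets (gaussian (entry_index s r)). emeasure (gaussian (entry_index s r)) A \<ge> ennreal (1 / 2) \<and>
    (\<forall>x\<in>A. \<forall>y. (\<Sum>j<r. (cmod (\<Sum>i<s. y i * centry x i j))\<^sup>2) \<le> 24 * real s * (\<Sum>i<s. (cmod (y i))\<^sup>2))"
proof -
  let ?\<gamma> = "gaussian (entry_index s r)"
  interpret X: prob_space ?\<gamma> by (rule prob_space_gaussian)
  interpret W: prob_space "gaussian (entry_index r 1)" by (rule prob_space_gaussian)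
  have meas [measurable]: "op_weight s r \<in> borel_measurable ?\<gamma>"
    unfolding op_weight_def using op_weight_measurable_pair
    by (intro W.borel_measurable_nn_integral) simp
  \<comment> \<open>Twice the bound \<open>2 ^ (r + s) \<le> 4 ^ s\<close> on the mean, so that the
    exceptional set \<open>B\<close> has probability at most 1/2.\<close>
  define K where "K = ennreal (2 * 4 ^ s)"
  define A where "A = {x \<in> space ?\<gamma>. op_weight s r x \<le> K}"
  define B where "B = {x \<in> space ?\<gamma>. op_weight s r x > K}"
  have sets: "A \<in> sets ?\<gamma>" "B \<in> sets ?\<gamma>" unfolding A_def B_def by measurable
  have "K * emeasure ?\<gamma> B = (\<integral>\<^sup>+x. K * indicator B x \<partial>?\<gamma>)"
    using sets by (simp add: nn_integral_cmult_indicator)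
  also have "\<dots> \<le> (\<integral>\<^sup>+x. op_weight s r x \<partial>?\<gamma>)"
    by (intro nn_integral_mono) (auto simp: B_def split: split_indicator)
  also have "\<dots> \<le> ennreal (2 ^ (r + s))" by (rule nn_integral_op_weight_le)
  also have "\<dots> \<le> ennreal (4 ^ s)"
  proof (rule ennreal_leI)
    have "(2::real) ^ (r + s) \<le> 2 ^ (s + s)" using assms by (intro power_increasing) auto
    also have "\<dots> = 4 ^ s" by (simp add: power_add flip: power_mult_distrib)
    finally show "(2::real) ^ (r + s) \<le> 4 ^ s" .
  qed
  finally have "ennreal (2 * 4 ^ s * X.prob B) \<le> ennreal (4 ^ s)"
    by (simp add: K_def X.emeasure_eq_measure ennreal_mult')
  then have "2 * 4 ^ s * X.prob B \<le> 4 ^ s" by (subst (asm) ennreal_le_iff) auto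
  then have PB: "X.prob B \<le> 1 / 2" by (simp add: field_simps)
  have "A = space ?\<gamma> - B" by (auto simp: A_def B_def)
  then have "X.prob A \<ge> 1 / 2" using PB X.prob_compl[OF sets(2)] by simp
  moreover have "(\<Sum>j<r. (cmod (\<Sum>i<s. y i * centry x i j))\<^sup>2) \<le> 24 * real s * (\<Sum>i<s. (cmod (y i))\<^sup>2)"
    if x: "x \<in> A" for x y
  proof (cases "(\<Sum>i<s. (cmod (y i))\<^sup>2) = 0")
    case True
    then have "\<forall>i<s. y i = 0" by (subst (asm) sum_nonneg_eq_0_iff) auto
    then show ?thesis by simp
  next
    case False
    define N where "N = (\<Sum>i<s. (cmod (y i))\<^sup>2)"
    have N: "N > 0" using False by (simp add: N_def sum_nonneg less_le)
    let ?y = "\<lambda>i. y i / complex_of_real (sqrt N)"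
    have "(\<Sum>i<s. (cmod (?y i))\<^sup>2) = 1"
      using N by (simp add: norm_divide power_divide flip: sum_divide_distrib) (simp add: N_def)
    then have "ennreal (exp ((\<Sum>j<r. (cmod (\<Sum>i<s. ?y i * centry x i j))\<^sup>2) / 8)) \<le> op_weight s r x"
      by (rule op_weight_ge)
    also have "\<dots> \<le> ennreal (2 * 4 ^ s)" using x by (simp add: A_def K_def)
    finally have "exp ((\<Sum>j<r. (cmod (\<Sum>i<s. ?y i * centry x i j))\<^sup>2) / 8) \<le> 2 * 4 ^ s"
      by (subst (asm) ennreal_le_iff) auto
    \<comment> \<open>Together with the eighth in the exponent this gives 24 = 8 * 3. The leading 2
      is absorbed into \<open>2 ^ s\<close>, which uses \<open>s\<close> at least 1.\<close>
    also have "(2::real) * 4 ^ s \<le> exp (3 * real s)"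
    proof -
      have e1: "(2::real) \<le> exp 1" using exp_ge_add_one_self[of 1] by simp
      have "(2::real) \<le> 2 ^ s" using assms by (intro self_le_power) auto
      then have "(2::real) * 4 ^ s \<le> 2 ^ s * 4 ^ s" by (intro mult_right_mono) auto
      also have "\<dots> = (2 ^ 3) ^ s" by (simp flip: power_mult_distrib)
      also have "\<dots> = 2 ^ (3 * s)" by (simp only: power_mult)
      also have "\<dots> \<le> exp 1 ^ (3 * s)" using e1 by (intro power_mono) auto
      also have "\<dots> = exp (3 * real s)" by (simp flip: exp_of_nat_mult)
      finally show ?thesis .
    qed
    finally have "(\<Sum>j<r. (cmod (\<Sum>i<s. ?y i * centry x i j))\<^sup>2) \<le> 24 * real s" by simp
    moreover have "(\<Sum>j<r. (cmod (\<Sum>i<s. ?y i * centry x i j))\<^sup>2) = (\<Sum>j<r. (cmod (\<Sum>i<s. y i * centry x i j))\<^sup>2) / N"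
    proof -
      have "(\<Sum>i<s. ?y i * centry x i j) = (\<Sum>i<s. y i * centry x i j) / complex_of_real (sqrt N)" for j
        by (simp add: sum_divide_distrib)
      then show ?thesis using N by (simp only:) (simp add: norm_divide power_divide flip: sum_divide_distrib)
    qed
    ultimately have "(\<Sum>j<r. (cmod (\<Sum>i<s. y i * centry x i j))\<^sup>2) / N \<le> 24 * real s"
      by (simp only:)
    then show ?thesis using N by (simp add: N_def[symmetric] field_simps)
  qed
  moreover have "emeasure ?\<gamma> A \<ge> ennreal (1 / 2)"
    unfolding X.emeasure_eq_measure by (rule ennreal_leI) fact
  ultimately show ?thesis using sets(1) by blast
qed

section \<open>Frobenius norm and Stiefel manifold\<close>

lemma mat_adjoint_carrier [simp, intro]:
  "A \<in> carrier_mat n k \<Longrightarrow> mat_adjoint A \<in> carrier_mat k n"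
  by (auto simp: mat_adjoint_def)

lemma dim_mat_adjoint [simp]:
  "dim_row (mat_adjoint A) = dim_col A" "dim_col (mat_adjoint A) = dim_row A"
  by (auto simp: mat_adjoint_def)

lemma index_mat_adjoint [simp]:
  fixes A :: "complex mat"
  shows "i < dim_col A \<Longrightarrow> j < dim_row A \<Longrightarrow> mat_adjoint A $$ (i, j) = cnj (A $$ (j, i))"
  by (auto simp: mat_adjoint_def mat_of_rows_def)

lemma mat_adjoint_adjoint [simp]: "mat_adjoint (mat_adjoint A) = (A :: complex mat)"
  by (rule eq_matI) auto

lemma mat_adjoint_minus:
  fixes A :: "complex mat"
  assumes "A \<in> carrier_mat n k" "B \<in> carrier_mat n k"
  shows "mat_adjoint (A - B) = mat_adjoint A - mat_adjoint B"
  by (rule eq_matI) (use assms in auto)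

lemma index_mult_mat_sum:
  "i < dim_row A \<Longrightarrow> j < dim_col B \<Longrightarrow> dim_col A = dim_row B \<Longrightarrow>
    (A * B) $$ (i, j) = (\<Sum>k<dim_row B. A $$ (i, k) * B $$ (k, j))"
  by (simp add: scalar_prod_def atLeast0LessThan)

lemma mat_adjoint_mult:
  fixes A :: "complex mat"
  assumes "A \<in> carrier_mat n k" "B \<in> carrier_mat k l"
  shows "mat_adjoint (A * B) = mat_adjoint B * mat_adjoint A"
  by (rule eq_matI) (use assms in \<open>auto simp: index_mult_mat_sum mult.commute simp del: index_mult_mat(1)\<close>)

definition fro2 :: "complex mat \<Rightarrow> real" where
  "fro2 A = (\<Sum>i<dim_row A. \<Sum>j<dim_col A. (cmod (A $$ (i, j)))\<^sup>2)"

lemma fro2_nonneg [simp]: "fro2 A \<ge> 0"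
  by (simp add: fro2_def sum_nonneg)

lemma frobenius_norm_power2: "(frobenius_norm A)\<^sup>2 = fro2 A"
  by (simp add: frobenius_norm_def fro2_def sum_nonneg)

lemma fro2_adjoint [simp]: "fro2 (mat_adjoint A) = fro2 A"
  unfolding fro2_def by (subst sum.swap) simp

lemma fro2_minus_commute:
  assumes "A \<in> carrier_mat n k" "B \<in> carrier_mat n k"
  shows "fro2 (A - B) = fro2 (B - A)"
  using assms by (simp add: fro2_def norm_minus_commute)

text \<open>The squared norm as a trace, so that norm identities reduce to matrix algebra on
  diagonal entries.\<close>

lemma fro2_conv_gram:
  "complex_of_real (fro2 A) = (\<Sum>j<dim_col A. (mat_adjoint A * A) $$ (j, j))"
proof -
  have "complex_of_real ((cmod z)\<^sup>2) = cnj z * z" for z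
    by (simp only: complex_norm_square mult.commute)
  then have "complex_of_real (fro2 A) = (\<Sum>j<dim_col A. \<Sum>i<dim_row A. cnj (A $$ (i, j)) * A $$ (i, j))"
    unfolding fro2_def by (subst sum.swap) (simp only: of_real_sum)
  also have "\<dots> = (\<Sum>j<dim_col A. (mat_adjoint A * A) $$ (j, j))"
    by (intro sum.cong refl) (simp add: index_mult_mat_sum del: index_mult_mat(1))
  finally show ?thesis .
qed

lemma fro2_diff_le:
  assumes "A \<in> carrier_mat n k" "B \<in> carrier_mat n k" "C \<in> carrier_mat n k"
  shows "fro2 (A - C) \<le> 2 * fro2 (A - B) + 2 * fro2 (B - C)"
proof -
  have "(cmod (x - z))\<^sup>2 \<le> 2 * (cmod (x - y))\<^sup>2 + 2 * (cmod (y - z))\<^sup>2" for x y z :: complex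
  proof -
    have "cmod (x - z) \<le> cmod (x - y) + cmod (y - z)"
      using norm_triangle_ineq[of "x - y" "y - z"] by simp
    then have "(cmod (x - z))\<^sup>2 \<le> (cmod (x - y) + cmod (y - z))\<^sup>2"
      by (intro power_mono) auto
    also have "\<dots> \<le> 2 * (cmod (x - y))\<^sup>2 + 2 * (cmod (y - z))\<^sup>2"
      using sum_squares_bound[of "cmod (x - y)" "cmod (y - z)"] by (simp add: power2_sum)
    finally show ?thesis .
  qed
  note pointwise = this
  have "fro2 (A - C) = (\<Sum>i<n. \<Sum>j<k. (cmod (A $$ (i, j) - C $$ (i, j)))\<^sup>2)"
    using assms by (simp add: fro2_def)
  also have "\<dots> \<le> (\<Sum>i<n. \<Sum>j<k. 2 * (cmod (A $$ (i, j) - B $$ (i, j)))\<^sup>2 + 2 * (cmod (B $$ (i, j) - C $$ (i, j)))\<^sup>2)"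
    by (intro sum_mono pointwise)
  also have "\<dots> = 2 * fro2 (A - B) + 2 * fro2 (B - C)"
    using assms by (auto simp: fro2_def sum.distrib sum_distrib_left)
  finally show ?thesis .
qed

lemma stiefelD:
  assumes "V \<in> stiefel n r"
  shows "V \<in> carrier_mat n r" "mat_adjoint V * V = 1\<^sub>m r"
  using assms by (auto simp: stiefel_def)

text \<open>Pythagoras: the part of \<open>A\<close> orthogonal to the range of \<open>U\<close>
  contributes the first two terms, and within the range multiplication by \<open>U\<close> is
  isometric. The projection and isometry facts below are the cases where \<open>T\<close> is the
  projection coefficient or \<open>A\<close> is zero.\<close>

lemma fro2_diff_stiefel_mult:
  assumes U: "U \<in> stiefel n r" and A: "A \<in> carrier_mat n k" and T: "T \<in> carrier_mat r k"
  shows "fro2 (A - U * T) = fro2 A - fro2 (mat_adjoint U * A) + fro2 (mat_adjoint U * A - T)"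
proof -
  note Uc = stiefelD(1)[OF U]
  define B where "B = mat_adjoint U * A"
  have B: "B \<in> carrier_mat r k" using Uc A by (auto simp: B_def)
  have Ba: "mat_adjoint B = mat_adjoint A * U"
    using Uc A by (simp add: B_def mat_adjoint_mult[of _ r n _ k])
  have 1: "mat_adjoint (A - U * T) * (A - U * T)
      = mat_adjoint A * A - mat_adjoint A * (U * T) - (mat_adjoint T * B - mat_adjoint T * T)"
  proof -
    have "mat_adjoint (A - U * T) = mat_adjoint A - mat_adjoint T * mat_adjoint U"
      using Uc A T by (simp add: mat_adjoint_minus[of _ n k] mat_adjoint_mult[of _ n r _ k])
    also have "\<dots> * (A - U * T) = mat_adjoint A * (A - U * T) - mat_adjoint T * mat_adjoint U * (A - U * T)"
      using Uc A T by (intro minus_mult_distrib_mat[where nr=k and n=n and nc=k]) auto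
    also have "mat_adjoint A * (A - U * T) = mat_adjoint A * A - mat_adjoint A * (U * T)"
      using Uc A T by (intro mult_minus_distrib_mat[where nr=k and n=n and nc=k]) auto
    also have "mat_adjoint T * mat_adjoint U * (A - U * T) = mat_adjoint T * (mat_adjoint U * (A - U * T))"
      using Uc A T by (intro assoc_mult_mat[where n\<^sub>1=k and n\<^sub>2=r and n\<^sub>3=n and n\<^sub>4=k]) auto
    also have "mat_adjoint U * (A - U * T) = B - mat_adjoint U * (U * T)"
      unfolding B_def using Uc A T by (intro mult_minus_distrib_mat[where nr=r and n=n and nc=k]) auto
    also have "mat_adjoint U * (U * T) = mat_adjoint U * U * T"
      using Uc A T by (intro assoc_mult_mat[symmetric, where n\<^sub>1=r and n\<^sub>2=n and n\<^sub>3=r and n\<^sub>4=k]) auto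
    also have "\<dots> = T" using stiefelD(2)[OF U] T by simp
    also have "mat_adjoint T * (B - T) = mat_adjoint T * B - mat_adjoint T * T"
      using T B by (intro mult_minus_distrib_mat[where nr=k and n=r and nc=k]) auto
    finally show ?thesis .
  qed
  have 2: "mat_adjoint A * (U * T) = mat_adjoint B * T"
    unfolding Ba using Uc A T
    by (intro assoc_mult_mat[symmetric, where n\<^sub>1=k and n\<^sub>2=n and n\<^sub>3=r and n\<^sub>4=k]) auto
  have 3: "mat_adjoint (B - T) * (B - T)
      = mat_adjoint B * B - mat_adjoint B * T - (mat_adjoint T * B - mat_adjoint T * T)"
  proof -
    have "mat_adjoint (B - T) = mat_adjoint B - mat_adjoint T"
      using B T by (rule mat_adjoint_minus)
    also have "\<dots> * (B - T) = mat_adjoint B * (B - T) - mat_adjoint T * (B - T)"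
      using B T by (intro minus_mult_distrib_mat[where nr=k and n=r and nc=k]) auto
    finally show ?thesis
      using B T by (simp add: mult_minus_distrib_mat[where nr=k and n=r and nc=k])
  qed
  have d: "dim_col (A - U * T) = k" "dim_col A = k" "dim_col B = k" "dim_col (B - T) = k"
    using Uc A T B by auto
  have "complex_of_real (fro2 (A - U * T))
      = complex_of_real (fro2 A) - complex_of_real (fro2 B) + complex_of_real (fro2 (B - T))"
    unfolding fro2_conv_gram d sum_subtractf[symmetric] sum.distrib[symmetric]
  proof (rule sum.cong)
    fix j assume "j \<in> {..<k}"
    then have j: "j < k" by simp
    show "(mat_adjoint (A - U * T) * (A - U * T)) $$ (j, j) = (mat_adjoint A * A) $$ (j, j)
        - (mat_adjoint B * B) $$ (j, j) + (mat_adjoint (B - T) * (B - T)) $$ (j, j)"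
      unfolding 1 2 3 using A B T j by (simp del: index_mult_mat(1))
  qed simp
  then have "complex_of_real (fro2 (A - U * T)) = complex_of_real (fro2 A - fro2 B + fro2 (B - T))"
    by (simp only: of_real_diff of_real_add)
  then show ?thesis
    by (simp only: of_real_eq_iff B_def)
qed

lemma fro2_zero_minus:
  assumes "A \<in> carrier_mat n k"
  shows "fro2 (0\<^sub>m n k - A) = fro2 A"
  using assms by (simp add: fro2_def)

lemma fro2_zero [simp]: "fro2 (0\<^sub>m n k) = 0"
  by (simp add: fro2_def)

lemma fro2_stiefel_mult:
  assumes U: "U \<in> stiefel n r" and T: "T \<in> carrier_mat r k"
  shows "fro2 (U * T) = fro2 T"
proof -
  have "mat_adjoint U * 0\<^sub>m n k = 0\<^sub>m r k" "U * T \<in> carrier_mat n k"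
    using stiefelD(1)[OF U] T by auto
  then show ?thesis
    using fro2_diff_stiefel_mult[OF U zero_carrier_mat T] T by (simp add: fro2_zero_minus)
qed

lemma fro2_mult_stiefel_adjoint:
  assumes U: "U \<in> stiefel n r" and T: "T \<in> carrier_mat k r"
  shows "fro2 (T * mat_adjoint U) = fro2 T"
proof -
  have "fro2 (T * mat_adjoint U) = fro2 (mat_adjoint (T * mat_adjoint U))" by simp
  also have "mat_adjoint (T * mat_adjoint U) = U * mat_adjoint T"
    using stiefelD(1)[OF U] T by (simp add: mat_adjoint_mult[of _ k r _ n])
  also have "fro2 \<dots> = fro2 T" using U T by (simp add: fro2_stiefel_mult[of _ n r _ k])
  finally show ?thesis .
qed

lemma fro2_stiefel_complement:
  assumes U: "U \<in> stiefel n r" and A: "A \<in> carrier_mat n k"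
  shows "fro2 (A - U * (mat_adjoint U * A)) = fro2 A - fro2 (mat_adjoint U * A)"
proof -
  have c: "mat_adjoint U * A \<in> carrier_mat r k" using stiefelD(1)[OF U] A by auto
  then have "mat_adjoint U * A - mat_adjoint U * A = 0\<^sub>m r k" by auto
  then show ?thesis using fro2_diff_stiefel_mult[OF U A c] by simp
qed

lemma fro2_adjoint_stiefel_mult_le:
  assumes U: "U \<in> stiefel n r" and A: "A \<in> carrier_mat n k"
  shows "fro2 (mat_adjoint U * A) \<le> fro2 A"
  using fro2_stiefel_complement[OF assms] fro2_nonneg[of "A - U * (mat_adjoint U * A)"] by simp

lemma fro2_one: "fro2 (1\<^sub>m r) = real r"
proof -
  have "(cmod (if i = j then 1 else 0))\<^sup>2 = (if i = j then 1 else 0 :: real)" for i j :: nat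
    by simp
  then show ?thesis by (simp add: fro2_def)
qed

lemma fro2_stiefel: "U \<in> stiefel n r \<Longrightarrow> fro2 U = real r"
  using fro2_stiefel_mult[of U n r "1\<^sub>m r" r] stiefelD(1)[of U n r] by (simp add: fro2_one)

text \<open>The operator norm enters only as a bound on the action of \<open>G\<close> on row
  vectors; it is applied to each row of \<open>M\<close>.\<close>

lemma fro2_mult_le:
  assumes M: "M \<in> carrier_mat l n" and G: "G \<in> carrier_mat n k" and R: "R \<ge> 0"
    and bound: "\<And>y. (\<Sum>j<k. (cmod (\<Sum>i<n. y i * G $$ (i, j)))\<^sup>2) \<le> R * (\<Sum>i<n. (cmod (y i))\<^sup>2)"
  shows "fro2 (M * G) \<le> R * fro2 M"
proof -
  have "fro2 (M * G) = (\<Sum>i<l. \<Sum>j<k. (cmod (\<Sum>m<n. M $$ (i, m) * G $$ (m, j)))\<^sup>2)"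
    using M G by (simp add: fro2_def index_mult_mat_sum del: index_mult_mat(1))
  also have "\<dots> \<le> (\<Sum>i<l. R * (\<Sum>m<n. (cmod (M $$ (i, m)))\<^sup>2))"
    by (intro sum_mono bound)
  also have "\<dots> = R * fro2 M" using M by (simp add: fro2_def sum_distrib_left)
  finally show ?thesis .
qed

section \<open>Orthonormal families, unitary completion and QR decomposition\<close>

definition orthonormal :: "nat \<Rightarrow> nat \<Rightarrow> (nat \<Rightarrow> nat \<Rightarrow> complex) \<Rightarrow> bool" where
  "orthonormal s r q \<longleftrightarrow>
     (\<forall>a<r. \<forall>b<r. (\<Sum>i<s. cnj (q a i) * q b i) = (if a = b then 1 else 0))"

lemma mat_in_stiefel:
  "orthonormal s r q \<Longrightarrow> mat s r (\<lambda>(i, a). q a i) \<in> stiefel s r"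
  unfolding stiefel_def orthonormal_def
  by (auto intro!: eq_matI simp: index_mult_mat_sum simp del: index_mult_mat(1))

lemma stiefel_sum:
  assumes "V \<in> stiefel n r" "a < r" "b < r"
  shows "(\<Sum>i<n. cnj (V $$ (i, a)) * V $$ (i, b)) = (if a = b then 1 else 0)"
proof -
  have V: "dim_row V = n" "dim_col V = r" using stiefelD(1)[OF assms(1)] by auto
  have "(mat_adjoint V * V) $$ (a, b) = (\<Sum>i<n. cnj (V $$ (i, a)) * V $$ (i, b))"
    using assms V by (simp add: index_mult_mat_sum del: index_mult_mat(1))
  then show ?thesis
    using stiefelD(2)[OF assms(1)] assms by simp
qed

lemma orthonormal_stiefel:
  "V \<in> stiefel n r \<Longrightarrow> orthonormal n r (\<lambda>a i. V $$ (i, a))"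
  by (simp add: orthonormal_def stiefel_sum)

text \<open>Fewer than \<open>s\<close> linear conditions on \<open>s\<close> unknowns: padded with
  zero rows, their matrix is square and singular, and a kernel vector can be normalised.\<close>

lemma exists_unit_orthogonal:
  fixes q :: "nat \<Rightarrow> nat \<Rightarrow> complex"
  assumes "r < s"
  shows "\<exists>v. (\<Sum>i<s. cnj (v i) * v i) = 1 \<and> (\<forall>a<r. (\<Sum>i<s. cnj (q a i) * v i) = 0)"
proof -
  define M where "M = mat s s (\<lambda>(a, i). if a < r then cnj (q a i) else 0)"
  have M: "M \<in> carrier_mat s s" by (auto simp: M_def)
  have "det M = 0"
  proof -
    have "row M r = 0\<^sub>v s" using assms by (auto simp: M_def)
    \<comment> \<open>Row \<open>r\<close> is zero, so scaling it by 0 changes nothing and the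
      determinant equals 0 times itself.\<close>
    then have "multrow r 0 M = M" using assms by (intro eq_matI) (auto simp: M_def)
    moreover have "det (multrow r 0 M) = 0 * det M"
      using det_multrow[OF assms M] by simp
    ultimately show ?thesis by simp
  qed
  then obtain w where w: "w \<in> carrier_vec s" "w \<noteq> 0\<^sub>v s" "M *\<^sub>v w = 0\<^sub>v s"
    using det_0_iff_vec_prod_zero_field[OF M] by blast
  define N where "N = (\<Sum>i<s. (cmod (w $ i))\<^sup>2)"
  obtain i where "i < s" "w $ i \<noteq> 0"
    using w by (metis carrier_vecD eq_vecI index_zero_vec(1,2))
  then have N: "N > 0" unfolding N_def by (intro sum_pos2[of _ i]) auto
  have 1: "(\<Sum>i<s. cnj (w $ i) * w $ i) = of_real N"
    unfolding N_def of_real_sum by (simp only: complex_norm_square mult.commute)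
  have 2: "(\<Sum>i<s. cnj (q a i) * w $ i) = 0" if "a < r" for a
  proof -
    have "(M *\<^sub>v w) $ a = (\<Sum>i<s. cnj (q a i) * w $ i)"
      using that assms w(1) by (simp add: M_def scalar_prod_def atLeast0LessThan)
    then show ?thesis using w(3) that assms by simp
  qed
  let ?v = "\<lambda>i. w $ i / of_real (sqrt N)"
  have "(\<Sum>i<s. cnj (?v i) * ?v i) = (\<Sum>i<s. cnj (w $ i) * w $ i) / (of_real (sqrt N) * of_real (sqrt N))"
    by (simp add: sum_divide_distrib)
  also have "\<dots> = 1"
    unfolding 1 of_real_mult[symmetric] using N by simp
  finally have "(\<Sum>i<s. cnj (?v i) * ?v i) = 1" .
  moreover have "(\<Sum>i<s. cnj (q a i) * ?v i) = 0" if "a < r" for a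
    using 2[OF that] by (simp add: sum_divide_distrib[symmetric])
  ultimately show ?thesis by (intro exI[of _ ?v]) auto
qed

lemma orthonormal_Suc:
  assumes "orthonormal s r q" "(\<Sum>i<s. cnj (v i) * v i) = 1"
    and orth: "\<And>a. a < r \<Longrightarrow> (\<Sum>i<s. cnj (q a i) * v i) = 0"
  shows "orthonormal s (Suc r) (q(r := v))"
proof -
  have "(\<Sum>i<s. cnj (v i) * q a i) = 0" if "a < r" for a
  proof -
    have "(\<Sum>i<s. cnj (v i) * q a i) = cnj (\<Sum>i<s. cnj (q a i) * v i)"
      by (simp add: mult.commute)
    then show ?thesis using orth[OF that] by simp
  qed
  then show ?thesis
    using assms by (auto simp: orthonormal_def less_Suc_eq)
qed

lemma orthonormal_extend:
  assumes "orthonormal s r q" "r \<le> t" "t \<le> s"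
  shows "\<exists>q'. orthonormal s t q' \<and> (\<forall>a<r. q' a = q a)"
  using assms(2,3)
proof (induction t rule: dec_induct)
  case base
  then show ?case using assms(1) by blast
next
  case (step t)
  then obtain q' where q': "orthonormal s t q'" "\<forall>a<r. q' a = q a" by auto
  obtain v where "(\<Sum>i<s. cnj (v i) * v i) = 1" "\<forall>a<t. (\<Sum>i<s. cnj (q' a i) * v i) = 0"
    using exists_unit_orthogonal[of t s q'] step by auto
  then have "orthonormal s (Suc t) (q'(t := v))" using orthonormal_Suc q' by blast
  moreover have "\<forall>a<r. (q'(t := v)) a = q a" using q'(2) step(1) by auto
  ultimately show ?case by blast
qed

text \<open>The columns of \<open>Q\<close> extend to an orthonormal basis, and the rectangular
  identity selects the first \<open>r\<close> of its vectors.\<close>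

lemma stiefel_completion:
  assumes Q: "Q \<in> stiefel s r" and "r \<le> s"
  shows "\<exists>P\<in>stiefel s s. P * mat s r (\<lambda>(i, j). if i = j then 1 else 0) = Q"
proof -
  obtain q' where q': "orthonormal s s q'" "\<forall>a<r. q' a = (\<lambda>i. Q $$ (i, a))"
    using orthonormal_extend[OF orthonormal_stiefel[OF Q] assms(2)] by auto
  let ?P = "mat s s (\<lambda>(i, a). q' a i)"
  have "?P * mat s r (\<lambda>(i, j). if i = j then 1 else 0) = Q"
    using stiefelD(1)[OF Q] q'(2) assms(2)
    by (intro eq_matI) (auto simp: index_mult_mat_sum if_distrib cong: if_cong simp del: index_mult_mat(1))
  then show ?thesis using mat_in_stiefel[OF q'(1)] by blast
qed

lemma stiefel_mult:
  assumes A: "A \<in> stiefel n k" and B: "B \<in> stiefel k r"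
  shows "A * B \<in> stiefel n r"
proof -
  note c = stiefelD(1)[OF A] stiefelD(1)[OF B]
  have "mat_adjoint (A * B) * (A * B) = mat_adjoint B * (mat_adjoint A * (A * B))"
    using c by (simp add: mat_adjoint_mult[of A n k B r] assoc_mult_mat[of _ r k _ n _ r])
  also have "mat_adjoint A * (A * B) = mat_adjoint A * A * B"
    using c by (simp add: assoc_mult_mat[of _ k n _ k _ r])
  also have "\<dots> = B" using c stiefelD(2)[OF A] by simp
  finally show ?thesis
    using c stiefelD(2)[OF B] by (auto simp: stiefel_def)
qed

lemma unitary_adjoint:
  assumes P: "P \<in> stiefel s s"
  shows "mat_adjoint P \<in> stiefel s s"
  using mat_mult_left_right_inverse[of "mat_adjoint P" s P] stiefelD[OF P]
  by (auto simp: stiefel_def)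

text \<open>Both points are images of the same rectangular identity under unitaries \<open>P\<close>
  and \<open>P'\<close>. This transitivity lets the reference point of a Laplace transform be moved
  anywhere on the Stiefel manifold.\<close>

lemma unitary_transitive:
  assumes Q: "Q \<in> stiefel s r" and Q': "Q' \<in> stiefel s r" and "r \<le> s"
  shows "\<exists>\<Omega>\<in>stiefel s s. \<Omega> * Q = Q'"
proof -
  define E where "E = (mat s r (\<lambda>(i, j). if i = j then 1 else 0) :: complex mat)"
  have E: "E \<in> carrier_mat s r" by (auto simp: E_def)
  obtain P where P: "P \<in> stiefel s s" "P * E = Q"
    using stiefel_completion[OF Q \<open>r \<le> s\<close>] by (auto simp: E_def)
  obtain P' where P': "P' \<in> stiefel s s" "P' * E = Q'"
    using stiefel_completion[OF Q' \<open>r \<le> s\<close>] by (auto simp: E_def)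
  note c = stiefelD(1)[OF P(1)] stiefelD(1)[OF P'(1)]
  have "P' * mat_adjoint P * Q = P' * (mat_adjoint P * (P * E))"
    unfolding P(2) using c stiefelD(1)[OF Q] by (simp add: assoc_mult_mat[of _ s s _ s _ r])
  also have "mat_adjoint P * (P * E) = mat_adjoint P * P * E"
    using c E by (simp add: assoc_mult_mat[of _ s s _ s _ r])
  also have "\<dots> = E" using stiefelD(2)[OF P(1)] E by simp
  finally have "P' * mat_adjoint P * Q = Q'" using P'(2) by simp
  moreover have "P' * mat_adjoint P \<in> stiefel s s"
    using stiefel_mult[OF P'(1) unitary_adjoint[OF P(1)]] .
  ultimately show ?thesis by blast
qed

text \<open>Gram-Schmidt for arbitrary, possibly dependent columns. The diagonal coefficient is the
  norm of the residual and therefore real, which later saves \<open>r\<close> real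
  dimensions.\<close>

lemma orthonormal_QR:
  fixes g :: "nat \<Rightarrow> nat \<Rightarrow> complex"
  assumes "r \<le> s"
  shows "\<exists>q c. orthonormal s r q \<and>
    (\<forall>j<r. Im (c j j) = 0 \<and> (\<forall>i<s. g j i = (\<Sum>a<Suc j. c j a * q a i)))"
  using assms
proof (induction r)
  case 0
  then show ?case by (auto simp: orthonormal_def)
next
  case (Suc r)
  then obtain q c where q: "orthonormal s r q"
    and c: "\<And>j. j < r \<Longrightarrow> Im (c j j) = 0"
      "\<And>j i. j < r \<Longrightarrow> i < s \<Longrightarrow> g j i = (\<Sum>a<Suc j. c j a * q a i)"
    by auto
  define \<alpha> where "\<alpha> a = (\<Sum>i<s. cnj (q a i) * g r i)" for a
  define h where "h i = g r i - (\<Sum>a<r. \<alpha> a * q a i)" for i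
  have horth: "(\<Sum>i<s. cnj (q b i) * h i) = 0" if "b < r" for b
  proof -
    have "(\<Sum>i<s. cnj (q b i) * h i) = \<alpha> b - (\<Sum>i<s. \<Sum>a<r. \<alpha> a * (cnj (q b i) * q a i))"
      by (simp add: h_def \<alpha>_def right_diff_distrib sum_subtractf sum_distrib_left mult_ac)
    also have "(\<Sum>i<s. \<Sum>a<r. \<alpha> a * (cnj (q b i) * q a i)) = (\<Sum>a<r. \<alpha> a * (\<Sum>i<s. cnj (q b i) * q a i))"
      by (subst sum.swap) (simp add: sum_distrib_left)
    also have "\<dots> = (\<Sum>a<r. \<alpha> a * (if b = a then 1 else 0))"
      using q that by (intro sum.cong) (auto simp: orthonormal_def)
    also have "\<dots> = \<alpha> b"
      using that by (simp add: if_distrib cong: if_cong)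
    finally show ?thesis by simp
  qed
  define N where "N = (\<Sum>i<s. (cmod (h i))\<^sup>2)"
  have N0: "N \<ge> 0" by (simp add: N_def sum_nonneg)
  have hN: "(\<Sum>i<s. cnj (h i) * h i) = of_real N"
    unfolding N_def of_real_sum by (simp only: complex_norm_square mult.commute)
  have "\<exists>v. (\<Sum>i<s. cnj (v i) * v i) = 1 \<and> (\<forall>a<r. (\<Sum>i<s. cnj (q a i) * v i) = 0)
      \<and> (\<forall>i<s. h i = of_real (sqrt N) * v i)"
  proof (cases "N = 0")
    \<comment> \<open>If the new column depends on the earlier ones, any unit vector orthogonal to
      them will do, with diagonal coefficient 0.\<close>
    case True
    then have "\<forall>i<s. h i = 0"
      unfolding N_def by (subst (asm) sum_nonneg_eq_0_iff) auto
    then show ?thesis using exists_unit_orthogonal[of r s q] Suc.prems True by auto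
  next
    case False
    let ?v = "\<lambda>i. h i / of_real (sqrt N)"
    have "(\<Sum>i<s. cnj (?v i) * ?v i) = (\<Sum>i<s. cnj (h i) * h i) / (of_real (sqrt N) * of_real (sqrt N))"
      by (simp add: sum_divide_distrib)
    also have "\<dots> = 1"
      unfolding hN of_real_mult[symmetric] using N0 False by simp
    finally have "(\<Sum>i<s. cnj (?v i) * ?v i) = 1" .
    moreover have "(\<Sum>i<s. cnj (q a i) * ?v i) = 0" if "a < r" for a
      using horth[OF that] by (simp add: sum_divide_distrib[symmetric])
    ultimately show ?thesis using False by (intro exI[of _ ?v]) auto
  qed
  then obtain v where v: "(\<Sum>i<s. cnj (v i) * v i) = 1"
      "\<And>a. a < r \<Longrightarrow> (\<Sum>i<s. cnj (q a i) * v i) = 0"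
      "\<And>i. i < s \<Longrightarrow> h i = of_real (sqrt N) * v i" by blast
  let ?c = "c(r := \<alpha>(r := of_real (sqrt N)))"
  have "g r i = (\<Sum>a<Suc r. ?c r a * (q(r := v)) a i)" if "i < s" for i
    using v(3)[OF that] by (simp add: h_def algebra_simps)
  moreover have "g j i = (\<Sum>a<Suc j. ?c j a * (q(r := v)) a i)" if "j < r" "i < s" for i j
    using c(2)[OF that] that by simp
  ultimately have "\<forall>j<Suc r. Im (?c j j) = 0 \<and> (\<forall>i<s. g j i = (\<Sum>a<Suc j. ?c j a * (q(r := v)) a i))"
    using c(1) by (auto simp: less_Suc_eq simp del: sum.lessThan_Suc)
  then show ?case using orthonormal_Suc[OF q v(1,2)] by blast
qed

lemma QR_decomposition:
  assumes G: "G \<in> carrier_mat s r" and "r \<le> s"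
  shows "\<exists>Q\<in>stiefel s r. \<exists>T\<in>carrier_mat r r. G = Q * T \<and>
    (\<forall>i<r. \<forall>j<i. T $$ (i, j) = 0) \<and> (\<forall>j<r. Im (T $$ (j, j)) = 0)"
proof -
  obtain q c where q: "orthonormal s r q"
    and c: "\<And>j. j < r \<Longrightarrow> Im (c j j) = 0"
      "\<And>j i. j < r \<Longrightarrow> i < s \<Longrightarrow> G $$ (i, j) = (\<Sum>a<Suc j. c j a * q a i)"
    using orthonormal_QR[OF \<open>r \<le> s\<close>, of "\<lambda>j i. G $$ (i, j)"] by blast
  let ?Q = "mat s r (\<lambda>(i, a). q a i)" and ?T = "mat r r (\<lambda>(a, j). if a \<le> j then c j a else 0)"
  have "G = ?Q * ?T"
  proof (rule eq_matI)
    fix i j assume "i < dim_row (?Q * ?T)" "j < dim_col (?Q * ?T)"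
    then have ij: "i < s" "j < r" by auto
    have "(?Q * ?T) $$ (i, j) = (\<Sum>a<r. if a < Suc j then c j a * q a i else 0)"
      using ij by (auto simp: index_mult_mat_sum less_Suc_eq_le mult.commute intro!: sum.cong simp del: index_mult_mat(1))
    also have "\<dots> = (\<Sum>a<Suc j. c j a * q a i)"
      using ij by (intro sum.mono_neutral_cong_right) auto
    finally show "G $$ (i, j) = (?Q * ?T) $$ (i, j)" using c(2)[OF ij(2,1)] by simp
  qed (use G in auto)
  then show ?thesis
    using mat_in_stiefel[OF q] c(1) by (intro bexI[of _ ?Q] bexI[of _ ?T]) auto
qed

section \<open>Laplace transforms of uniform Stiefel matrices\<close>

lemma measurable_cnj:
  assumes "f \<in> borel_measurable M"
  shows "(\<lambda>x. cnj (f x)) \<in> borel_measurable M"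
  using measurable_compose[OF assms borel_measurable_continuous_onI[OF continuous_on_cnj[OF continuous_on_id]]] .

lemma measurable_part:
  assumes "f \<in> borel_measurable M"
  shows "(\<lambda>x. part b (f x)) \<in> borel_measurable M"
  using assms unfolding part_def borel_measurable_complex_iff by (cases b) simp_all

lemma space_borel_mat [simp]: "space (borel_mat n k) = carrier_mat n k"
  by (simp add: borel_mat_def)

lemma measurable_borel_matI:
  assumes "\<And>x. x \<in> space M \<Longrightarrow> h x \<in> carrier_mat n k"
    and "\<And>i j. i < n \<Longrightarrow> j < k \<Longrightarrow> (\<lambda>x. h x $$ (i, j)) \<in> borel_measurable M"
  shows "h \<in> M \<rightarrow>\<^sub>M borel_mat n k"
  unfolding borel_mat_def
  by (rule measurable_vimage_algebra2) (use assms in \<open>auto intro!: measurable_restrict\<close>)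

lemma measurable_mat_index:
  assumes h: "h \<in> M \<rightarrow>\<^sub>M borel_mat n k" and ij: "i < n" "j < k"
  shows "(\<lambda>x. h x $$ (i, j)) \<in> borel_measurable M"
proof -
  let ?I = "{..<n} \<times> {..<k}"
  have "(\<lambda>A. \<lambda>p\<in>?I. A $$ p) \<in> borel_mat n k \<rightarrow>\<^sub>M (\<Pi>\<^sub>M p\<in>?I. borel :: complex measure)"
    unfolding borel_mat_def by (rule measurable_vimage_algebra1) (auto simp: space_PiM)
  then have "(\<lambda>A. (\<lambda>p\<in>?I. A $$ p) (i, j)) \<in> borel_measurable (borel_mat n k)"
    by (rule measurable_compose[OF _ measurable_component_singleton]) (use ij in auto)
  then have "(\<lambda>A. A $$ (i, j)) \<in> borel_measurable (borel_mat n k)"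
    using ij by simp
  from measurable_compose[OF h this] show ?thesis .
qed

lemma measurable_mat_carrier:
  "h \<in> M \<rightarrow>\<^sub>M borel_mat n k \<Longrightarrow> x \<in> space M \<Longrightarrow> h x \<in> carrier_mat n k"
  using measurable_space[of h M "borel_mat n k" x] by simp

lemma measurable_fro2 [measurable (raw)]:
  assumes "h \<in> M \<rightarrow>\<^sub>M borel_mat n k"
  shows "(\<lambda>x. fro2 (h x)) \<in> borel_measurable M"
proof -
  have "(\<lambda>x. \<Sum>i<n. \<Sum>j<k. (cmod (h x $$ (i, j)))\<^sup>2) \<in> borel_measurable M"
    using measurable_mat_index[OF assms]
    by (intro borel_measurable_sum borel_measurable_power borel_measurable_norm) auto
  also have "?this \<longleftrightarrow> (\<lambda>x. fro2 (h x)) \<in> borel_measurable M"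
    using measurable_mat_carrier[OF assms]
    by (intro measurable_cong) (auto simp: fro2_def)
  finally show ?thesis .
qed

lemma measurable_mat_mult:
  assumes f: "f \<in> M \<rightarrow>\<^sub>M borel_mat n k" and g: "g \<in> M \<rightarrow>\<^sub>M borel_mat k l"
  shows "(\<lambda>x. f x * g x) \<in> M \<rightarrow>\<^sub>M borel_mat n l"
proof (rule measurable_borel_matI)
  note c = measurable_mat_carrier[OF f] measurable_mat_carrier[OF g]
  show "f x * g x \<in> carrier_mat n l" if "x \<in> space M" for x
    using c[OF that] by auto
  fix i j assume ij: "i < n" "j < l"
  have "(\<lambda>x. \<Sum>m<k. f x $$ (i, m) * g x $$ (m, j)) \<in> borel_measurable M"
    using measurable_mat_index[OF f] measurable_mat_index[OF g] ij
    by (intro borel_measurable_sum borel_measurable_times) auto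
  also have "?this \<longleftrightarrow> (\<lambda>x. (f x * g x) $$ (i, j)) \<in> borel_measurable M"
  proof (rule measurable_cong)
    fix x assume "x \<in> space M"
    then show "(\<Sum>m<k. f x $$ (i, m) * g x $$ (m, j)) = (f x * g x) $$ (i, j)"
      using carrier_matD[OF c(1)] carrier_matD[OF c(2)] ij
      by (simp add: index_mult_mat_sum del: index_mult_mat(1))
  qed
  finally show "(\<lambda>x. (f x * g x) $$ (i, j)) \<in> borel_measurable M" .
qed

lemma measurable_mat_adjoint:
  assumes f: "f \<in> M \<rightarrow>\<^sub>M borel_mat n k"
  shows "(\<lambda>x. mat_adjoint (f x)) \<in> M \<rightarrow>\<^sub>M borel_mat k n"
proof (rule measurable_borel_matI)
  note c = measurable_mat_carrier[OF f]
  show "mat_adjoint (f x) \<in> carrier_mat k n" if "x \<in> space M" for x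
    using c[OF that] by auto
  fix i j assume ij: "i < k" "j < n"
  have "(\<lambda>x. cnj (f x $$ (j, i))) \<in> borel_measurable M"
    using measurable_mat_index[OF f] ij by (intro measurable_cnj) auto
  also have "?this \<longleftrightarrow> (\<lambda>x. mat_adjoint (f x) $$ (i, j)) \<in> borel_measurable M"
  proof (rule measurable_cong)
    fix x assume "x \<in> space M"
    then show "cnj (f x $$ (j, i)) = mat_adjoint (f x) $$ (i, j)"
      using carrier_matD[OF c] ij by simp
  qed
  finally show "(\<lambda>x. mat_adjoint (f x) $$ (i, j)) \<in> borel_measurable M" .
qed

lemma measurable_mat_minus:
  assumes f: "f \<in> M \<rightarrow>\<^sub>M borel_mat n k" and g: "g \<in> M \<rightarrow>\<^sub>M borel_mat n k"
  shows "(\<lambda>x. f x - g x) \<in> M \<rightarrow>\<^sub>M borel_mat n k"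
proof (rule measurable_borel_matI)
  note c = measurable_mat_carrier[OF f] measurable_mat_carrier[OF g]
  show "f x - g x \<in> carrier_mat n k" if "x \<in> space M" for x
    using c[OF that] by auto
  fix i j assume ij: "i < n" "j < k"
  have "(\<lambda>x. f x $$ (i, j) - g x $$ (i, j)) \<in> borel_measurable M"
    using measurable_mat_index[OF f] measurable_mat_index[OF g] ij by (intro borel_measurable_diff) auto
  also have "?this \<longleftrightarrow> (\<lambda>x. (f x - g x) $$ (i, j)) \<in> borel_measurable M"
  proof (rule measurable_cong)
    fix x assume "x \<in> space M"
    then show "f x $$ (i, j) - g x $$ (i, j) = (f x - g x) $$ (i, j)"
      using carrier_matD[OF c(2)] ij by simp
  qed
  finally show "(\<lambda>x. (f x - g x) $$ (i, j)) \<in> borel_measurable M" .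
qed

section \<open>Averaging an invariant Laplace transform over its reference point\<close>

lemma uniform_on_stiefelD:
  assumes "uniform_on_stiefel s r \<mu>"
  shows "prob_space \<mu>" "sets \<mu> = sets (borel_mat s r)" "AE V in \<mu>. V \<in> stiefel s r"
    "\<And>Q. Q \<in> stiefel s s \<Longrightarrow> distr \<mu> (borel_mat s r) (\<lambda>V. Q * V) = \<mu>"
  using assms by (auto simp: uniform_on_stiefel_def)

text \<open>
  By invariance the integral does not depend on \<open>Q\<^sub>0\<close>, so \<open>Q\<^sub>0\<close> may be replaced by the orthonormal
  factor of a Gaussian matrix. For a fixed \<open>U\<close> the remaining Gaussian integral only involves the
  distance to a real subspace of dimension \<open>card J\<close>.
\<close>

lemma stiefel_laplace_bound:
  fixes \<delta> :: "complex mat \<Rightarrow> complex mat \<Rightarrow> real"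
  assumes \<mu>: "uniform_on_stiefel s r \<mu>" and r: "0 < r" "r \<le> s" and \<theta>: "\<theta> \<ge> 0"
    and J: "J \<subseteq> entry_index r r"
    and inv: "\<And>\<Omega> U Q. \<Omega> \<in> stiefel s s \<Longrightarrow> U \<in> carrier_mat s r \<Longrightarrow> Q \<in> stiefel s r \<Longrightarrow> \<delta> (\<Omega> * U) (\<Omega> * Q) = \<delta> U Q"
    and meas: "\<And>Q. Q \<in> stiefel s r \<Longrightarrow> (\<lambda>U. \<delta> U Q) \<in> borel_measurable (borel_mat s r)"
    and key: "\<And>G R. G \<in> carrier_mat s r \<Longrightarrow> R \<ge> 0 \<Longrightarrow>
        (\<And>y. (\<Sum>j<r. (cmod (\<Sum>i<s. y i * G $$ (i, j)))\<^sup>2) \<le> R * (\<Sum>i<s. (cmod (y i))\<^sup>2)) \<Longrightarrow>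
        \<exists>Q\<in>stiefel s r. \<forall>U\<in>stiefel s r.
          fro2 G - (\<Sum>(k, j, b)\<in>J. (part b ((mat_adjoint U * G) $$ (k, j)))\<^sup>2) \<le> R * \<delta> U Q"
    and Q0: "Q0 \<in> stiefel s r"
  shows "(\<integral>\<^sup>+U. ennreal (exp (- \<theta> * \<delta> U Q0)) \<partial>\<mu>)
    \<le> ennreal (2 * (1 + 2 * (\<theta> / (24 * real s))) powr (- (real (2 * s * r) - real (card J)) / 2))"
proof -
  let ?\<gamma> = "gaussian (entry_index s r)"
  note \<mu>' = uniform_on_stiefelD[OF \<mu>]
  interpret \<mu>: prob_space \<mu> by (rule \<mu>'(1))
  interpret \<gamma>: prob_space ?\<gamma> by (rule prob_space_gaussian)
  interpret P: pair_sigma_finite ?\<gamma> \<mu> ..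
  note [measurable_cong] = \<mu>'(2)
  define R where "R = 24 * real s"
  have R: "R > 0" using r by (simp add: R_def)
  \<comment> \<open>By \<open>key\<close>, \<open>R * \<delta>\<close> dominates the squared
    distance \<open>?D\<close>, so \<open>\<theta>\<close> on \<open>\<delta>\<close> turns into
    \<open>\<theta> / R\<close> on \<open>?D\<close>.\<close>
  define a where "a = \<theta> / R"
  have a: "a \<ge> 0" using \<theta> R by (simp add: a_def)
  define c where "c = (\<integral>\<^sup>+U. ennreal (exp (- \<theta> * \<delta> U Q0)) \<partial>\<mu>)"
  define K where "K = ennreal ((1 + 2 * a) powr (- (real (2 * s * r) - real (card J)) / 2))"
  \<comment> \<open>Some unitary moves \<open>Q0\<close> to \<open>Q\<close>; substituting it into
    the integral leaves both \<open>\<mu>\<close> and \<open>\<delta>\<close> unchanged.\<close>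
  have const: "c = (\<integral>\<^sup>+U. ennreal (exp (- \<theta> * \<delta> U Q)) \<partial>\<mu>)" if Q: "Q \<in> stiefel s r" for Q
  proof -
    obtain \<Omega> where \<Omega>: "\<Omega> \<in> stiefel s s" "\<Omega> * Q0 = Q"
      using unitary_transitive[OF Q0 Q r(2)] by blast
    have m1: "(\<lambda>U. \<Omega> * U) \<in> \<mu> \<rightarrow>\<^sub>M borel_mat s r"
      using stiefelD(1)[OF \<Omega>(1)]
      by (intro measurable_mat_mult[of _ _ _ s]) (auto intro: measurable_ident_sets[OF \<mu>'(2)])
    have m2: "(\<lambda>U. ennreal (exp (- \<theta> * \<delta> U Q))) \<in> borel_measurable (borel_mat s r)"
      using meas[OF Q] by measurable
    have sp: "space \<mu> = carrier_mat s r" using sets_eq_imp_space_eq[OF \<mu>'(2)] by simp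
    have "(\<integral>\<^sup>+U. ennreal (exp (- \<theta> * \<delta> U Q)) \<partial>\<mu>)
       = (\<integral>\<^sup>+U. ennreal (exp (- \<theta> * \<delta> U Q)) \<partial>distr \<mu> (borel_mat s r) (\<lambda>U. \<Omega> * U))"
      using \<mu>'(4)[OF \<Omega>(1)] by simp
    also have "\<dots> = (\<integral>\<^sup>+U. ennreal (exp (- \<theta> * \<delta> (\<Omega> * U) (\<Omega> * Q0))) \<partial>\<mu>)"
      by (subst nn_integral_distr[OF m1]) (use m2 \<Omega>(2) in auto)
    also have "\<dots> = c"
      unfolding c_def by (intro nn_integral_cong) (use inv[OF \<Omega>(1) _ Q0] sp in auto)
    finally show ?thesis ..
  qed
  let ?D = "\<lambda>x U. (\<Sum>i<s. \<Sum>j<r. (cmod (centry x i j))\<^sup>2)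
      - (\<Sum>(k, j, b)\<in>J. (part b (\<Sum>i<s. cnj (U $$ (i, k)) * centry x i j))\<^sup>2)"
  have J': "finite J" "\<And>k j b. (k, j, b) \<in> J \<Longrightarrow> k < r \<and> j < r"
    using J finite_subset by (fastforce simp: entry_index_def)+
  have mD: "(\<lambda>p. ennreal (exp (- a * ?D (fst p) (snd p)))) \<in> borel_measurable (?\<gamma> \<Otimes>\<^sub>M \<mu>)"
  proof -
    have m1 [measurable]: "(\<lambda>p. centry (fst p) i j) \<in> borel_measurable (?\<gamma> \<Otimes>\<^sub>M \<mu>)" for i j
      using measurable_compose[OF measurable_fst measurable_centry] .
    have snd: "snd \<in> (?\<gamma> \<Otimes>\<^sub>M \<mu>) \<rightarrow>\<^sub>M borel_mat s r" by measurable
    have "(\<lambda>p. (part b (\<Sum>i<s. cnj (snd p $$ (i, k)) * centry (fst p) i j))\<^sup>2) \<in> borel_measurable (?\<gamma> \<Otimes>\<^sub>M \<mu>)"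
      if "(k, j, b) \<in> J" for k j b
    proof -
      have "(\<lambda>p. \<Sum>i<s. cnj (snd p $$ (i, k)) * centry (fst p) i j) \<in> borel_measurable (?\<gamma> \<Otimes>\<^sub>M \<mu>)"
        using J'(2)[OF that]
        by (intro borel_measurable_sum borel_measurable_times measurable_cnj
            measurable_mat_index[OF snd] m1) auto
      then show ?thesis by (intro borel_measurable_power measurable_part)
    qed
    then have [measurable]: "(\<lambda>p. \<Sum>(k, j, b)\<in>J. (part b (\<Sum>i<s. cnj (snd p $$ (i, k)) * centry (fst p) i j))\<^sup>2)
        \<in> borel_measurable (?\<gamma> \<Otimes>\<^sub>M \<mu>)"
      by (intro borel_measurable_sum) auto
    show ?thesis by measurable
  qed
  obtain A where A: "A \<in> sets ?\<gamma>" "emeasure ?\<gamma> A \<ge> ennreal (1 / 2)"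
    and Aop: "\<And>x y. x \<in> A \<Longrightarrow> (\<Sum>j<r. (cmod (\<Sum>i<s. y i * centry x i j))\<^sup>2) \<le> R * (\<Sum>i<s. (cmod (y i))\<^sup>2)"
    using gaussian_op_bound[OF r] unfolding R_def by blast
  \<comment> \<open>Since \<open>c\<close> is the same for every reference point, \<open>Q\<close>
    may be chosen for each \<open>x\<close> separately and only has to exist.\<close>
  have good: "c \<le> (\<integral>\<^sup>+U. ennreal (exp (- a * ?D x U)) \<partial>\<mu>)" if x: "x \<in> A" for x
  proof -
    define G where "G = mat s r (\<lambda>(i, j). centry x i j)"
    have G: "G \<in> carrier_mat s r" "fro2 G = (\<Sum>i<s. \<Sum>j<r. (cmod (centry x i j))\<^sup>2)"
      by (auto simp: G_def fro2_def)
    have "(\<Sum>j<r. (cmod (\<Sum>i<s. y i * G $$ (i, j)))\<^sup>2) \<le> R * (\<Sum>i<s. (cmod (y i))\<^sup>2)" for y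
      using Aop[OF x, of y] by (simp add: G_def)
    then obtain Q where Q: "Q \<in> stiefel s r" and D: "\<And>U. U \<in> stiefel s r \<Longrightarrow>
        fro2 G - (\<Sum>(k, j, b)\<in>J. (part b ((mat_adjoint U * G) $$ (k, j)))\<^sup>2) \<le> R * \<delta> U Q"
      using key[OF G(1), of R] R by auto
    have "(part b ((mat_adjoint U * G) $$ (k, j)))\<^sup>2 = (part b (\<Sum>i<s. cnj (U $$ (i, k)) * centry x i j))\<^sup>2"
      if "U \<in> stiefel s r" "(k, j, b) \<in> J" for U k j b
    proof -
      have "(mat_adjoint U * G) $$ (k, j) = (\<Sum>i<s. cnj (U $$ (i, k)) * centry x i j)"
        using J'(2)[OF that(2)] stiefelD(1)[OF that(1)] G(1)
        by (auto simp: index_mult_mat_sum G_def simp del: index_mult_mat(1))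
      then show ?thesis by simp
    qed
    then have eq: "?D x U = fro2 G - (\<Sum>(k, j, b)\<in>J. (part b ((mat_adjoint U * G) $$ (k, j)))\<^sup>2)"
      if "U \<in> stiefel s r" for U
      using that unfolding G(2) by (intro arg_cong2[of _ _ _ _ "(-)"] sum.cong refl) auto
    have "exp (- \<theta> * \<delta> U Q) \<le> exp (- a * ?D x U)" if U: "U \<in> stiefel s r" for U
    proof -
      have "a * ?D x U \<le> a * (R * \<delta> U Q)"
        unfolding eq[OF U] by (rule mult_left_mono[OF D[OF U] a])
      also have "\<dots> = \<theta> * \<delta> U Q" using R by (simp add: a_def)
      finally show ?thesis by simp
    qed
    then have "(\<integral>\<^sup>+U. ennreal (exp (- \<theta> * \<delta> U Q)) \<partial>\<mu>) \<le> (\<integral>\<^sup>+U. ennreal (exp (- a * ?D x U)) \<partial>\<mu>)"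
      using \<mu>'(3) by (intro nn_integral_mono_AE) (auto intro: ennreal_leI)
    then show ?thesis using const[OF Q] by simp
  qed
  \<comment> \<open>The constant \<open>c\<close> is averaged over \<open>A\<close> only; the right
    side is then enlarged to an integral over all \<open>x\<close>, which Fubini can handle. The
    mass 1/2 of \<open>A\<close> is the source of the factor 2.\<close>
  have "c * ennreal (1 / 2) \<le> c * emeasure ?\<gamma> A" by (rule mult_left_mono[OF A(2)]) simp
  also have "\<dots> = (\<integral>\<^sup>+x. c * indicator A x \<partial>?\<gamma>)"
    using A(1) by (simp add: nn_integral_cmult_indicator)
  also have "\<dots> \<le> (\<integral>\<^sup>+x. (\<integral>\<^sup>+U. ennreal (exp (- a * ?D x U)) \<partial>\<mu>) \<partial>?\<gamma>)"
    using good by (intro nn_integral_mono) (auto split: split_indicator)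
  also have "\<dots> = (\<integral>\<^sup>+U. (\<integral>\<^sup>+x. ennreal (exp (- a * ?D x U)) \<partial>?\<gamma>) \<partial>\<mu>)"
    using P.Fubini[OF mD] by simp
  \<comment> \<open>For each orthonormal \<open>U\<close> the Gaussian integral has the same value
    \<open>K\<close>: the dimension of the removed subspace is \<open>card J\<close> whatever
    \<open>U\<close> is.\<close>
  also have "\<dots> = (\<integral>\<^sup>+U. K \<partial>\<mu>)"
  proof (rule nn_integral_cong_AE)
    show "AE U in \<mu>. (\<integral>\<^sup>+x. ennreal (exp (- a * ?D x U)) \<partial>?\<gamma>) = K"
      using \<mu>'(3)
    proof eventually_elim
      case (elim U)
      show ?case unfolding K_def
        by (rule nn_integral_gaussian_exp_complement) (use stiefel_sum[OF elim] J a in auto)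
    qed
  qed
  also have "\<dots> = K" by (simp add: \<mu>.emeasure_space_1)
  finally have "2 * (c * ennreal (1 / 2)) \<le> 2 * K" by (rule mult_left_mono) simp
  also have "2 * (c * ennreal (1 / 2)) = c"
  proof -
    have "2 * (c * ennreal (1 / 2)) = c * (ennreal 2 * ennreal (1 / 2))" by (simp add: mult_ac)
    also have "ennreal 2 * ennreal (1 / 2) = 1" by (subst ennreal_mult'[symmetric]) auto
    finally show ?thesis by simp
  qed
  also have "2 * K = ennreal (2 * (1 + 2 * a) powr (- (real (2 * s * r) - real (card J)) / 2))"
    unfolding K_def by (subst ennreal_mult') auto
  finally show ?thesis by (simp add: c_def a_def R_def)
qed

lemma fro2_part:
  assumes "B \<in> carrier_mat n k"
  shows "fro2 B = (\<Sum>(i, j, b)\<in>entry_index n k. (part b (B $$ (i, j)))\<^sup>2)"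
  using assms by (simp add: sum_entry_index fro2_def part_def cmod_power2)

text \<open>\<open>T\<close> inherits the operator bound of \<open>Q * T\<close>: right
  multiplication by the adjoint of \<open>Q\<close> preserves the norm of \<open>M\<close>, and the
  two factors \<open>Q\<close> then cancel.\<close>

lemma fro2_factor_le:
  assumes Q: "Q \<in> stiefel s r" and T: "T \<in> carrier_mat r r" and M: "M \<in> carrier_mat s r" and R: "R \<ge> 0"
    and bound: "\<And>y. (\<Sum>j<r. (cmod (\<Sum>i<s. y i * (Q * T) $$ (i, j)))\<^sup>2) \<le> R * (\<Sum>i<s. (cmod (y i))\<^sup>2)"
  shows "fro2 (M * T) \<le> R * fro2 M"
proof -
  note Qc = stiefelD(1)[OF Q]
  have "M * mat_adjoint Q * (Q * T) = M * (mat_adjoint Q * (Q * T))"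
    using M Qc T by (intro assoc_mult_mat[where n\<^sub>1=s and n\<^sub>2=r and n\<^sub>3=s and n\<^sub>4=r]) auto
  also have "mat_adjoint Q * (Q * T) = mat_adjoint Q * Q * T"
    using Qc T by (intro assoc_mult_mat[symmetric, where n\<^sub>1=r and n\<^sub>2=s and n\<^sub>3=r and n\<^sub>4=r]) auto
  also have "\<dots> = T" using stiefelD(2)[OF Q] T by simp
  finally have "fro2 (M * T) = fro2 (M * mat_adjoint Q * (Q * T))" by simp
  also have "\<dots> \<le> R * fro2 (M * mat_adjoint Q)"
    by (rule fro2_mult_le[OF _ _ R bound]) (use M Qc T in auto)
  also have "fro2 (M * mat_adjoint Q) = fro2 M" by (rule fro2_mult_stiefel_adjoint[OF Q M])
  finally show ?thesis .
qed

text \<open>The coordinates in which an upper triangular matrix with real diagonal may be nonzero.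
  Removing these r^2 from \<open>2 s r\<close> leaves the real dimension of the Stiefel
  manifold.\<close>

definition triangular_index :: "nat \<Rightarrow> (nat \<times> nat \<times> bool) set" where
  "triangular_index r = {(k, j, b) \<in> entry_index r r. k < j \<or> (k = j \<and> \<not> b)}"

lemma card_triangular_index: "card (triangular_index r) = r * r"
proof -
  \<comment> \<open>Imaginary parts above the diagonal are sent to the transposed positions below
    it, so every position is hit exactly once.\<close>
  let ?f = "\<lambda>(k, j, b). if b then (j, k) else (k, j) :: nat \<times> nat"
  let ?g = "\<lambda>(k, j). if k \<le> j then (k, j, False) else (j, k, True) :: nat \<times> nat \<times> bool"
  have "bij_betw ?f (triangular_index r) ({..<r} \<times> {..<r})"
    by (rule bij_betw_byWitness[where f' = ?g])
       (auto simp: triangular_index_def entry_index_def split: if_splits)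
  then show ?thesis by (simp add: bij_betw_same_card card_cartesian_product)
qed

text \<open>For the QR factors of \<open>G\<close>, the triangular \<open>T\<close> vanishes outside
  \<open>triangular_index\<close>, so the coordinates of \<open>mat_adjoint U * G\<close> that
  survive the subtraction are also coordinates of its difference from \<open>T\<close>. Together
  with the residual of the projection onto the range of \<open>U\<close> they are at most
  \<open>fro2 (G - U * T)\<close>. As \<open>G - U * T = (Q - U) * T\<close>, this is controlled by
  the displacement of \<open>U\<close> from \<open>Q\<close>.\<close>

lemma stiefel_laplace_point:
  assumes \<mu>: "uniform_on_stiefel s r \<mu>" and r: "0 < r" "r \<le> s" and \<theta>: "\<theta> \<ge> 0" and Q0: "Q0 \<in> stiefel s r"
  shows "(\<integral>\<^sup>+U. ennreal (exp (- \<theta> * fro2 (U - Q0))) \<partial>\<mu>)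
    \<le> ennreal (2 * (1 + 2 * (\<theta> / (24 * real s))) powr (- (real s * real r - (real r)\<^sup>2 / 2)))"
proof -
  have J: "triangular_index r \<subseteq> entry_index r r" by (auto simp: triangular_index_def)
  have "(\<integral>\<^sup>+U. ennreal (exp (- \<theta> * fro2 (U - Q0))) \<partial>\<mu>)
    \<le> ennreal (2 * (1 + 2 * (\<theta> / (24 * real s))) powr (- (real (2 * s * r) - real (card (triangular_index r))) / 2))"
  proof (rule stiefel_laplace_bound[where \<delta> = "\<lambda>U Q. fro2 (U - Q)", OF \<mu> r \<theta> J _ _ _ Q0])
    fix \<Omega> U Q :: "complex mat" assume \<Omega>: "\<Omega> \<in> stiefel s s" and U: "U \<in> carrier_mat s r" and Q: "Q \<in> stiefel s r"
    have "\<Omega> * U - \<Omega> * Q = \<Omega> * (U - Q)"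
      using stiefelD(1)[OF \<Omega>] U stiefelD(1)[OF Q]
      by (intro mult_minus_distrib_mat[symmetric, where nr=s and n=s and nc=r]) auto
    then show "fro2 (\<Omega> * U - \<Omega> * Q) = fro2 (U - Q)"
      using fro2_stiefel_mult[OF \<Omega> minus_carrier_mat[OF stiefelD(1)[OF Q]]] by simp
  next
    fix Q :: "complex mat" assume "Q \<in> stiefel s r"
    then show "(\<lambda>U. fro2 (U - Q)) \<in> borel_measurable (borel_mat s r)"
      using stiefelD(1) by (intro measurable_fro2[of _ _ s r] measurable_mat_minus) auto
  next
    fix G :: "complex mat" and R :: real
    assume G: "G \<in> carrier_mat s r" and R: "R \<ge> 0"
      and bound: "\<And>y. (\<Sum>j<r. (cmod (\<Sum>i<s. y i * G $$ (i, j)))\<^sup>2) \<le> R * (\<Sum>i<s. (cmod (y i))\<^sup>2)"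
    obtain Q T where Q: "Q \<in> stiefel s r" and T: "T \<in> carrier_mat r r" and GQT: "G = Q * T"
      and upper: "\<And>i j. i < r \<Longrightarrow> j < i \<Longrightarrow> T $$ (i, j) = 0" "\<And>j. j < r \<Longrightarrow> Im (T $$ (j, j)) = 0"
      using QR_decomposition[OF G r(2)] by blast
    have "fro2 G - (\<Sum>(k, j, b)\<in>triangular_index r. (part b ((mat_adjoint U * G) $$ (k, j)))\<^sup>2) \<le> R * fro2 (U - Q)"
      if U: "U \<in> stiefel s r" for U
    proof -
      define B where "B = mat_adjoint U * G"
      have B: "B \<in> carrier_mat r r" using stiefelD(1)[OF U] G by (auto simp: B_def)
      let ?J = "triangular_index r"
      \<comment> \<open>An index outside \<open>triangular_index\<close> lies strictly below the
        diagonal or is the imaginary part of a diagonal entry.\<close>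
      have zero: "part b (T $$ (k, j)) = 0" if "(k, j, b) \<in> entry_index r r - ?J" for k j b
      proof -
        have "j < k \<or> k = j \<and> b" "k < r"
          using that by (auto simp: triangular_index_def entry_index_def)
        then show ?thesis using upper by (auto simp: part_def)
      qed
      have "fro2 B - (\<Sum>(k, j, b)\<in>?J. (part b (B $$ (k, j)))\<^sup>2)
          = (\<Sum>(k, j, b)\<in>entry_index r r - ?J. (part b (B $$ (k, j)))\<^sup>2)"
        unfolding fro2_part[OF B] by (subst sum_diff[OF _ J]) auto
      also have "\<dots> = (\<Sum>(k, j, b)\<in>entry_index r r - ?J. (part b ((B - T) $$ (k, j)))\<^sup>2)"
      proof (intro sum.cong refl, clarify)
        fix k j b assume *: "(k, j, b) \<in> entry_index r r" "(k, j, b) \<notin> ?J"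
        then have "(B - T) $$ (k, j) = B $$ (k, j) - T $$ (k, j)"
          using T by (auto simp: entry_index_def)
        then show "(part b (B $$ (k, j)))\<^sup>2 = (part b ((B - T) $$ (k, j)))\<^sup>2"
          using zero[of k j b] * by (auto simp: part_def split: if_splits)
      qed
      also have "\<dots> \<le> (\<Sum>(k, j, b)\<in>entry_index r r. (part b ((B - T) $$ (k, j)))\<^sup>2)"
        by (intro sum_mono2) auto
      also have "\<dots> = fro2 (B - T)" using B T by (intro fro2_part[symmetric]) auto
      finally have "fro2 G - (\<Sum>(k, j, b)\<in>?J. (part b (B $$ (k, j)))\<^sup>2) \<le> fro2 (G - U * T)"
        using fro2_diff_stiefel_mult[OF U G T] by (simp add: B_def)
      also have "G - U * T = (Q - U) * T"
        unfolding GQT using stiefelD(1)[OF Q] stiefelD(1)[OF U] T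
        by (intro minus_mult_distrib_mat[symmetric, where nr=s and n=r and nc=r]) auto
      also have "fro2 \<dots> \<le> R * fro2 (Q - U)"
        by (rule fro2_factor_le[OF Q T _ R]) (use bound stiefelD(1)[OF Q] stiefelD(1)[OF U] in \<open>auto simp: GQT\<close>)
      also have "fro2 (Q - U) = fro2 (U - Q)"
        using stiefelD(1)[OF Q] stiefelD(1)[OF U] by (intro fro2_minus_commute) auto
      finally show ?thesis by (simp add: B_def)
    qed
    then show "\<exists>Q\<in>stiefel s r. \<forall>U\<in>stiefel s r.
        fro2 G - (\<Sum>(k, j, b)\<in>triangular_index r. (part b ((mat_adjoint U * G) $$ (k, j)))\<^sup>2) \<le> R * fro2 (U - Q)"
      using Q by blast
  qed
  also have "- (real (2 * s * r) - real (card (triangular_index r))) / 2 = - (real s * real r - (real r)\<^sup>2 / 2)"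
    by (simp add: card_triangular_index power2_eq_square field_simps)
  finally show ?thesis .
qed

text \<open>All coordinates of the projection of \<open>G\<close> are subtracted here, so only the
  residual \<open>(Q - U * (mat_adjoint U * Q)) * T\<close> remains, which sees the range of
  \<open>U\<close> alone. The exponent is half the dimension \<open>2 r (s - r)\<close> of the
  Grassmannian. The distance used is the sum of the squared sines of the principal angles and is
  symmetric in \<open>Q\<close> and \<open>U\<close>.\<close>

lemma stiefel_laplace_subspace:
  assumes \<mu>: "uniform_on_stiefel s r \<mu>" and r: "0 < r" "r \<le> s" and \<theta>: "\<theta> \<ge> 0" and Q0: "Q0 \<in> stiefel s r"
  shows "(\<integral>\<^sup>+U. ennreal (exp (- \<theta> * (real r - fro2 (mat_adjoint Q0 * U)))) \<partial>\<mu>)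
    \<le> ennreal (2 * (1 + 2 * (\<theta> / (24 * real s))) powr (- (real s * real r - (real r)\<^sup>2)))"
proof -
  have "(\<integral>\<^sup>+U. ennreal (exp (- \<theta> * (real r - fro2 (mat_adjoint Q0 * U)))) \<partial>\<mu>)
    \<le> ennreal (2 * (1 + 2 * (\<theta> / (24 * real s))) powr (- (real (2 * s * r) - real (card (entry_index r r))) / 2))"
  proof (rule stiefel_laplace_bound[where \<delta> = "\<lambda>U Q. real r - fro2 (mat_adjoint Q * U)", OF \<mu> r \<theta> order_refl _ _ _ Q0])
    fix \<Omega> U Q :: "complex mat" assume \<Omega>: "\<Omega> \<in> stiefel s s" and U: "U \<in> carrier_mat s r" and Q: "Q \<in> stiefel s r"
    note c = stiefelD(1)[OF \<Omega>] U stiefelD(1)[OF Q]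
    have "mat_adjoint (\<Omega> * Q) * (\<Omega> * U) = mat_adjoint Q * mat_adjoint \<Omega> * (\<Omega> * U)"
      using c by (simp add: mat_adjoint_mult[of _ s s _ r])
    also have "\<dots> = mat_adjoint Q * (mat_adjoint \<Omega> * (\<Omega> * U))"
      using c by (intro assoc_mult_mat[where n\<^sub>1=r and n\<^sub>2=s and n\<^sub>3=s and n\<^sub>4=r]) auto
    also have "mat_adjoint \<Omega> * (\<Omega> * U) = mat_adjoint \<Omega> * \<Omega> * U"
      using c by (intro assoc_mult_mat[symmetric, where n\<^sub>1=s and n\<^sub>2=s and n\<^sub>3=s and n\<^sub>4=r]) auto
    also have "\<dots> = U" using stiefelD(2)[OF \<Omega>] U by simp
    finally show "real r - fro2 (mat_adjoint (\<Omega> * Q) * (\<Omega> * U)) = real r - fro2 (mat_adjoint Q * U)" by simp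
  next
    fix Q :: "complex mat" assume "Q \<in> stiefel s r"
    then have "(\<lambda>U. fro2 (mat_adjoint Q * U)) \<in> borel_measurable (borel_mat s r)"
      using stiefelD(1) by (intro measurable_fro2[of _ _ r r] measurable_mat_mult[of _ _ r s]) auto
    then show "(\<lambda>U. real r - fro2 (mat_adjoint Q * U)) \<in> borel_measurable (borel_mat s r)" by simp
  next
    fix G :: "complex mat" and R :: real
    assume G: "G \<in> carrier_mat s r" and R: "R \<ge> 0"
      and bound: "\<And>y. (\<Sum>j<r. (cmod (\<Sum>i<s. y i * G $$ (i, j)))\<^sup>2) \<le> R * (\<Sum>i<s. (cmod (y i))\<^sup>2)"
    obtain Q T where Q: "Q \<in> stiefel s r" and T: "T \<in> carrier_mat r r" and GQT: "G = Q * T"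
      using QR_decomposition[OF G r(2)] by blast
    have "fro2 G - (\<Sum>(k, j, b)\<in>entry_index r r. (part b ((mat_adjoint U * G) $$ (k, j)))\<^sup>2)
        \<le> R * (real r - fro2 (mat_adjoint Q * U))"
      if U: "U \<in> stiefel s r" for U
    proof -
      note c = stiefelD(1)[OF Q] stiefelD(1)[OF U] T G
      have UG: "mat_adjoint U * G \<in> carrier_mat r r" using c by auto
      have "mat_adjoint U * G = mat_adjoint U * Q * T"
        unfolding GQT using c by (intro assoc_mult_mat[symmetric, where n\<^sub>1=r and n\<^sub>2=s and n\<^sub>3=r and n\<^sub>4=r]) auto
      also have "U * \<dots> = U * (mat_adjoint U * Q) * T"
        using c by (intro assoc_mult_mat[symmetric, where n\<^sub>1=s and n\<^sub>2=r and n\<^sub>3=r and n\<^sub>4=r]) auto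
      also have "G - \<dots> = (Q - U * (mat_adjoint U * Q)) * T"
        unfolding GQT using c by (intro minus_mult_distrib_mat[symmetric, where nr=s and n=r and nc=r]) auto
      finally have eq: "G - U * (mat_adjoint U * G) = (Q - U * (mat_adjoint U * Q)) * T" .
      have "fro2 G - (\<Sum>(k, j, b)\<in>entry_index r r. (part b ((mat_adjoint U * G) $$ (k, j)))\<^sup>2)
          = fro2 ((Q - U * (mat_adjoint U * Q)) * T)"
        using fro2_stiefel_complement[OF U G] fro2_part[OF UG] eq by simp
      also have "\<dots> \<le> R * fro2 (Q - U * (mat_adjoint U * Q))"
        by (rule fro2_factor_le[OF Q T _ R]) (use bound c in \<open>auto simp: GQT\<close>)
      also have "fro2 (Q - U * (mat_adjoint U * Q)) = real r - fro2 (mat_adjoint U * Q)"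
        using fro2_stiefel_complement[OF U stiefelD(1)[OF Q]] fro2_stiefel[OF Q] by simp
      also have "fro2 (mat_adjoint U * Q) = fro2 (mat_adjoint (mat_adjoint U * Q))" by simp
      also have "mat_adjoint (mat_adjoint U * Q) = mat_adjoint Q * U"
        using c by (simp add: mat_adjoint_mult[of _ r s _ r])
      finally show ?thesis .
    qed
    then show "\<exists>Q\<in>stiefel s r. \<forall>U\<in>stiefel s r.
        fro2 G - (\<Sum>(k, j, b)\<in>entry_index r r. (part b ((mat_adjoint U * G) $$ (k, j)))\<^sup>2)
          \<le> R * (real r - fro2 (mat_adjoint Q * U))"
      using Q by blast
  qed
  also have "- (real (2 * s * r) - real (card (entry_index r r))) / 2 = - (real s * real r - (real r)\<^sup>2)"
    by (simp add: card_entry_index power2_eq_square field_simps)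
  finally show ?thesis .
qed

section \<open>Change of measure for the Gaussian channel\<close>

text \<open>The weight is the density of variance \<open>t^2\<close> at \<open>a + x\<close> divided
  by the density of variance \<open>s^2\<close> at \<open>x\<close>. After weighting, the law of the
  shifted variable no longer depends on \<open>a\<close>.\<close>

lemma nn_integral_normal_change:
  fixes a s t :: real
  assumes s: "s > 0" and t: "t > 0" and F [measurable]: "F \<in> borel_measurable borel"
  shows "(\<integral>\<^sup>+x. ennreal (s / t * exp (x\<^sup>2 / (2 * s\<^sup>2) - (a + x)\<^sup>2 / (2 * t\<^sup>2))) * F (a + x)
      \<partial>density lborel (normal_density 0 s)) = (\<integral>\<^sup>+x. F x \<partial>density lborel (normal_density 0 t))"
proof -
  have eq: "normal_density 0 s x * (s / t * exp (x\<^sup>2 / (2 * s\<^sup>2) - (a + x)\<^sup>2 / (2 * t\<^sup>2))) = normal_density 0 t (a + 1 * x)" for x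
  proof -
    have "exp (- x\<^sup>2 / (2 * s\<^sup>2)) * exp (x\<^sup>2 / (2 * s\<^sup>2) - (a + x)\<^sup>2 / (2 * t\<^sup>2)) = exp (- (a + x)\<^sup>2 / (2 * t\<^sup>2))"
      by (simp flip: exp_add)
    then show ?thesis using s t by (simp add: normal_density_def real_sqrt_mult)
  qed
  have "(\<integral>\<^sup>+x. ennreal (s / t * exp (x\<^sup>2 / (2 * s\<^sup>2) - (a + x)\<^sup>2 / (2 * t\<^sup>2))) * F (a + x)
      \<partial>density lborel (normal_density 0 s))
    = (\<integral>\<^sup>+x. ennreal (normal_density 0 s x) * (ennreal (s / t * exp (x\<^sup>2 / (2 * s\<^sup>2) - (a + x)\<^sup>2 / (2 * t\<^sup>2))) * F (a + x)) \<partial>lborel)"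
    by (rule nn_integral_density) auto
  also have "\<dots> = (\<integral>\<^sup>+x. ennreal (normal_density 0 t (a + 1 * x)) * F (a + 1 * x) \<partial>lborel)"
    by (subst eq[symmetric]) (simp only: mult.assoc[symmetric] ennreal_mult'[symmetric] normal_density_nonneg mult_1)
  also have "\<dots> = (\<integral>\<^sup>+x. ennreal (normal_density 0 t x) * F x \<partial>lborel)"
    using nn_integral_real_affine[of "\<lambda>x. ennreal (normal_density 0 t x) * F x" 1 a] by simp
  also have "\<dots> = (\<integral>\<^sup>+x. F x \<partial>density lborel (normal_density 0 t))"
    by (rule nn_integral_density[symmetric]) auto
  finally show ?thesis .
qed

lemma nn_integral_normal_second_moment:
  fixes a s :: real
  assumes s: "s > 0"
  shows "(\<integral>\<^sup>+x. ennreal ((a + x)\<^sup>2) \<partial>density lborel (normal_density 0 s)) = ennreal (a\<^sup>2 + s\<^sup>2)"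
proof -
  \<comment> \<open>The square is expanded into moments of order 0, 1 and 2, written so that
    \<open>normal_moment_even\<close> and \<open>normal_moment_nz_1\<close> match literally.\<close>
  have "has_bochner_integral lborel (\<lambda>x. a\<^sup>2 * (normal_density 0 s x * (x - 0) ^ (2 * 0))
      + 2 * a * (normal_density 0 s x * x) + normal_density 0 s x * (x - 0) ^ (2 * 1))
      (a\<^sup>2 * (fact (2 * 0) / ((2 / s\<^sup>2) ^ 0 * fact 0)) + 2 * a * 0 + fact (2 * 1) / ((2 / s\<^sup>2) ^ 1 * fact 1))"
    using s by (intro has_bochner_integral_add has_bochner_integral_mult_right normal_moment_even normal_moment_nz_1)
  also have "(\<lambda>x. a\<^sup>2 * (normal_density 0 s x * (x - 0) ^ (2 * 0))
      + 2 * a * (normal_density 0 s x * x) + normal_density 0 s x * (x - 0) ^ (2 * 1))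
      = (\<lambda>x. normal_density 0 s x * (a + x)\<^sup>2)"
    by (auto simp: fun_eq_iff power2_eq_square algebra_simps)
  also have "a\<^sup>2 * (fact (2 * 0) / ((2 / s\<^sup>2) ^ 0 * fact 0)) + 2 * a * 0 + fact (2 * 1) / ((2 / s\<^sup>2) ^ 1 * fact 1)
      = a\<^sup>2 + s\<^sup>2" by simp
  finally have h: "has_bochner_integral lborel (\<lambda>x. normal_density 0 s x * (a + x)\<^sup>2) (a\<^sup>2 + s\<^sup>2)" .
  have "(\<integral>\<^sup>+x. ennreal ((a + x)\<^sup>2) \<partial>density lborel (normal_density 0 s))
     = (\<integral>\<^sup>+x. ennreal (normal_density 0 s x * (a + x)\<^sup>2) \<partial>lborel)"
    by (subst nn_integral_density) (auto simp: ennreal_mult')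
  also have "\<dots> = ennreal (a\<^sup>2 + s\<^sup>2)"
    using h by (subst nn_integral_eq_integral) (auto simp: has_bochner_integral_iff)
  finally show ?thesis .
qed

lemma measurable_Complex_pair [measurable]:
  "(\<lambda>(x, y). Complex x y) \<in> borel_measurable (borel \<Otimes>\<^sub>M borel)"
  unfolding borel_measurable_complex_iff by (auto simp: case_prod_beta)

lemma sets_complex_normal [simp, measurable_cong]: "sets (complex_normal \<sigma>) = sets borel"
  by (simp add: complex_normal_def)

lemma space_complex_normal [simp]: "space (complex_normal \<sigma>) = UNIV"
  by (simp add: complex_normal_def)

lemma nn_integral_complex_normal:
  assumes \<sigma>: "\<sigma> > 0" and F [measurable]: "F \<in> borel_measurable borel"
  shows "(\<integral>\<^sup>+z. F z \<partial>complex_normal \<sigma>)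
    = (\<integral>\<^sup>+x. (\<integral>\<^sup>+y. F (Complex x y) \<partial>density lborel (normal_density 0 (\<sigma> / sqrt 2)))
        \<partial>density lborel (normal_density 0 (\<sigma> / sqrt 2)))"
proof -
  let ?N = "density lborel (normal_density 0 (\<sigma> / sqrt 2))"
  interpret N: prob_space ?N using \<sigma> by (intro prob_space_normal_density) simp
  have "(\<integral>\<^sup>+z. F z \<partial>complex_normal \<sigma>) = (\<integral>\<^sup>+p. F (case p of (x, y) \<Rightarrow> Complex x y) \<partial>(?N \<Otimes>\<^sub>M ?N))"
    unfolding complex_normal_def by (rule nn_integral_distr) measurable
  also have "\<dots> = (\<integral>\<^sup>+x. (\<integral>\<^sup>+y. F (case (x, y) of (x, y) \<Rightarrow> Complex x y) \<partial>?N) \<partial>?N)"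
    by (rule N.nn_integral_fst[symmetric]) measurable
  finally show ?thesis by simp
qed

lemma prob_space_complex_normal:
  assumes "\<sigma> > 0"
  shows "prob_space (complex_normal \<sigma>)"
proof -
  let ?N = "density lborel (normal_density 0 (\<sigma> / sqrt 2))"
  interpret N: prob_space ?N using assms by (intro prob_space_normal_density) simp
  interpret NN: pair_prob_space ?N ?N ..
  show ?thesis unfolding complex_normal_def by (rule NN.prob_space_distr) measurable
qed

text \<open>The density of \<open>CN(0, \<tau>^2)\<close> at \<open>a + z\<close> over that of
  \<open>CN(0, \<sigma>^2)\<close> at \<open>z\<close>. The usual 1/2 in the exponents is missing
  because each real coordinate carries half the variance.\<close>

definition normal_ratio :: "real \<Rightarrow> real \<Rightarrow> complex \<Rightarrow> complex \<Rightarrow> real" where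
  "normal_ratio \<sigma> \<tau> a z = \<sigma>\<^sup>2 / \<tau>\<^sup>2 * exp ((cmod z)\<^sup>2 / \<sigma>\<^sup>2 - (cmod (a + z))\<^sup>2 / \<tau>\<^sup>2)"

lemma normal_ratio_nonneg [simp]: "normal_ratio \<sigma> \<tau> a z \<ge> 0"
  by (simp add: normal_ratio_def)

lemma measurable_normal_ratio [measurable]: "normal_ratio \<sigma> \<tau> a \<in> borel_measurable borel"
  unfolding normal_ratio_def by measurable

text \<open>The ratio factors over real and imaginary parts, so the real identity applies to one
  coordinate after the other.\<close>

lemma nn_integral_complex_normal_change:
  assumes \<sigma>: "\<sigma> > 0" and \<tau>: "\<tau> > 0" and F [measurable]: "F \<in> borel_measurable borel"
  shows "(\<integral>\<^sup>+z. ennreal (normal_ratio \<sigma> \<tau> a z) * F (a + z) \<partial>complex_normal \<sigma>) = (\<integral>\<^sup>+z. F z \<partial>complex_normal \<tau>)"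
proof -
  let ?s = "\<sigma> / sqrt 2" and ?t = "\<tau> / sqrt 2"
  let ?N = "density lborel (normal_density 0 ?s)" and ?N' = "density lborel (normal_density 0 ?t)"
  interpret N: prob_space ?N using \<sigma> by (intro prob_space_normal_density) simp
  interpret N': prob_space ?N' using \<tau> by (intro prob_space_normal_density) simp
  let ?\<rho> = "\<lambda>b x. ?s / ?t * exp (x\<^sup>2 / (2 * ?s\<^sup>2) - (b + x)\<^sup>2 / (2 * ?t\<^sup>2))"
  have st: "?s > 0" "?t > 0" using \<sigma> \<tau> by auto
  have ratio: "normal_ratio \<sigma> \<tau> a (Complex x y) = ?\<rho> (Re a) x * ?\<rho> (Im a) y" for x y
  proof -
    have "?\<rho> (Re a) x * ?\<rho> (Im a) y = (\<sigma> / \<tau>) * (\<sigma> / \<tau>) *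
        (exp (x\<^sup>2 / (2 * ?s\<^sup>2) - (Re a + x)\<^sup>2 / (2 * ?t\<^sup>2)) * exp (y\<^sup>2 / (2 * ?s\<^sup>2) - (Im a + y)\<^sup>2 / (2 * ?t\<^sup>2)))"
      by simp
    also have "\<dots> = normal_ratio \<sigma> \<tau> a (Complex x y)"
      unfolding normal_ratio_def cmod_power2 exp_add[symmetric]
      by (simp add: power2_eq_square[of \<sigma>] power2_eq_square[of \<tau>] power_divide add_divide_distrib diff_divide_distrib)
    finally show ?thesis ..
  qed
  have mC: "(\<lambda>y. F (Complex x y)) \<in> borel_measurable borel" for x
    using measurable_compose[OF measurable_Pair2'[of x borel borel] measurable_compose[OF measurable_Complex_pair F]]
    by simp
  have mI: "(\<lambda>x. \<integral>\<^sup>+y. F (Complex x y) \<partial>?N') \<in> borel_measurable borel"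
    using N'.borel_measurable_nn_integral[of "\<lambda>x y. F (Complex x y)" borel] measurable_compose[OF measurable_Complex_pair F]
    by (simp add: case_prod_beta cong: measurable_cong_sets)
  have "(\<integral>\<^sup>+z. ennreal (normal_ratio \<sigma> \<tau> a z) * F (a + z) \<partial>complex_normal \<sigma>)
     = (\<integral>\<^sup>+x. (\<integral>\<^sup>+y. ennreal (normal_ratio \<sigma> \<tau> a (Complex x y)) * F (a + Complex x y) \<partial>?N) \<partial>?N)"
    by (rule nn_integral_complex_normal[OF \<sigma>]) measurable
  also have "\<dots> = (\<integral>\<^sup>+x. (\<integral>\<^sup>+y. ennreal (?\<rho> (Re a) x) * (ennreal (?\<rho> (Im a) y) * F (Complex (Re a + x) (Im a + y))) \<partial>?N) \<partial>?N)"
  proof (intro nn_integral_cong)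
    fix x y
    have "a + Complex x y = Complex (Re a + x) (Im a + y)" by (simp add: complex_eq_iff)
    then show "ennreal (normal_ratio \<sigma> \<tau> a (Complex x y)) * F (a + Complex x y)
      = ennreal (?\<rho> (Re a) x) * (ennreal (?\<rho> (Im a) y) * F (Complex (Re a + x) (Im a + y)))"
      unfolding ratio using \<sigma> \<tau>
      by (subst ennreal_mult') (auto simp: mult.assoc intro!: divide_nonneg_nonneg mult_nonneg_nonneg)
  qed
  also have "\<dots> = (\<integral>\<^sup>+x. ennreal (?\<rho> (Re a) x) * (\<integral>\<^sup>+y. ennreal (?\<rho> (Im a) y) * F (Complex (Re a + x) (Im a + y)) \<partial>?N) \<partial>?N)"
  proof (intro nn_integral_cong nn_integral_cmult)
    fix x
    have "(\<lambda>y. F (Complex (Re a + x) (Im a + y))) \<in> borel_measurable borel"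
      using measurable_compose[OF _ mC, of "\<lambda>y. Im a + y" borel] by simp
    then show "(\<lambda>y. ennreal (?\<rho> (Im a) y) * F (Complex (Re a + x) (Im a + y))) \<in> borel_measurable ?N"
      by measurable
  qed
  also have "\<dots> = (\<integral>\<^sup>+x. ennreal (?\<rho> (Re a) x) * (\<integral>\<^sup>+y. F (Complex (Re a + x) y) \<partial>?N') \<partial>?N)"
    using nn_integral_normal_change[OF st mC] by simp
  also have "\<dots> = (\<integral>\<^sup>+x. (\<integral>\<^sup>+y. F (Complex x y) \<partial>?N') \<partial>?N')"
    by (rule nn_integral_normal_change[OF st mI])
  also have "\<dots> = (\<integral>\<^sup>+z. F z \<partial>complex_normal \<tau>)"
    by (rule nn_integral_complex_normal[OF \<tau> F, symmetric])
  finally show ?thesis .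
qed

lemma nn_integral_complex_normal_second_moment:
  assumes \<sigma>: "\<sigma> > 0"
  shows "(\<integral>\<^sup>+z. ennreal ((cmod (a + z))\<^sup>2) \<partial>complex_normal \<sigma>) = ennreal ((cmod a)\<^sup>2 + \<sigma>\<^sup>2)"
proof -
  let ?s = "\<sigma> / sqrt 2"
  let ?N = "density lborel (normal_density 0 ?s)"
  interpret N: prob_space ?N using \<sigma> by (intro prob_space_normal_density) simp
  have s: "?s > 0" "?s\<^sup>2 = \<sigma>\<^sup>2 / 2" using \<sigma> by (auto simp: power_divide)
  have "(\<integral>\<^sup>+z. ennreal ((cmod (a + z))\<^sup>2) \<partial>complex_normal \<sigma>)
     = (\<integral>\<^sup>+x. (\<integral>\<^sup>+y. ennreal ((cmod (a + Complex x y))\<^sup>2) \<partial>?N) \<partial>?N)"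
    by (rule nn_integral_complex_normal[OF \<sigma>]) measurable
  also have "\<dots> = (\<integral>\<^sup>+x. (\<integral>\<^sup>+y. ennreal ((Re a + x)\<^sup>2) + ennreal ((Im a + y)\<^sup>2) \<partial>?N) \<partial>?N)"
    by (simp add: cmod_power2 ennreal_plus)
  also have "\<dots> = (\<integral>\<^sup>+x. ennreal ((Re a + x)\<^sup>2) + ennreal ((Im a)\<^sup>2 + ?s\<^sup>2) \<partial>?N)"
    using N.emeasure_space_1
    by (simp add: nn_integral_add nn_integral_normal_second_moment[OF s(1)] del: ennreal_plus)
  also have "\<dots> = ennreal ((Re a)\<^sup>2 + ?s\<^sup>2) + ennreal ((Im a)\<^sup>2 + ?s\<^sup>2)"
    using N.emeasure_space_1
    by (simp add: nn_integral_add nn_integral_normal_second_moment[OF s(1)] del: ennreal_plus)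
  also have "\<dots> = ennreal ((cmod a)\<^sup>2 + \<sigma>\<^sup>2)"
    unfolding s(2) cmod_power2 by (subst ennreal_plus[symmetric]) (auto simp: algebra_simps)
  finally show ?thesis .
qed

text \<open>Proved as an identity of measures: the weighted and shifted product measure is again a
  product, which only has to be checked on boxes, where both sides factor over the
  coordinates.\<close>

lemma nn_integral_PiM_complex_normal_change:
  assumes \<sigma>: "\<sigma> > 0" and \<tau>: "\<tau> > 0" and I: "finite I"
    and F: "F \<in> borel_measurable (\<Pi>\<^sub>M i\<in>I. (borel :: complex measure))"
  shows "(\<integral>\<^sup>+z. (\<Prod>i\<in>I. ennreal (normal_ratio \<sigma> \<tau> (a i) (z i))) * F (\<lambda>i\<in>I. a i + z i) \<partial>(\<Pi>\<^sub>M i\<in>I. complex_normal \<sigma>))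
    = (\<integral>\<^sup>+z. F z \<partial>(\<Pi>\<^sub>M i\<in>I. complex_normal \<tau>))"
proof -
  let ?P = "\<Pi>\<^sub>M i\<in>I. complex_normal \<sigma>" and ?B = "\<Pi>\<^sub>M i\<in>I. (borel :: complex measure)"
  interpret S: product_sigma_finite "\<lambda>_. complex_normal \<sigma>"
    using prob_space_complex_normal[OF \<sigma>] by (simp add: product_sigma_finite_def prob_space_imp_sigma_finite)
  interpret T: product_sigma_finite "\<lambda>_. complex_normal \<tau>"
    using prob_space_complex_normal[OF \<tau>] by (simp add: product_sigma_finite_def prob_space_imp_sigma_finite)
  define \<rho> where "\<rho> z = (\<Prod>i\<in>I. ennreal (normal_ratio \<sigma> \<tau> (a i) (z i)))" for z
  define h where "h z = (\<lambda>i\<in>I. a i + z i)" for z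
  have \<rho> [measurable]: "\<rho> \<in> borel_measurable ?P"
    unfolding \<rho>_def by measurable
  have h [measurable]: "h \<in> ?P \<rightarrow>\<^sub>M ?B"
    unfolding h_def by (intro measurable_restrict) measurable
  have eqB: "sets (\<Pi>\<^sub>M i\<in>I. complex_normal \<tau>) = sets ?B" by (intro sets_PiM_cong) auto
  have eq: "distr (density ?P \<rho>) ?B h = (\<Pi>\<^sub>M i\<in>I. complex_normal \<tau>)"
  proof (rule T.PiM_eqI[OF I])
    show "sets (distr (density ?P \<rho>) ?B h) = sets (\<Pi>\<^sub>M i\<in>I. complex_normal \<tau>)" using eqB by simp
    fix A assume A: "\<And>i. i \<in> I \<Longrightarrow> A i \<in> sets (complex_normal \<tau>)"
    then have A': "\<And>i. i \<in> I \<Longrightarrow> A i \<in> sets borel" by simp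
    have box: "Pi\<^sub>E I A \<in> sets ?B" using A' I by (intro sets_PiM_I_finite) auto
    have "emeasure (distr (density ?P \<rho>) ?B h) (Pi\<^sub>E I A) = (\<integral>\<^sup>+z. indicator (Pi\<^sub>E I A) z \<partial>distr (density ?P \<rho>) ?B h)"
      using box by simp
    also have "\<dots> = (\<integral>\<^sup>+z. indicator (Pi\<^sub>E I A) (h z) \<partial>density ?P \<rho>)"
      using box by (intro nn_integral_distr) auto
    also have "\<dots> = (\<integral>\<^sup>+z. \<rho> z * indicator (Pi\<^sub>E I A) (h z) \<partial>?P)"
      using measurable_sets[OF h box] box by (intro nn_integral_density) auto
    also have "\<dots> = (\<integral>\<^sup>+z. (\<Prod>i\<in>I. ennreal (normal_ratio \<sigma> \<tau> (a i) (z i)) * indicator (A i) (a i + z i)) \<partial>?P)"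
    proof (rule nn_integral_cong)
      fix z
      have "indicator (Pi\<^sub>E I A) (h z) = (\<Prod>i\<in>I. indicator (A i) (a i + z i) :: ennreal)"
      proof (cases "\<forall>i\<in>I. a i + z i \<in> A i")
        case True
        then show ?thesis by (auto simp: h_def indicator_def)
      next
        case False
        then show ?thesis using I by (auto simp: h_def indicator_def Pi_iff intro!: prod_zero[symmetric])
      qed
      then show "\<rho> z * indicator (Pi\<^sub>E I A) (h z)
          = (\<Prod>i\<in>I. ennreal (normal_ratio \<sigma> \<tau> (a i) (z i)) * indicator (A i) (a i + z i))"
        by (simp add: \<rho>_def prod.distrib)
    qed
    also have "\<dots> = (\<Prod>i\<in>I. \<integral>\<^sup>+z. ennreal (normal_ratio \<sigma> \<tau> (a i) z) * indicator (A i) (a i + z) \<partial>complex_normal \<sigma>)"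
    proof (rule S.product_nn_integral_prod[OF I])
      fix i assume "i \<in> I"
      then have [measurable]: "A i \<in> sets borel" by (rule A')
      show "(\<lambda>z. ennreal (normal_ratio \<sigma> \<tau> (a i) z) * indicator (A i) (a i + z)) \<in> borel_measurable (complex_normal \<sigma>)"
        by measurable
    qed
    also have "\<dots> = (\<Prod>i\<in>I. emeasure (complex_normal \<tau>) (A i))"
      using A' by (intro prod.cong refl) (subst nn_integral_complex_normal_change[OF \<sigma> \<tau>], auto)
    finally show "emeasure (distr (density ?P \<rho>) ?B h) (Pi\<^sub>E I A) = (\<Prod>i\<in>I. emeasure (complex_normal \<tau>) (A i))" .
  qed
  have "(\<integral>\<^sup>+z. F z \<partial>(\<Pi>\<^sub>M i\<in>I. complex_normal \<tau>)) = (\<integral>\<^sup>+z. F z \<partial>distr (density ?P \<rho>) ?B h)"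
    by (simp only: eq)
  also have "\<dots> = (\<integral>\<^sup>+z. F (h z) \<partial>density ?P \<rho>)"
    using F by (intro nn_integral_distr) auto
  also have "\<dots> = (\<integral>\<^sup>+z. \<rho> z * F (h z) \<partial>?P)"
    using measurable_compose[OF h F] by (intro nn_integral_density) auto
  finally show ?thesis by (simp only: \<rho>_def h_def)
qed

section \<open>Complex Gaussian vectors\<close>

lemma space_borel_vec [simp]: "space (borel_vec m) = carrier_vec m"
  by (simp add: borel_vec_def)

lemma measurable_borel_vecI:
  assumes "\<And>x. x \<in> space M \<Longrightarrow> h x \<in> carrier_vec m"
    and "\<And>i. i < m \<Longrightarrow> (\<lambda>x. h x $ i) \<in> borel_measurable M"
  shows "h \<in> M \<rightarrow>\<^sub>M borel_vec m"
  unfolding borel_vec_def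
  by (rule measurable_vimage_algebra2) (use assms in \<open>auto intro!: measurable_restrict\<close>)

lemma measurable_vec_index:
  assumes h: "h \<in> M \<rightarrow>\<^sub>M borel_vec m" and i: "i < m"
  shows "(\<lambda>x. h x $ i) \<in> borel_measurable M"
proof -
  have "(\<lambda>v. \<lambda>i\<in>{..<m}. v $ i) \<in> borel_vec m \<rightarrow>\<^sub>M (\<Pi>\<^sub>M i\<in>{..<m}. borel :: complex measure)"
    unfolding borel_vec_def by (rule measurable_vimage_algebra1) (auto simp: space_PiM)
  then have "(\<lambda>v. (\<lambda>i\<in>{..<m}. v $ i) i) \<in> borel_measurable (borel_vec m)"
    by (rule measurable_compose[OF _ measurable_component_singleton]) (use i in auto)
  then have "(\<lambda>v. v $ i) \<in> borel_measurable (borel_vec m)"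
    using i by simp
  from measurable_compose[OF h this] show ?thesis .
qed

lemma measurable_vec_carrier:
  "h \<in> M \<rightarrow>\<^sub>M borel_vec m \<Longrightarrow> x \<in> space M \<Longrightarrow> h x \<in> carrier_vec m"
  using measurable_space[of h M "borel_vec m" x] by simp

lemma measurable_vec_add:
  assumes f: "f \<in> M \<rightarrow>\<^sub>M borel_vec m" and g: "g \<in> M \<rightarrow>\<^sub>M borel_vec m"
  shows "(\<lambda>x. f x + g x) \<in> M \<rightarrow>\<^sub>M borel_vec m"
proof (rule measurable_borel_vecI)
  note c = measurable_vec_carrier[OF f] measurable_vec_carrier[OF g]
  show "f x + g x \<in> carrier_vec m" if "x \<in> space M" for x
    using c[OF that] by auto
  fix i assume i: "i < m"
  have "(\<lambda>x. f x $ i + g x $ i) \<in> borel_measurable M"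
    using measurable_vec_index[OF f i] measurable_vec_index[OF g i] by measurable
  also have "?this \<longleftrightarrow> (\<lambda>x. (f x + g x) $ i) \<in> borel_measurable M"
  proof (rule measurable_cong)
    fix x assume "x \<in> space M"
    then show "f x $ i + g x $ i = (f x + g x) $ i"
      using carrier_vecD[OF c(2)] i by simp
  qed
  finally show "(\<lambda>x. (f x + g x) $ i) \<in> borel_measurable M" .
qed

lemma norm2_vec_power2: "v \<in> carrier_vec m \<Longrightarrow> (norm2_vec v)\<^sup>2 = (\<Sum>i<m. (cmod (v $ i))\<^sup>2)"
  by (simp add: norm2_vec_def sum_nonneg)

lemma measurable_norm2_vec:
  assumes h: "h \<in> M \<rightarrow>\<^sub>M borel_vec m"
  shows "(\<lambda>x. (norm2_vec (h x))\<^sup>2) \<in> borel_measurable M"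
proof -
  have "(\<lambda>x. \<Sum>i<m. (cmod (h x $ i))\<^sup>2) \<in> borel_measurable M"
    using measurable_vec_index[OF h]
    by (intro borel_measurable_sum borel_measurable_power borel_measurable_norm) auto
  also have "?this \<longleftrightarrow> ?thesis"
    by (rule measurable_cong) (rule norm2_vec_power2[OF measurable_vec_carrier[OF h], symmetric])
  finally show ?thesis .
qed

lemma sets_complex_normal_vec [simp, measurable_cong]: "sets (complex_normal_vec m \<sigma>) = sets (borel_vec m)"
  by (simp add: complex_normal_vec_def)

lemma space_complex_normal_vec [simp]: "space (complex_normal_vec m \<sigma>) = carrier_vec m"
  by (simp add: complex_normal_vec_def)

lemma measurable_vec_PiM:
  "vec m \<in> (\<Pi>\<^sub>M i\<in>{..<m}. complex_normal \<sigma>) \<rightarrow>\<^sub>M borel_vec m"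
  by (rule measurable_borel_vecI) (auto intro: measurable_component_singleton)

lemma prob_space_complex_normal_vec:
  assumes "\<sigma> > 0"
  shows "prob_space (complex_normal_vec m \<sigma>)"
proof -
  interpret prob_space "\<Pi>\<^sub>M i\<in>{..<m}. complex_normal \<sigma>"
    by (intro prob_space_PiM prob_space_complex_normal assms)
  show ?thesis unfolding complex_normal_vec_def by (rule prob_space_distr[OF measurable_vec_PiM])
qed

lemma nn_integral_complex_normal_vec:
  assumes "F \<in> borel_measurable (borel_vec m)"
  shows "(\<integral>\<^sup>+Z. F Z \<partial>complex_normal_vec m \<sigma>) = (\<integral>\<^sup>+z. F (vec m z) \<partial>(\<Pi>\<^sub>M i\<in>{..<m}. complex_normal \<sigma>))"
  unfolding complex_normal_vec_def by (rule nn_integral_distr[OF measurable_vec_PiM]) (simp add: assms)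

lemma nn_integral_complex_normal_vec_change:
  assumes \<sigma>: "\<sigma> > 0" and \<tau>: "\<tau> > 0" and a: "a \<in> carrier_vec m" and F: "F \<in> borel_measurable (borel_vec m)"
  shows "(\<integral>\<^sup>+Z. ennreal ((\<sigma>\<^sup>2 / \<tau>\<^sup>2) ^ m * exp ((norm2_vec Z)\<^sup>2 / \<sigma>\<^sup>2 - (norm2_vec (a + Z))\<^sup>2 / \<tau>\<^sup>2)) * F (a + Z)
      \<partial>complex_normal_vec m \<sigma>) = (\<integral>\<^sup>+Z. F Z \<partial>complex_normal_vec m \<tau>)"
proof -
  let ?P = "\<Pi>\<^sub>M i\<in>{..<m}. complex_normal \<sigma>"
  have id: "(\<lambda>Z. Z) \<in> borel_vec m \<rightarrow>\<^sub>M borel_vec m" by simp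
  have ad: "(\<lambda>Z. a + Z) \<in> borel_vec m \<rightarrow>\<^sub>M borel_vec m"
    using a by (intro measurable_vec_add) auto
  note [measurable] = measurable_norm2_vec[OF id] measurable_norm2_vec[OF ad] measurable_compose[OF ad F]
  have B: "vec m \<in> (\<Pi>\<^sub>M i\<in>{..<m}. (borel :: complex measure)) \<rightarrow>\<^sub>M borel_vec m"
    by (rule measurable_borel_vecI) (auto intro: measurable_component_singleton)
  have "(\<integral>\<^sup>+Z. ennreal ((\<sigma>\<^sup>2 / \<tau>\<^sup>2) ^ m * exp ((norm2_vec Z)\<^sup>2 / \<sigma>\<^sup>2 - (norm2_vec (a + Z))\<^sup>2 / \<tau>\<^sup>2)) * F (a + Z)
      \<partial>complex_normal_vec m \<sigma>)
    = (\<integral>\<^sup>+z. ennreal ((\<sigma>\<^sup>2 / \<tau>\<^sup>2) ^ m * exp ((norm2_vec (vec m z))\<^sup>2 / \<sigma>\<^sup>2 - (norm2_vec (a + vec m z))\<^sup>2 / \<tau>\<^sup>2))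
        * F (a + vec m z) \<partial>?P)"
    by (rule nn_integral_complex_normal_vec) measurable
  also have "\<dots> = (\<integral>\<^sup>+z. (\<Prod>i\<in>{..<m}. ennreal (normal_ratio \<sigma> \<tau> (a $ i) (z i))) * F (vec m (\<lambda>i\<in>{..<m}. a $ i + z i)) \<partial>?P)"
  proof (rule nn_integral_cong)
    fix z :: "nat \<Rightarrow> complex"
    have v: "a + vec m z = vec m (\<lambda>i\<in>{..<m}. a $ i + z i)" using a by (intro eq_vecI) auto
    have "(\<Prod>i\<in>{..<m}. normal_ratio \<sigma> \<tau> (a $ i) (z i))
        = (\<sigma>\<^sup>2 / \<tau>\<^sup>2) ^ m * exp (\<Sum>i<m. (cmod (z i))\<^sup>2 / \<sigma>\<^sup>2 - (cmod (a $ i + z i))\<^sup>2 / \<tau>\<^sup>2)"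
      by (simp only: normal_ratio_def prod.distrib exp_sum prod_constant card_lessThan finite_lessThan)
    also have "(\<Sum>i<m. (cmod (z i))\<^sup>2 / \<sigma>\<^sup>2 - (cmod (a $ i + z i))\<^sup>2 / \<tau>\<^sup>2)
        = (norm2_vec (vec m z))\<^sup>2 / \<sigma>\<^sup>2 - (norm2_vec (a + vec m z))\<^sup>2 / \<tau>\<^sup>2"
      unfolding v by (simp add: norm2_vec_power2[of _ m] sum_subtractf sum_divide_distrib)
    finally show "ennreal ((\<sigma>\<^sup>2 / \<tau>\<^sup>2) ^ m * exp ((norm2_vec (vec m z))\<^sup>2 / \<sigma>\<^sup>2 - (norm2_vec (a + vec m z))\<^sup>2 / \<tau>\<^sup>2))
        * F (a + vec m z)
      = (\<Prod>i\<in>{..<m}. ennreal (normal_ratio \<sigma> \<tau> (a $ i) (z i))) * F (vec m (\<lambda>i\<in>{..<m}. a $ i + z i))"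
      unfolding v by (subst prod_ennreal) auto
  qed
  also have "\<dots> = (\<integral>\<^sup>+z. F (vec m z) \<partial>(\<Pi>\<^sub>M i\<in>{..<m}. complex_normal \<tau>))"
    by (rule nn_integral_PiM_complex_normal_change[OF \<sigma> \<tau>, where F = "\<lambda>z. F (vec m z)"])
      (auto intro: measurable_compose[OF B F])
  also have "\<dots> = (\<integral>\<^sup>+Z. F Z \<partial>complex_normal_vec m \<tau>)"
    by (rule nn_integral_complex_normal_vec[OF F, symmetric])
  finally show ?thesis .
qed

lemma nn_integral_complex_normal_vec_second_moment:
  assumes \<sigma>: "\<sigma> > 0" and a: "a \<in> carrier_vec m"
  shows "(\<integral>\<^sup>+Z. ennreal ((norm2_vec (a + Z))\<^sup>2) \<partial>complex_normal_vec m \<sigma>) = ennreal ((norm2_vec a)\<^sup>2 + real m * \<sigma>\<^sup>2)"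
proof -
  let ?P = "\<Pi>\<^sub>M i\<in>{..<m}. complex_normal \<sigma>"
  interpret C: prob_space "complex_normal \<sigma>" by (rule prob_space_complex_normal[OF \<sigma>])
  interpret PP: product_prob_space "\<lambda>_. complex_normal \<sigma>" "{..<m}" ..
  have ad: "(\<lambda>Z. a + Z) \<in> borel_vec m \<rightarrow>\<^sub>M borel_vec m"
    using a by (intro measurable_vec_add) auto
  note [measurable] = measurable_norm2_vec[OF ad]
  have "(\<integral>\<^sup>+Z. ennreal ((norm2_vec (a + Z))\<^sup>2) \<partial>complex_normal_vec m \<sigma>)
     = (\<integral>\<^sup>+z. ennreal ((norm2_vec (a + vec m z))\<^sup>2) \<partial>?P)"
    by (rule nn_integral_complex_normal_vec) measurable
  also have "\<dots> = (\<integral>\<^sup>+z. (\<Sum>i<m. ennreal ((cmod (a $ i + z i))\<^sup>2)) \<partial>?P)"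
    using a by (intro nn_integral_cong) (simp add: norm2_vec_power2[of _ m] sum_ennreal)
  also have "\<dots> = (\<Sum>i<m. \<integral>\<^sup>+z. ennreal ((cmod (a $ i + z i))\<^sup>2) \<partial>?P)"
    by (intro nn_integral_sum) measurable
  also have "\<dots> = (\<Sum>i<m. ennreal ((cmod (a $ i))\<^sup>2 + \<sigma>\<^sup>2))"
  proof (rule sum.cong[OF refl])
    fix i assume i: "i \<in> {..<m}"
    have "(\<integral>\<^sup>+z. ennreal ((cmod (a $ i + z i))\<^sup>2) \<partial>?P)
        = (\<integral>\<^sup>+x. ennreal ((cmod (a $ i + x))\<^sup>2) \<partial>distr ?P (complex_normal \<sigma>) (\<lambda>z. z i))"
      using i by (subst nn_integral_distr) measurable
    also have "distr ?P (complex_normal \<sigma>) (\<lambda>z. z i) = complex_normal \<sigma>"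
      using PP.PiM_component[OF i] by simp
    finally show "(\<integral>\<^sup>+z. ennreal ((cmod (a $ i + z i))\<^sup>2) \<partial>?P) = ennreal ((cmod (a $ i))\<^sup>2 + \<sigma>\<^sup>2)"
      by (simp only: nn_integral_complex_normal_second_moment[OF \<sigma>])
  qed
  also have "\<dots> = ennreal ((norm2_vec a)\<^sup>2 + real m * \<sigma>\<^sup>2)"
    by (subst sum_ennreal) (auto simp: norm2_vec_power2[OF a] sum.distrib)
  finally show ?thesis .
qed

text \<open>Jensen's inequality, from the tangent line of the exponential at the mean of
  \<open>W\<close>.\<close>

lemma (in prob_space) exp_expectation_le:
  assumes W: "integrable M W" and le: "(\<integral>\<^sup>+x. ennreal (exp (W x)) \<partial>M) \<le> ennreal K"
  shows "exp (\<integral>x. W x \<partial>M) \<le> K"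
proof -
  define t where "t = (\<integral>x. W x \<partial>M)"
  have [measurable]: "W \<in> borel_measurable M" using W by simp
  have fin: "(\<integral>\<^sup>+x. ennreal (exp (W x)) \<partial>M) < \<infinity>" using le by (simp add: le_less_trans)
  have eW: "integrable M (\<lambda>x. exp (W x))"
    using fin by (intro integrableI_nonneg) auto
  have "exp t = (\<integral>x. exp t * (1 - t + W x) \<partial>M)"
    using W by (simp add: t_def prob_space)
  also have "\<dots> \<le> (\<integral>x. exp (W x) \<partial>M)"
  proof (rule integral_mono[OF _ eW])
    show "integrable M (\<lambda>x. exp t * (1 - t + W x))" using W by simp
    fix x
    have "exp t * (1 + (W x - t)) \<le> exp t * exp (W x - t)"
      by (intro mult_left_mono exp_ge_add_one_self) auto
    then show "exp t * (1 - t + W x) \<le> exp (W x)" by (simp add: exp_diff algebra_simps)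
  qed
  finally have "ennreal (exp t) \<le> ennreal (\<integral>x. exp (W x) \<partial>M)" by (rule ennreal_leI)
  also have "\<dots> = (\<integral>\<^sup>+x. ennreal (exp (W x)) \<partial>M)"
    using eW by (intro nn_integral_eq_integral[symmetric]) auto
  also note le
  finally have *: "ennreal (exp t) \<le> ennreal K" .
  \<comment> \<open>\<open>ennreal\<close> sends negative numbers to 0, so the sign of
    \<open>K\<close> has to be settled before passing back to the reals.\<close>
  have "K > 0"
  proof (rule ccontr)
    assume "\<not> K > 0"
    then have "ennreal (exp t) \<le> 0" using * by (simp add: ennreal_neg)
    then show False by (simp add: ennreal_eq_0_iff not_le)
  qed
  then show ?thesis using * by (simp add: t_def ennreal_le_iff)
qed

section \<open>The converse bound\<close>

lemma integral_bound_of_nn_integral: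
  assumes h: "h \<in> borel_measurable M" "\<And>x. h x \<ge> (0 :: real)"
    and le: "(\<integral>\<^sup>+x. ennreal (h x) \<partial>M) \<le> ennreal c" and c: "c \<ge> 0"
  shows "integrable M h" "(\<integral>x. h x \<partial>M) \<le> c"
proof -
  have "(\<integral>\<^sup>+x. ennreal (h x) \<partial>M) < \<infinity>" using le by (simp add: le_less_trans)
  then show i: "integrable M h" using h by (intro integrableI_nonneg) auto
  have "(\<integral>\<^sup>+x. ennreal (h x) \<partial>M) = ennreal (\<integral>x. h x \<partial>M)"
    using h i by (intro nn_integral_eq_integral) auto
  then show "(\<integral>x. h x \<partial>M) \<le> c" using le c by (simp add: ennreal_le_iff)
qed

text \<open>Weighting by the likelihood ratio turns the joint law of \<open>X\<close> and the
  channel output into a product law. There the output \<open>Y\<close> is independent of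
  \<open>X\<close>, so \<open>g Y\<close> stays fixed while \<open>X\<close> is integrated, which is
  the situation of \<open>moment\<close>. The price is the mean of the log ratio, which the power
  constraint keeps above \<open>- m ln (1 + 1 / \<sigma>^2)\<close>.\<close>

lemma rate_distortion_converse:
  fixes K \<theta> \<delta> \<sigma> :: real
  assumes PX: "prob_space PX" "sets PX = sets (borel_mat n1 n2)"
    and \<sigma>: "\<sigma> > 0" and \<theta>: "\<theta> \<ge> 0" and \<delta>: "\<delta> \<ge> 0" and K: "K > 0"
    and f: "f \<in> borel_mat n1 n2 \<rightarrow>\<^sub>M borel_vec m" and g: "g \<in> borel_vec m \<rightarrow>\<^sub>M borel_mat n1 n2"
    and power: "(\<integral>\<^sup>+X. ennreal ((norm2_vec (f X))\<^sup>2) \<partial>PX) \<le> ennreal (real m)"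
    and range: "AE (X, Z) in PX \<Otimes>\<^sub>M complex_normal_vec m \<sigma>. g (f X + Z) \<in> S"
    and dist: "(\<integral>\<^sup>+(X, Z). ennreal (fro2 (g (f X + Z) - X)) \<partial>(PX \<Otimes>\<^sub>M complex_normal_vec m \<sigma>)) \<le> ennreal \<delta>"
    and moment: "\<And>Y. Y \<in> S \<Longrightarrow> (\<integral>\<^sup>+X. ennreal (exp (- \<theta> * fro2 (Y - X))) \<partial>PX) \<le> ennreal K"
  shows "- \<theta> * \<delta> - real m * ln (1 + 1 / \<sigma>\<^sup>2) \<le> ln K"
proof -
  \<comment> \<open>\<open>1 + \<sigma>^2\<close> is the mean output power per coordinate when the
    power constraint is attained.\<close>
  define \<tau> where "\<tau> = sqrt (1 + \<sigma>\<^sup>2)"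
  have \<tau>: "\<tau> > 0" "\<tau>\<^sup>2 = 1 + \<sigma>\<^sup>2" by (auto simp: \<tau>_def add_pos_nonneg)
  let ?Z = "complex_normal_vec m \<sigma>" and ?Y = "complex_normal_vec m \<tau>"
  let ?P = "PX \<Otimes>\<^sub>M ?Z"
  interpret PX: prob_space PX by (rule PX(1))
  interpret Z: prob_space ?Z by (rule prob_space_complex_normal_vec[OF \<sigma>])
  interpret Y: prob_space ?Y by (rule prob_space_complex_normal_vec[OF \<tau>(1)])
  interpret P: pair_prob_space PX ?Z ..
  interpret PXY: pair_sigma_finite PX ?Y ..
  note [measurable_cong] = PX(2)
  have spX: "space PX = carrier_mat n1 n2" using sets_eq_imp_space_eq[OF PX(2)] by simp
  have mX: "fst \<in> ?P \<rightarrow>\<^sub>M borel_mat n1 n2" and mZ: "snd \<in> ?P \<rightarrow>\<^sub>M borel_vec m" by measurable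
  have mfX: "(\<lambda>p. f (fst p) + snd p) \<in> ?P \<rightarrow>\<^sub>M borel_vec m"
    by (intro measurable_vec_add measurable_compose[OF mX f] mZ)
  have md: "(\<lambda>p. fro2 (g (f (fst p) + snd p) - fst p)) \<in> borel_measurable ?P"
    by (rule measurable_fro2[OF measurable_mat_minus[OF measurable_compose[OF mfX g] mX]])
  note mu = measurable_norm2_vec[OF mZ] and mv = measurable_norm2_vec[OF mfX]
  define d u v where "d p = fro2 (g (f (fst p) + snd p) - fst p)"
    and "u p = (norm2_vec (snd p))\<^sup>2" and "v p = (norm2_vec (f (fst p) + snd p))\<^sup>2"
    for p :: "complex mat \<times> complex vec"
  note [measurable] = md[folded d_def] mu[folded u_def] mv[folded v_def]
  have pos: "d p \<ge> 0" "u p \<ge> 0" "v p \<ge> 0" for p by (auto simp: d_def u_def v_def)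
  have fX: "f X \<in> carrier_vec m" if "X \<in> carrier_mat n1 n2" for X
    using measurable_space[OF f] that by simp
  have secm: "(\<integral>\<^sup>+p. ennreal (v p) \<partial>?P) \<le> ennreal (real m + real m * \<sigma>\<^sup>2)"
  proof -
    have "(\<integral>\<^sup>+p. ennreal (v p) \<partial>?P) = (\<integral>\<^sup>+X. (\<integral>\<^sup>+Z. ennreal ((norm2_vec (f X + Z))\<^sup>2) \<partial>?Z) \<partial>PX)"
      by (subst Z.nn_integral_fst[symmetric]) (simp_all add: v_def[symmetric], simp add: v_def)
    also have "\<dots> = (\<integral>\<^sup>+X. ennreal ((norm2_vec (f X))\<^sup>2) + ennreal (real m * \<sigma>\<^sup>2) \<partial>PX)"
      using fX spX by (intro nn_integral_cong)
        (simp add: nn_integral_complex_normal_vec_second_moment[OF \<sigma>] ennreal_plus)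
    also have "\<dots> = (\<integral>\<^sup>+X. ennreal ((norm2_vec (f X))\<^sup>2) \<partial>PX) + ennreal (real m * \<sigma>\<^sup>2)"
      using measurable_norm2_vec[OF f] PX.emeasure_space_1 by (subst nn_integral_add) auto
    also have "\<dots> \<le> ennreal (real m) + ennreal (real m * \<sigma>\<^sup>2)"
      by (intro add_right_mono power)
    finally show ?thesis by (simp add: ennreal_plus)
  qed
  have sec0: "(\<integral>\<^sup>+p. ennreal (u p) \<partial>?P) = ennreal (real m * \<sigma>\<^sup>2)"
  proof -
    have "(\<integral>\<^sup>+p. ennreal (u p) \<partial>?P) = (\<integral>\<^sup>+X. (\<integral>\<^sup>+Z. ennreal ((norm2_vec Z)\<^sup>2) \<partial>?Z) \<partial>PX)"
      by (subst Z.nn_integral_fst[symmetric]) (simp_all add: u_def[symmetric], simp add: u_def)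
    also have "(\<integral>\<^sup>+Z. ennreal ((norm2_vec Z)\<^sup>2) \<partial>?Z) = (\<integral>\<^sup>+Z. ennreal ((norm2_vec (0\<^sub>v m + Z))\<^sup>2) \<partial>?Z)"
      by (intro nn_integral_cong) simp
    also have "\<dots> = ennreal (real m * \<sigma>\<^sup>2)"
      by (subst nn_integral_complex_normal_vec_second_moment[OF \<sigma>]) (auto simp: norm2_vec_def)
    finally show ?thesis by (simp add: PX.emeasure_space_1)
  qed
  have dist': "(\<integral>\<^sup>+p. ennreal (d p) \<partial>?P) \<le> ennreal \<delta>"
    using dist unfolding d_def case_prod_unfold .
  have di: "integrable ?P d" "(\<integral>p. d p \<partial>?P) \<le> \<delta>"
    using integral_bound_of_nn_integral[of d ?P, OF _ _ dist' \<delta>] pos by auto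
  have vi: "integrable ?P v" "(\<integral>p. v p \<partial>?P) \<le> real m + real m * \<sigma>\<^sup>2"
    using integral_bound_of_nn_integral[of v ?P, OF _ _ secm] pos by auto
  have ui: "integrable ?P u"
    using integral_bound_of_nn_integral(1)[of u ?P, OF _ _ eq_refl[OF sec0]] pos by auto
  have "(\<integral>\<^sup>+p. ennreal (u p) \<partial>?P) = ennreal (\<integral>p. u p \<partial>?P)"
    using ui pos by (intro nn_integral_eq_integral) auto
  then have ue: "(\<integral>p. u p \<partial>?P) = real m * \<sigma>\<^sup>2"
    using sec0 pos by (simp add: ennreal_inj integral_nonneg_AE)
  \<comment> \<open>The logarithm of the normalising factor
    \<open>(\<tau>^2 / \<sigma>^2) ^ m\<close> between the two Gaussian densities.\<close>
  define L where "L = real m * ln (1 + 1 / \<sigma>\<^sup>2)"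
  have "\<sigma>\<^sup>2 / \<tau>\<^sup>2 = inverse (1 + 1 / \<sigma>\<^sup>2)"
    using \<sigma> unfolding \<tau>(2) by (simp add: field_simps)
  then have expL: "exp (- L) = (\<sigma>\<^sup>2 / \<tau>\<^sup>2) ^ m"
    using \<sigma> unfolding L_def exp_minus exp_of_nat_mult by (simp add: power_inverse add_pos_pos)
  \<comment> \<open>Minus \<open>\<theta>\<close> times the distortion, plus the logarithm of the
    density of the reference output over that of the channel output.\<close>
  define W where "W p = - \<theta> * d p + (u p / \<sigma>\<^sup>2 - v p / \<tau>\<^sup>2) - L" for p
  have Wi: "integrable ?P W"
    unfolding W_def using di(1) vi(1) ui by auto
  have EW: "(\<integral>p. W p \<partial>?P) \<ge> - \<theta> * \<delta> - L"
  proof -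
    have "(\<integral>p. W p \<partial>?P) = - \<theta> * (\<integral>p. d p \<partial>?P) + ((\<integral>p. u p \<partial>?P) / \<sigma>\<^sup>2 - (\<integral>p. v p \<partial>?P) / \<tau>\<^sup>2) - L"
      unfolding W_def using di(1) vi(1) ui by (simp add: P.prob_space)
    moreover have "(\<integral>p. u p \<partial>?P) / \<sigma>\<^sup>2 = real m" using \<sigma> by (simp add: ue)
    \<comment> \<open>Signal and noise powers add up to at most \<open>m * \<tau>^2\<close>. The
      resulting \<open>- m\<close> is compensated by the \<open>m\<close> coming from
      \<open>u\<close>, so that only \<open>- L\<close> is left of the log ratio.\<close>
    moreover have "(\<integral>p. v p \<partial>?P) / \<tau>\<^sup>2 \<le> real m"
    proof -
      have "real m + real m * \<sigma>\<^sup>2 = real m * \<tau>\<^sup>2" unfolding \<tau>(2) by (simp add: algebra_simps)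
      then show ?thesis using vi(2) \<tau>(1) by (subst pos_divide_le_eq) auto
    qed
    moreover have "\<theta> * (\<integral>p. d p \<partial>?P) \<le> \<theta> * \<delta>" using di(2) \<theta> by (rule mult_left_mono)
    ultimately show ?thesis by simp
  qed
  define E where "E = (\<lambda>(X, Y). ennreal (exp (- \<theta> * fro2 (g Y - X))))"
  \<comment> \<open>\<open>range\<close> holds almost surely for the channel law and says nothing
    for the independent output. The outputs satisfying the moment bound are therefore cut out by an
    indicator before the change of measure; \<open>B\<close> is measurable, while \<open>S\<close>
    is an arbitrary set.\<close>
  define B where "B = {Y \<in> space (borel_vec m). (\<integral>\<^sup>+X. E (X, Y) \<partial>PX) \<le> ennreal K}"
  have mE: "E \<in> borel_measurable (PX \<Otimes>\<^sub>M ?Y)"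
  proof -
    have 1: "fst \<in> PX \<Otimes>\<^sub>M ?Y \<rightarrow>\<^sub>M borel_mat n1 n2" and 2: "snd \<in> PX \<Otimes>\<^sub>M ?Y \<rightarrow>\<^sub>M borel_vec m" by measurable
    have [measurable]: "(\<lambda>p. fro2 (g (snd p) - fst p)) \<in> borel_measurable (PX \<Otimes>\<^sub>M ?Y)"
      by (rule measurable_fro2[OF measurable_mat_minus[OF measurable_compose[OF 2 g] 1]])
    show ?thesis unfolding E_def case_prod_beta by measurable
  qed
  have "(\<lambda>Y. \<integral>\<^sup>+X. E (X, Y) \<partial>PX) \<in> borel_measurable ?Y"
    using PX.borel_measurable_nn_integral_fst[OF measurable_pair_swap[OF mE]] by simp
  then have "(\<lambda>Y. \<integral>\<^sup>+X. E (X, Y) \<partial>PX) \<in> borel_measurable (borel_vec m)"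
    by (simp cong: measurable_cong_sets)
  then have B: "B \<in> sets (borel_vec m)" unfolding B_def by measurable
  have mF: "(\<lambda>Y. E (X, Y) * indicator B Y) \<in> borel_measurable (borel_vec m)"
    if X: "X \<in> carrier_mat n1 n2" for X
  proof -
    have [measurable]: "(\<lambda>Y. fro2 (g Y - X)) \<in> borel_measurable (borel_vec m)"
      using X by (intro measurable_fro2[OF measurable_mat_minus[OF g]]) auto
    have [measurable]: "indicator B \<in> borel_measurable (borel_vec m)"
      using B by (rule borel_measurable_indicator)
    have "(\<lambda>Y. ennreal (exp (- \<theta> * fro2 (g Y - X))) * indicator B Y) \<in> borel_measurable (borel_vec m)"
      by measurable
    then show ?thesis by (simp add: E_def)
  qed
  have mH: "(\<lambda>p. E p * indicator B (snd p)) \<in> borel_measurable (PX \<Otimes>\<^sub>M ?Y)"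
  proof -
    have "(\<lambda>p. indicator B (snd p) :: ennreal) \<in> borel_measurable (PX \<Otimes>\<^sub>M ?Y)"
      using B by (intro measurable_compose[OF measurable_snd] borel_measurable_indicator) simp
    then show ?thesis using mE by (intro borel_measurable_times_ennreal)
  qed
  have "AE p in ?P. f (fst p) + snd p \<in> B"
    using range AE_space
  proof eventually_elim
    case (elim p)
    then have "f (fst p) + snd p \<in> carrier_vec m"
      using measurable_vec_carrier[OF mfX] by blast
    moreover have "(\<integral>\<^sup>+X. E (X, f (fst p) + snd p) \<partial>PX) \<le> ennreal K"
      using moment elim(1) by (auto simp: E_def case_prod_beta)
    ultimately show ?case by (simp add: B_def)
  qed
  then have "(\<integral>\<^sup>+p. ennreal (exp (W p)) \<partial>?P)
      = (\<integral>\<^sup>+p. ennreal (exp (W p)) * indicator B (f (fst p) + snd p) \<partial>?P)"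
    by (intro nn_integral_cong_AE) auto
  also have "\<dots> = (\<integral>\<^sup>+X. (\<integral>\<^sup>+Z. ennreal (exp (W (X, Z))) * indicator B (f X + Z) \<partial>?Z) \<partial>PX)"
  proof -
    have [measurable]: "(\<lambda>p. indicator B (f (fst p) + snd p) :: ennreal) \<in> borel_measurable ?P"
      using measurable_compose[OF mfX borel_measurable_indicator[OF B]] .
    have [measurable]: "W \<in> borel_measurable ?P" using Wi by simp
    have "(\<lambda>p. ennreal (exp (W p)) * indicator B (f (fst p) + snd p)) \<in> borel_measurable ?P"
      by measurable
    from Z.nn_integral_fst[OF this] show ?thesis by simp
  qed
  also have "\<dots> = (\<integral>\<^sup>+X. (\<integral>\<^sup>+Y. E (X, Y) * indicator B Y \<partial>?Y) \<partial>PX)"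
  proof (rule nn_integral_cong)
    fix X assume "X \<in> space PX"
    then have X: "X \<in> carrier_mat n1 n2" by (simp add: spX)
    have "ennreal (exp (W (X, Z))) = ennreal ((\<sigma>\<^sup>2 / \<tau>\<^sup>2) ^ m *
        exp ((norm2_vec Z)\<^sup>2 / \<sigma>\<^sup>2 - (norm2_vec (f X + Z))\<^sup>2 / \<tau>\<^sup>2)) * E (X, f X + Z)" for Z
    proof -
      have "exp (W (X, Z)) = exp (- L) * exp ((norm2_vec Z)\<^sup>2 / \<sigma>\<^sup>2 - (norm2_vec (f X + Z))\<^sup>2 / \<tau>\<^sup>2)
          * exp (- \<theta> * fro2 (g (f X + Z) - X))"
        unfolding W_def d_def u_def v_def exp_add[symmetric] by (simp add: algebra_simps)
      then show ?thesis unfolding expL by (simp add: E_def ennreal_mult')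
    qed
    then have "(\<integral>\<^sup>+Z. ennreal (exp (W (X, Z))) * indicator B (f X + Z) \<partial>?Z)
       = (\<integral>\<^sup>+Z. ennreal ((\<sigma>\<^sup>2 / \<tau>\<^sup>2) ^ m * exp ((norm2_vec Z)\<^sup>2 / \<sigma>\<^sup>2 - (norm2_vec (f X + Z))\<^sup>2 / \<tau>\<^sup>2))
          * (E (X, f X + Z) * indicator B (f X + Z)) \<partial>?Z)"
      by (simp add: mult.assoc)
    also have "\<dots> = (\<integral>\<^sup>+Y. E (X, Y) * indicator B Y \<partial>?Y)"
      by (rule nn_integral_complex_normal_vec_change[OF \<sigma> \<tau>(1) fX[OF X] mF[OF X]])
    finally show "(\<integral>\<^sup>+Z. ennreal (exp (W (X, Z))) * indicator B (f X + Z) \<partial>?Z)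
        = (\<integral>\<^sup>+Y. E (X, Y) * indicator B Y \<partial>?Y)" .
  qed
  also have "\<dots> = (\<integral>\<^sup>+Y. (\<integral>\<^sup>+X. E (X, Y) * indicator B Y \<partial>PX) \<partial>?Y)"
    using PXY.Fubini[OF mH] by simp
  also have "\<dots> \<le> (\<integral>\<^sup>+Y. ennreal K \<partial>?Y)"
    by (intro nn_integral_mono) (auto simp: B_def split: split_indicator)
  also have "\<dots> = ennreal K" using Y.emeasure_space_1 by simp
  finally have "exp (\<integral>p. W p \<partial>?P) \<le> K"
    by (rule P.exp_expectation_le[OF Wi])
  then have "exp (- \<theta> * \<delta> - L) \<le> K"
    using EW by (meson exp_le_cancel_iff order_trans)
  then show ?thesis
    using K by (simp add: L_def ln_ge_iff)
qed

section \<open>The law of the sparse low-rank matrix\<close>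

text \<open>\<open>B\<close> is replaced by an almost nearest Stiefel point \<open>V\<close>. Every
  Stiefel \<open>U\<close> is nearly as far from \<open>B\<close> as \<open>V\<close> is, so twice
  the two squared distances to \<open>B\<close> bound \<open>fro2 (U - V)\<close> by
  \<open>4 * fro2 (U - B)\<close> plus a small error. The cost is \<open>\<theta> / 4\<close> in
  place of \<open>\<theta>\<close> and a factor 2.\<close>

lemma stiefel_laplace_any_point:
  assumes \<mu>: "uniform_on_stiefel s r \<mu>" and r: "0 < r" "r \<le> s" and \<theta>: "\<theta> > 0" and B: "B \<in> carrier_mat s r"
  shows "(\<integral>\<^sup>+U. ennreal (exp (- \<theta> * fro2 (U - B))) \<partial>\<mu>)
    \<le> ennreal (4 * (48 * real s / \<theta>) powr (real s * real r - (real r)\<^sup>2 / 2))"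
proof -
  note \<mu>' = uniform_on_stiefelD[OF \<mu>]
  interpret \<mu>: prob_space \<mu> by (rule \<mu>'(1))
  note [measurable_cong] = \<mu>'(2)
  define q where "q = real s * real r - (real r)\<^sup>2 / 2"
  have q: "q \<ge> 0"
  proof -
    have "(real r)\<^sup>2 \<le> real s * real r" using r by (simp add: power2_eq_square mult_right_mono)
    then show ?thesis using zero_le_power2[of "real r"] unfolding q_def by linarith
  qed
  define I where "I = Inf ((\<lambda>U. fro2 (U - B)) ` stiefel s r)"
  have ne: "stiefel s r \<noteq> {}"
    using \<mu>'(3) \<mu>.AE_False by (auto intro: ccontr)
  have bdd: "bdd_below ((\<lambda>U. fro2 (U - B)) ` stiefel s r)" by (rule bdd_belowI[of _ 0]) auto
  \<comment> \<open>The slack \<open>1 / \<theta>\<close> in the infimum becomes 1/2 in the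
    exponent, and \<open>exp (1 / 2) \<le> 2\<close>.\<close>
  obtain V where V: "V \<in> stiefel s r" "fro2 (V - B) < I + 1 / \<theta>"
    using cInf_lessD[of "(\<lambda>U. fro2 (U - B)) ` stiefel s r" "I + 1 / \<theta>"] ne \<theta> unfolding I_def by auto
  have le: "exp (- \<theta> * fro2 (U - B)) \<le> 2 * exp (- (\<theta> / 4) * fro2 (U - V))" if U: "U \<in> stiefel s r" for U
  proof -
    note c = stiefelD(1)[OF U] stiefelD(1)[OF V(1)] B
    have "I \<le> fro2 (U - B)" unfolding I_def by (rule cInf_lower[OF _ bdd]) (use U in auto)
    then have "fro2 (B - V) \<le> fro2 (U - B) + 1 / \<theta>"
      using V(2) fro2_minus_commute[OF c(2,3)] by simp
    then have "fro2 (U - V) \<le> 4 * fro2 (U - B) + 2 / \<theta>"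
      using fro2_diff_le[OF c(1,3,2)] by simp
    then have "\<theta> / 4 * fro2 (U - V) \<le> \<theta> / 4 * (4 * fro2 (U - B) + 2 / \<theta>)"
      using \<theta> by (intro mult_left_mono) auto
    also have "\<dots> = \<theta> * fro2 (U - B) + 1 / 2" using \<theta> by (simp add: field_simps)
    finally have "exp (- \<theta> * fro2 (U - B)) \<le> exp (1 / 2 + - (\<theta> / 4) * fro2 (U - V))" by simp
    also have "\<dots> = exp (1 / 2) * exp (- (\<theta> / 4) * fro2 (U - V))" by (rule exp_add)
    also have "\<dots> \<le> 2 * exp (- (\<theta> / 4) * fro2 (U - V))"
    proof (rule mult_right_mono)
      have "exp (1 / 2 :: real) \<le> 1 + 1 / 2 + (1 / 2)\<^sup>2" by (rule exp_bound) auto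
      then show "exp (1 / 2 :: real) \<le> 2" by (simp add: power2_eq_square)
    qed simp
    finally show ?thesis .
  qed
  have le': "ennreal (exp (- \<theta> * fro2 (U - B))) \<le> ennreal 2 * ennreal (exp (- (\<theta> / 4) * fro2 (U - V)))"
    if "U \<in> stiefel s r" for U
    unfolding ennreal_mult'[OF zero_le_numeral, symmetric] by (rule ennreal_leI[OF le[OF that]])
  have [measurable]: "(\<lambda>U. fro2 (U - V)) \<in> borel_measurable \<mu>"
    using stiefelD(1)[OF V(1)] \<mu>'(2)
    by (intro measurable_fro2[of _ _ s r] measurable_mat_minus) (auto intro: measurable_ident_sets)
  have "(\<integral>\<^sup>+U. ennreal (exp (- \<theta> * fro2 (U - B))) \<partial>\<mu>)
      \<le> (\<integral>\<^sup>+U. ennreal 2 * ennreal (exp (- (\<theta> / 4) * fro2 (U - V))) \<partial>\<mu>)"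
    by (intro nn_integral_mono_AE eventually_mono[OF \<mu>'(3) le'])
  also have "\<dots> = ennreal 2 * (\<integral>\<^sup>+U. ennreal (exp (- (\<theta> / 4) * fro2 (U - V))) \<partial>\<mu>)"
    by (rule nn_integral_cmult) measurable
  also have "\<dots> \<le> ennreal 2 * ennreal (2 * (1 + 2 * (\<theta> / 4 / (24 * real s))) powr (- q))"
    unfolding q_def using \<theta> by (intro mult_left_mono stiefel_laplace_point[OF \<mu> r _ V(1)]) auto
  also have "\<dots> = ennreal (4 * (1 + 2 * (\<theta> / 4 / (24 * real s))) powr (- q))"
    by (subst ennreal_mult'[symmetric]) auto
  also have "\<dots> \<le> ennreal (4 * (48 * real s / \<theta>) powr q)"
  proof (intro ennreal_leI mult_left_mono)
    have s: "real s > 0" using r by simp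
    \<comment> \<open>The summand 1 is dropped under a nonpositive exponent; 48 = 4 * 24 /
      2.\<close>
    have "(1 + 2 * (\<theta> / 4 / (24 * real s))) powr (- q) \<le> (\<theta> / (48 * real s)) powr (- q)"
      using \<theta> s q by (intro powr_mono2') auto
    also have "\<dots> = (48 * real s / \<theta>) powr q"
      using \<theta> s by (simp add: powr_minus powr_divide field_simps)
    finally show "(1 + 2 * (\<theta> / 4 / (24 * real s))) powr (- q) \<le> (48 * real s / \<theta>) powr q" .
  qed simp
  finally show ?thesis by (simp add: q_def)
qed

lemma stiefel_laplace_subspace_powr:
  assumes \<mu>: "uniform_on_stiefel s r \<mu>" and r: "0 < r" "r \<le> s" and \<theta>: "\<theta> > 0" and Q: "Q \<in> stiefel s r"
  shows "(\<integral>\<^sup>+U. ennreal (exp (- \<theta> * (real r - fro2 (mat_adjoint Q * U)))) \<partial>\<mu>)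
    \<le> ennreal (2 * (12 * real s / \<theta>) powr (real s * real r - (real r)\<^sup>2))"
proof -
  define q where "q = real s * real r - (real r)\<^sup>2"
  have q: "q \<ge> 0" using r by (simp add: q_def power2_eq_square mult_right_mono)
  have s: "real s > 0" using r by simp
  have "(1 + 2 * (\<theta> / (24 * real s))) powr (- q) \<le> (\<theta> / (12 * real s)) powr (- q)"
    using \<theta> s q by (intro powr_mono2') auto
  also have "\<dots> = (12 * real s / \<theta>) powr q"
    using \<theta> s by (simp add: powr_minus powr_divide field_simps)
  finally have "ennreal (2 * (1 + 2 * (\<theta> / (24 * real s))) powr (- q)) \<le> ennreal (2 * (12 * real s / \<theta>) powr q)"
    by (intro ennreal_leI mult_left_mono) auto
  then show ?thesis
    using stiefel_laplace_subspace[OF \<mu> r _ Q, of \<theta>] \<theta> unfolding q_def by (meson less_imp_le order_trans)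
qed

section \<open>Conditioning on the row support\<close>

lemma measurable_place_rows:
  assumes sets: "sets \<mu> = sets (borel_mat s r)"
  shows "(\<lambda>(S, W). place_rows n S W) \<in>
    uniform_count_measure {S. S \<subseteq> {..<n} \<and> card S = s} \<Otimes>\<^sub>M \<mu> \<rightarrow>\<^sub>M borel_mat n r"
proof -
  let ?A = "{S. S \<subseteq> {..<n} \<and> card S = s}"
  have fin: "finite ?A" by (rule finite_subset[of _ "Pow {..<n}"]) auto
  have "(\<lambda>(S, W). place_rows n S W) \<in> count_space ?A \<Otimes>\<^sub>M borel_mat s r \<rightarrow>\<^sub>M borel_mat n r"
  proof (rule measurable_pair_measure_countable1)
    show "countable ?A" using fin by (rule countable_finite)
    fix S assume S: "S \<in> ?A"
    then have finS: "finite S" using finite_subset by blast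
    have "place_rows n S \<in> borel_mat s r \<rightarrow>\<^sub>M borel_mat n r"
    proof (rule measurable_borel_matI)
      show "place_rows n S W \<in> carrier_mat n r" if "W \<in> space (borel_mat s r)" for W
        using place_rows_carrier that by auto
      fix i j assume ij: "i < n" "j < r"
      show "(\<lambda>W. place_rows n S W $$ (i, j)) \<in> borel_measurable (borel_mat s r)"
      proof (cases "i \<in> S")
        case True
        then have "{k \<in> S. k < i} \<subset> S" by auto
        then have "card {k \<in> S. k < i} < s" using S finS by (auto dest: psubset_card_mono)
        then have "(\<lambda>W. W $$ (card {k \<in> S. k < i}, j)) \<in> borel_measurable (borel_mat s r)"
          using ij by (intro measurable_mat_index[of "\<lambda>W. W"]) auto
        also have "?this \<longleftrightarrow> ?thesis"
          using ij True by (intro measurable_cong) (auto simp: place_rows_def)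
        finally show ?thesis .
      next
        case False
        have "(\<lambda>W. 0 :: complex) \<in> borel_measurable (borel_mat s r)" by simp
        also have "?this \<longleftrightarrow> ?thesis"
          using ij False by (intro measurable_cong) (auto simp: place_rows_def)
        finally show ?thesis .
      qed
    qed
    then show "(\<lambda>W. case (S, W) of (S, W) \<Rightarrow> place_rows n S W) \<in> borel_mat s r \<rightarrow>\<^sub>M borel_mat n r"
      by simp
  qed
  moreover have "sets (uniform_count_measure ?A \<Otimes>\<^sub>M \<mu>) = sets (count_space ?A \<Otimes>\<^sub>M borel_mat s r)"
    by (intro sets_pair_measure_cong sets) (simp add: sets_uniform_count_measure)
  ultimately show ?thesis by (simp cong: measurable_cong_sets)
qed

lemma prob_space_supports:
  assumes "s \<le> n"
  shows "prob_space (uniform_count_measure {S. S \<subseteq> {..<n} \<and> card S = s})"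
proof (rule prob_space_uniform_count_measure)
  show "finite {S. S \<subseteq> {..<n} \<and> card S = s}" by (rule finite_subset[of _ "Pow {..<n}"]) auto
  have "{..<s} \<in> {S. S \<subseteq> {..<n} \<and> card S = s}" using assms by auto
  then show "{S. S \<subseteq> {..<n} \<and> card S = s} \<noteq> {}" by blast
qed

lemma sets_row_sparse_law [simp, measurable_cong]: "sets (row_sparse_law n s r \<mu>) = sets (borel_mat n r)"
  by (simp add: row_sparse_law_def)

lemma prob_space_row_sparse_law:
  assumes "prob_space \<mu>" "sets \<mu> = sets (borel_mat s r)" "s \<le> n"
  shows "prob_space (row_sparse_law n s r \<mu>)"
proof -
  interpret \<mu>: prob_space \<mu> by fact
  interpret A: prob_space "uniform_count_measure {S. S \<subseteq> {..<n} \<and> card S = s}"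
    by (rule prob_space_supports[OF assms(3)])
  interpret P: pair_prob_space "uniform_count_measure {S. S \<subseteq> {..<n} \<and> card S = s}" \<mu> ..
  show ?thesis
    unfolding row_sparse_law_def by (rule P.prob_space_distr[OF measurable_place_rows[OF assms(2)]])
qed

text \<open>A bound valid for each support passes to the average over supports, so from here on the
  supports may be treated as fixed.\<close>

lemma nn_integral_row_sparse_law_le:
  assumes \<mu>: "prob_space \<mu>" "sets \<mu> = sets (borel_mat s r)" and "s \<le> n"
    and F: "F \<in> borel_measurable (borel_mat n r)"
    and le: "\<And>S. S \<subseteq> {..<n} \<Longrightarrow> card S = s \<Longrightarrow> (\<integral>\<^sup>+W. F (place_rows n S W) \<partial>\<mu>) \<le> K"
  shows "(\<integral>\<^sup>+U. F U \<partial>row_sparse_law n s r \<mu>) \<le> K"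
proof -
  let ?A = "uniform_count_measure {S. S \<subseteq> {..<n} \<and> card S = s}"
  interpret \<mu>: prob_space \<mu> by fact
  interpret A: prob_space ?A by (rule prob_space_supports[OF assms(3)])
  note m = measurable_place_rows[OF \<mu>(2), of n]
  have "(\<integral>\<^sup>+U. F U \<partial>row_sparse_law n s r \<mu>) = (\<integral>\<^sup>+p. F (case p of (S, W) \<Rightarrow> place_rows n S W) \<partial>(?A \<Otimes>\<^sub>M \<mu>))"
    unfolding row_sparse_law_def by (rule nn_integral_distr[OF m]) (use F in simp)
  also have "\<dots> = (\<integral>\<^sup>+S. (\<integral>\<^sup>+W. F (place_rows n S W) \<partial>\<mu>) \<partial>?A)"
    using \<mu>.nn_integral_fst[OF measurable_compose[OF m F]] by simp
  also have "\<dots> \<le> (\<integral>\<^sup>+S. K \<partial>?A)"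
    using le by (intro nn_integral_mono) (auto simp: space_uniform_count_measure)
  also have "\<dots> = K" by (simp add: A.emeasure_space_1)
  finally show ?thesis .
qed

lemma sum_pick_le:
  fixes h :: "nat \<Rightarrow> real"
  assumes S: "S \<subseteq> {..<n}" and h: "\<And>i. h i \<ge> 0"
  shows "(\<Sum>i<card S. h (pick S i)) \<le> (\<Sum>i<n. h i)"
proof -
  have inj: "inj_on (pick S) {..<card S}"
  proof (rule inj_onI)
    fix i j assume ij: "i \<in> {..<card S}" "j \<in> {..<card S}" "pick S i = pick S j"
    have "card {a \<in> S. a < pick S i} = i" by (rule card_pick_le) (use ij(1) in simp)
    moreover have "card {a \<in> S. a < pick S j} = j" by (rule card_pick_le) (use ij(2) in simp)
    ultimately show "i = j" using ij(3) by metis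
  qed
  have "pick S ` {..<card S} \<subseteq> {..<n}"
    using S pick_in_set_le[of _ S] by auto
  then have "sum h (pick S ` {..<card S}) \<le> (\<Sum>i<n. h i)"
    by (intro sum_mono2) (auto simp: h)
  then show ?thesis by (simp add: sum.reindex[OF inj])
qed

definition select_rows :: "nat set \<Rightarrow> complex mat \<Rightarrow> complex mat" where
  "select_rows S U = mat (card S) (dim_col U) (\<lambda>(i, j). U $$ (pick S i, j))"

lemma select_rows_carrier: "U \<in> carrier_mat n r \<Longrightarrow> select_rows S U \<in> carrier_mat (card S) r"
  by (auto simp: select_rows_def)

text \<open>Entries outside \<open>S\<close> times \<open>T\<close> are discarded, which can only
  lower the norm; inside, row placement and selection undo each other. This reduces an unconstrained
  reconstruction to the size of the sparse blocks.\<close>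

lemma fro2_place_rows_ge:
  assumes S: "S \<subseteq> {..<n1}" "T \<subseteq> {..<n2}"
    and W: "W1 \<in> carrier_mat (card S) r" "W2 \<in> carrier_mat (card T) r"
    and U: "U \<in> carrier_mat n1 r" "V \<in> carrier_mat n2 r"
  shows "fro2 (W1 * mat_adjoint W2 - select_rows S U * mat_adjoint (select_rows T V))
    \<le> fro2 (U * mat_adjoint V - place_rows n1 S W1 * mat_adjoint (place_rows n2 T W2))"
proof -
  define M where "M = U * mat_adjoint V - place_rows n1 S W1 * mat_adjoint (place_rows n2 T W2)"
  define N where "N = W1 * mat_adjoint W2 - select_rows S U * mat_adjoint (select_rows T V)"
  note P = place_rows_carrier[OF W(1), of n1 S] place_rows_carrier[OF W(2), of n2 T]
  note R = select_rows_carrier[OF U(1), of S] select_rows_carrier[OF U(2), of T]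
  have fin: "finite S" "finite T" using S finite_subset by blast+
  have eq: "cmod (N $$ (i, j)) = cmod (M $$ (pick S i, pick T j))" if ij: "i < card S" "j < card T" for i j
  proof -
    have p: "pick S i < n1" "pick T j < n2" "pick S i \<in> S" "pick T j \<in> T"
      using pick_in_set_le[OF ij(1)] pick_in_set_le[OF ij(2)] S by auto
    have c: "card {k \<in> S. k < pick S i} = i" "card {k \<in> T. k < pick T j} = j"
      using ij fin by (auto intro!: card_pick)
    have "(place_rows n1 S W1 * mat_adjoint (place_rows n2 T W2)) $$ (pick S i, pick T j)
        = (\<Sum>a<r. place_rows n1 S W1 $$ (pick S i, a) * cnj (place_rows n2 T W2 $$ (pick T j, a)))"
      using P p by (simp add: index_mult_mat_sum carrier_matD[OF P(1)] carrier_matD[OF P(2)] del: index_mult_mat(1))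
    also have "\<dots> = (\<Sum>a<r. W1 $$ (i, a) * cnj (W2 $$ (j, a)))"
      using W p c by (intro sum.cong) (auto simp: place_rows_def)
    also have "\<dots> = (W1 * mat_adjoint W2) $$ (i, j)"
      using W ij by (simp add: index_mult_mat_sum del: index_mult_mat(1))
    finally have 1: "(place_rows n1 S W1 * mat_adjoint (place_rows n2 T W2)) $$ (pick S i, pick T j)
      = (W1 * mat_adjoint W2) $$ (i, j)" .
    have "(U * mat_adjoint V) $$ (pick S i, pick T j) = (\<Sum>a<r. U $$ (pick S i, a) * cnj (V $$ (pick T j, a)))"
      using U p by (simp add: index_mult_mat_sum del: index_mult_mat(1))
    also have "\<dots> = (select_rows S U * mat_adjoint (select_rows T V)) $$ (i, j)"
      using U ij R by (simp add: index_mult_mat_sum carrier_matD[OF R(1)] carrier_matD[OF R(2)] del: index_mult_mat(1))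
        (simp add: select_rows_def)
    finally have 2: "(U * mat_adjoint V) $$ (pick S i, pick T j) = (select_rows S U * mat_adjoint (select_rows T V)) $$ (i, j)" .
    have "M $$ (pick S i, pick T j) = - N $$ (i, j)"
      unfolding M_def N_def using p ij P R
      by (simp add: 1[symmetric] 2[symmetric] del: index_mult_mat(1))
    then show ?thesis by simp
  qed
  have dM: "dim_row M = n1" "dim_col M = n2" and dN: "dim_row N = card S" "dim_col N = card T"
    using U P R by (auto simp: M_def N_def)
  have "fro2 N = (\<Sum>i<card S. \<Sum>j<card T. (cmod (M $$ (pick S i, pick T j)))\<^sup>2)"
    unfolding fro2_def dN by (intro sum.cong refl) (simp add: eq)
  also have "\<dots> \<le> (\<Sum>i<card S. \<Sum>j<n2. (cmod (M $$ (pick S i, j)))\<^sup>2)"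
    by (intro sum_mono sum_pick_le[OF S(2), of "\<lambda>j. (cmod (M $$ (pick S _, j)))\<^sup>2"]) auto
  also have "\<dots> \<le> (\<Sum>i<n1. \<Sum>j<n2. (cmod (M $$ (i, j)))\<^sup>2)"
    by (intro sum_pick_le[OF S(1), of "\<lambda>i. \<Sum>j<n2. (cmod (M $$ (i, j)))\<^sup>2"] sum_nonneg) auto
  also have "\<dots> = fro2 M" by (simp add: fro2_def dM)
  finally show ?thesis by (simp add: M_def N_def)
qed

text \<open>
  The two terms measure the displacement of \<open>V\<close> for a given \<open>U\<close> and that of the range of \<open>U\<close>;
  their dimensions add up to that of the set of all \<open>U V\<^sup>*\<close>.
\<close>

lemma fro2_product_split:
  assumes U: "U \<in> stiefel s1 r" and V: "V \<in> stiefel s2 r" and Q: "Q \<in> stiefel s1 r"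
    and T: "T \<in> carrier_mat r r" and B: "B \<in> carrier_mat s2 r"
  shows "fro2 (V - mat_adjoint (mat_adjoint U * (Q * T * mat_adjoint B))) / 2 + (real r - fro2 (mat_adjoint Q * U)) / 2
    \<le> fro2 (U * mat_adjoint V - Q * T * mat_adjoint B)"
proof -
  note c = stiefelD(1)[OF U] stiefelD(1)[OF V] stiefelD(1)[OF Q] T B
  define A where "A = Q * T * mat_adjoint B"
  define M where "M = U * mat_adjoint V - A"
  have A: "A \<in> carrier_mat s1 s2" using c by (auto simp: A_def)
  have M: "M \<in> carrier_mat s1 s2" using A by (auto simp: M_def)
  \<comment> \<open>Applying the adjoint of \<open>U\<close> is a contraction and isolates
    \<open>V\<close> from \<open>U * mat_adjoint V\<close>.\<close>
  have 1: "fro2 (V - mat_adjoint (mat_adjoint U * A)) \<le> fro2 M"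
  proof -
    have UA: "mat_adjoint U * A \<in> carrier_mat r s2" using c A by auto
    have "mat_adjoint U * M = mat_adjoint U * (U * mat_adjoint V) - mat_adjoint U * A"
      unfolding M_def using c A by (intro mult_minus_distrib_mat[where nr=r and n=s1 and nc=s2]) auto
    also have "mat_adjoint U * (U * mat_adjoint V) = mat_adjoint U * U * mat_adjoint V"
      using c by (intro assoc_mult_mat[symmetric, where n\<^sub>1=r and n\<^sub>2=s1 and n\<^sub>3=r and n\<^sub>4=s2]) auto
    also have "\<dots> = mat_adjoint V" using stiefelD(2)[OF U] c by simp
    also have "mat_adjoint V - mat_adjoint U * A = mat_adjoint (V - mat_adjoint (mat_adjoint U * A))"
      using c UA by (simp add: mat_adjoint_minus[of _ s2 r])
    finally have "fro2 (V - mat_adjoint (mat_adjoint U * A)) = fro2 (mat_adjoint U * M)" by simp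
    also have "\<dots> \<le> fro2 M" by (rule fro2_adjoint_stiefel_mult_le[OF U M])
    finally show ?thesis .
  qed
  \<comment> \<open>The range of \<open>A\<close> lies in that of \<open>Q\<close>, so projecting
    \<open>M\<close> off the range of \<open>Q\<close> removes \<open>A\<close> and leaves the
    residual \<open>N\<close> of \<open>U\<close>, times the adjoint of \<open>V\<close>.\<close>
  have 2: "real r - fro2 (mat_adjoint Q * U) \<le> fro2 M"
  proof -
    have QA: "Q * (mat_adjoint Q * A) = A"
    proof -
      have TB: "T * mat_adjoint B \<in> carrier_mat r s2" using c by auto
      have A': "A = Q * (T * mat_adjoint B)"
        unfolding A_def using c by (intro assoc_mult_mat[where n\<^sub>1=s1 and n\<^sub>2=r and n\<^sub>3=r and n\<^sub>4=s2]) auto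
      have "mat_adjoint Q * A = mat_adjoint Q * Q * (T * mat_adjoint B)"
        unfolding A' using c by (intro assoc_mult_mat[symmetric, where n\<^sub>1=r and n\<^sub>2=s1 and n\<^sub>3=r and n\<^sub>4=s2]) auto
      also have "\<dots> = T * mat_adjoint B"
        unfolding stiefelD(2)[OF Q] by (rule left_mult_one_mat[OF TB])
      finally show ?thesis using A' by simp
    qed
    define N where "N = U - Q * (mat_adjoint Q * U)"
    have N: "N \<in> carrier_mat s1 r" using c by (auto simp: N_def)
    have "mat_adjoint Q * M = mat_adjoint Q * (U * mat_adjoint V) - mat_adjoint Q * A"
      unfolding M_def using c A by (intro mult_minus_distrib_mat[where nr=r and n=s1 and nc=s2]) auto
    also have "Q * \<dots> = Q * (mat_adjoint Q * (U * mat_adjoint V)) - Q * (mat_adjoint Q * A)"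
      using c A by (intro mult_minus_distrib_mat[where nr=s1 and n=r and nc=s2]) auto
    also have "mat_adjoint Q * (U * mat_adjoint V) = mat_adjoint Q * U * mat_adjoint V"
      using c by (intro assoc_mult_mat[symmetric, where n\<^sub>1=r and n\<^sub>2=s1 and n\<^sub>3=r and n\<^sub>4=s2]) auto
    also have "Q * (mat_adjoint Q * U * mat_adjoint V) = Q * (mat_adjoint Q * U) * mat_adjoint V"
      using c by (intro assoc_mult_mat[symmetric, where n\<^sub>1=s1 and n\<^sub>2=r and n\<^sub>3=r and n\<^sub>4=s2]) auto
    finally have QM: "Q * (mat_adjoint Q * M) = Q * (mat_adjoint Q * U) * mat_adjoint V - A"
      by (simp only: QA)
    have "N * mat_adjoint V = U * mat_adjoint V - Q * (mat_adjoint Q * U) * mat_adjoint V"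
      unfolding N_def using c by (intro minus_mult_distrib_mat[where nr=s1 and n=r and nc=s2]) auto
    also have "\<dots> = M - Q * (mat_adjoint Q * M)"
    proof -
      have gen: "X - Y = X - A - (Y - A)" if "X \<in> carrier_mat s1 s2" "Y \<in> carrier_mat s1 s2" for X Y :: "complex mat"
        using that A by (intro eq_matI) auto
      show ?thesis unfolding QM unfolding M_def by (rule gen) (use c in auto)
    qed
    finally have NV: "N * mat_adjoint V = M - Q * (mat_adjoint Q * M)" .
    have "real r - fro2 (mat_adjoint Q * U) = fro2 N"
      unfolding N_def using fro2_stiefel_complement[OF Q c(1)] fro2_stiefel[OF U] by simp
    also have "\<dots> = fro2 (N * mat_adjoint V)"
      by (rule fro2_mult_stiefel_adjoint[OF V N, symmetric])
    also have "\<dots> = fro2 M - fro2 (mat_adjoint Q * M)"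
      unfolding NV by (rule fro2_stiefel_complement[OF Q M])
    finally show ?thesis using fro2_nonneg[of "mat_adjoint Q * M"] by simp
  qed
  \<comment> \<open>Each term alone is bounded by the whole, so half of each is bounded by it too;
    this later halves \<open>\<theta>\<close>.\<close>
  have arith: "x / 2 + y / 2 \<le> z" if "x \<le> z" "y \<le> z" for x y z :: real
    using that by simp
  show ?thesis using arith[OF 1 2] unfolding M_def A_def .
qed

section \<open>Laplace transform of the product of the two factors\<close>

lemma measurable_product_law:
  assumes P: "sets P = sets (borel_mat n1 r)" and Q: "sets Q = sets (borel_mat n2 r)"
  shows "(\<lambda>(U, V). U * mat_adjoint V) \<in> P \<Otimes>\<^sub>M Q \<rightarrow>\<^sub>M borel_mat n1 n2"
proof -
  note [measurable_cong] = P Q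
  have 1: "fst \<in> P \<Otimes>\<^sub>M Q \<rightarrow>\<^sub>M borel_mat n1 r" and 2: "snd \<in> P \<Otimes>\<^sub>M Q \<rightarrow>\<^sub>M borel_mat n2 r" by measurable
  show ?thesis
    unfolding case_prod_beta by (intro measurable_mat_mult[of _ _ n1 r] measurable_mat_adjoint 1 2)
qed

text \<open>\<open>V\<close> is integrated first: for given \<open>U\<close> its reference point
  depends on \<open>U\<close>, but \<open>stiefel_laplace_any_point\<close> is uniform in that
  point. What remains depends on \<open>U\<close> only through the angle between its range and that
  of \<open>Q\<close>, and \<open>stiefel_laplace_subspace_powr\<close> applies. The factors are 8 =
  4 * 2 and, as \<open>\<theta>\<close> is halved, 96 = 2 * 48.\<close>

lemma product_law_laplace_bound:
  assumes \<mu>1: "uniform_on_stiefel s1 r \<mu>1" and \<mu>2: "uniform_on_stiefel s2 r \<mu>2"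
    and r: "0 < r" "r \<le> s1" "r \<le> s2" and s: "s1 \<le> n1" "s2 \<le> n2" and \<theta>: "\<theta> > 0"
    and U0: "U0 \<in> stiefel n1 r" and V0: "V0 \<in> stiefel n2 r"
  shows "(\<integral>\<^sup>+X. ennreal (exp (- \<theta> * fro2 (U0 * mat_adjoint V0 - X)))
      \<partial>product_law n1 n2 (row_sparse_law n1 s1 r \<mu>1) (row_sparse_law n2 s2 r \<mu>2))
    \<le> ennreal (8 * (96 * (real s1 + real s2) / \<theta>) powr ((real s1 + real s2) * real r - 3 * (real r)\<^sup>2 / 2))"
proof -
  let ?P = "row_sparse_law n1 s1 r \<mu>1" and ?Q = "row_sparse_law n2 s2 r \<mu>2"
  note m1 = uniform_on_stiefelD[OF \<mu>1] and m2 = uniform_on_stiefelD[OF \<mu>2]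
  note U0c = stiefelD(1)[OF U0] and V0c = stiefelD(1)[OF V0]
  interpret P: prob_space ?P by (rule prob_space_row_sparse_law[OF m1(1,2) s(1)])
  interpret Q: prob_space ?Q by (rule prob_space_row_sparse_law[OF m2(1,2) s(2)])
  define F where "F X = ennreal (exp (- \<theta> * fro2 (U0 * mat_adjoint V0 - X)))" for X
  have F: "F \<in> borel_measurable (borel_mat n1 n2)"
  proof -
    have [measurable]: "(\<lambda>X. fro2 (U0 * mat_adjoint V0 - X)) \<in> borel_measurable (borel_mat n1 n2)"
      using U0c V0c by (intro measurable_fro2[of _ _ n1 n2] measurable_mat_minus) auto
    show ?thesis unfolding F_def by measurable
  qed
  define q1 where "q1 = real s1 * real r - (real r)\<^sup>2"
  define q2 where "q2 = real s2 * real r - (real r)\<^sup>2 / 2"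
  \<comment> \<open>A common base for both powers, above \<open>96 * s2 / \<theta>\<close> and
    \<open>24 * s1 / \<theta>\<close>, so that the exponents simply add.\<close>
  define c where "c = 96 * (real s1 + real s2) / \<theta>"
  have q: "q1 \<ge> 0" "q2 \<ge> 0"
  proof -
    have "(real r)\<^sup>2 \<le> real s1 * real r" "(real r)\<^sup>2 \<le> real s2 * real r"
      using r by (simp_all add: power2_eq_square mult_right_mono)
    then show "q1 \<ge> 0" "q2 \<ge> 0" using zero_le_power2[of "real r"] unfolding q1_def q2_def by linarith+
  qed
  have c2: "48 * real s2 / (\<theta> / 2) \<le> c" and c1: "12 * real s1 / (\<theta> / 2) \<le> c"
  proof -
    have "96 * real s2 / \<theta> \<le> c" "24 * real s1 / \<theta> \<le> c"
      unfolding c_def using \<theta> by (intro divide_right_mono; simp)+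
    then show "48 * real s2 / (\<theta> / 2) \<le> c" "12 * real s1 / (\<theta> / 2) \<le> c" by simp_all
  qed
  have inner: "(\<integral>\<^sup>+V. F (place_rows n1 S W1 * mat_adjoint V) \<partial>?Q)
      \<le> ennreal (4 * c powr q2) * ennreal (exp (- (\<theta> / 2) * (real r - fro2 (mat_adjoint Q * W1))))"
    if S: "S \<subseteq> {..<n1}" "card S = s1" and W1: "W1 \<in> stiefel s1 r"
      and Q: "Q \<in> stiefel s1 r" and T: "T \<in> carrier_mat r r" and QT: "select_rows S U0 = Q * T" for S W1 Q T
  proof (rule nn_integral_row_sparse_law_le[OF m2(1,2) s(2)])
    show "(\<lambda>V. F (place_rows n1 S W1 * mat_adjoint V)) \<in> borel_measurable (borel_mat n2 r)"
      using place_rows_carrier[OF stiefelD(1)[OF W1], of n1 S]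
      by (intro measurable_compose[OF _ F] measurable_mat_mult[of _ _ n1 r] measurable_mat_adjoint) auto
    fix S2 assume S2: "S2 \<subseteq> {..<n2}" "card S2 = s2"
    define B where "B = select_rows S2 V0"
    have B: "B \<in> carrier_mat s2 r" using select_rows_carrier[OF V0c, of S2] S2 by (simp add: B_def)
    \<comment> \<open>The reference point for \<open>W2\<close> given \<open>W1\<close>. In general
      it lies off the Stiefel manifold.\<close>
    define B' where "B' = mat_adjoint (mat_adjoint W1 * (Q * T * mat_adjoint B))"
    have B': "B' \<in> carrier_mat s2 r"
      using stiefelD(1)[OF W1] stiefelD(1)[OF Q] T B by (auto simp: B'_def)
    define e where "e = exp (- (\<theta> / 2) * (real r - fro2 (mat_adjoint Q * W1)))"
    have le: "F (place_rows n1 S W1 * mat_adjoint (place_rows n2 S2 W2))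
        \<le> ennreal e * ennreal (exp (- (\<theta> / 2) * fro2 (W2 - B')))" if W2: "W2 \<in> stiefel s2 r" for W2
    proof -
      have "fro2 (W2 - B') / 2 + (real r - fro2 (mat_adjoint Q * W1)) / 2
          \<le> fro2 (W1 * mat_adjoint W2 - Q * T * mat_adjoint B)"
        unfolding B'_def by (rule fro2_product_split[OF W1 W2 Q T B])
      also have "\<dots> \<le> fro2 (U0 * mat_adjoint V0 - place_rows n1 S W1 * mat_adjoint (place_rows n2 S2 W2))"
        unfolding QT[symmetric] B_def
        using fro2_place_rows_ge[OF S(1) S2(1) _ _ U0c V0c] S S2 stiefelD(1)[OF W1] stiefelD(1)[OF W2] by auto
      finally have "\<theta> * (fro2 (W2 - B') / 2 + (real r - fro2 (mat_adjoint Q * W1)) / 2)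
          \<le> \<theta> * fro2 (U0 * mat_adjoint V0 - place_rows n1 S W1 * mat_adjoint (place_rows n2 S2 W2))"
        using \<theta> by (intro mult_left_mono) auto
      moreover have "\<theta> * (fro2 (W2 - B') / 2 + (real r - fro2 (mat_adjoint Q * W1)) / 2)
          = \<theta> / 2 * (real r - fro2 (mat_adjoint Q * W1)) + \<theta> / 2 * fro2 (W2 - B')"
        by (simp add: field_simps)
      ultimately have "exp (- \<theta> * fro2 (U0 * mat_adjoint V0 - place_rows n1 S W1 * mat_adjoint (place_rows n2 S2 W2)))
          \<le> exp (- (\<theta> / 2) * (real r - fro2 (mat_adjoint Q * W1)) + - (\<theta> / 2) * fro2 (W2 - B'))"
        unfolding exp_le_cancel_iff by linarith
      then have "ennreal (exp (- \<theta> * fro2 (U0 * mat_adjoint V0 - place_rows n1 S W1 * mat_adjoint (place_rows n2 S2 W2))))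
          \<le> ennreal (e * exp (- (\<theta> / 2) * fro2 (W2 - B')))"
        unfolding e_def exp_add[symmetric] by (rule ennreal_leI)
      also have "\<dots> = ennreal e * ennreal (exp (- (\<theta> / 2) * fro2 (W2 - B')))"
        by (rule ennreal_mult') (simp add: e_def)
      finally show ?thesis unfolding F_def .
    qed
    have [measurable]: "(\<lambda>U. fro2 (U - B')) \<in> borel_measurable \<mu>2"
      using B' m2(2) by (intro measurable_fro2[of _ _ s2 r] measurable_mat_minus) (auto intro: measurable_ident_sets)
    have "(\<integral>\<^sup>+W2. F (place_rows n1 S W1 * mat_adjoint (place_rows n2 S2 W2)) \<partial>\<mu>2)
        \<le> (\<integral>\<^sup>+W2. ennreal e * ennreal (exp (- (\<theta> / 2) * fro2 (W2 - B'))) \<partial>\<mu>2)"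
      using m2(3) le by (intro nn_integral_mono_AE) auto
    also have "\<dots> = ennreal e * (\<integral>\<^sup>+W2. ennreal (exp (- (\<theta> / 2) * fro2 (W2 - B'))) \<partial>\<mu>2)"
      by (rule nn_integral_cmult) measurable
    also have "\<dots> \<le> ennreal e * ennreal (4 * (48 * real s2 / (\<theta> / 2)) powr q2)"
      unfolding q2_def using \<theta> by (intro mult_left_mono stiefel_laplace_any_point[OF \<mu>2 r(1,3) _ B']) auto
    also have "\<dots> \<le> ennreal e * ennreal (4 * c powr q2)"
      by (intro mult_left_mono ennreal_leI powr_mono2 q(2) c2) (use \<theta> in auto)
    finally show "(\<integral>\<^sup>+W2. F (place_rows n1 S W1 * mat_adjoint (place_rows n2 S2 W2)) \<partial>\<mu>2)
        \<le> ennreal (4 * c powr q2) * ennreal (exp (- (\<theta> / 2) * (real r - fro2 (mat_adjoint Q * W1))))"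
      by (simp add: e_def mult.commute)
  qed
  have mUV: "(\<lambda>(U, V). U * mat_adjoint V) \<in> ?P \<Otimes>\<^sub>M ?Q \<rightarrow>\<^sub>M borel_mat n1 n2"
    by (rule measurable_product_law) auto
  have mUV': "(\<lambda>(U, V). F (U * mat_adjoint V)) \<in> borel_measurable (?P \<Otimes>\<^sub>M ?Q)"
    using measurable_compose[OF mUV F] by (simp add: case_prod_beta)
  have "(\<integral>\<^sup>+X. F X \<partial>product_law n1 n2 ?P ?Q) = (\<integral>\<^sup>+p. F (case p of (U, V) \<Rightarrow> U * mat_adjoint V) \<partial>(?P \<Otimes>\<^sub>M ?Q))"
    unfolding product_law_def by (rule nn_integral_distr[OF mUV]) (use F in simp)
  also have "\<dots> = (\<integral>\<^sup>+(U, V). F (U * mat_adjoint V) \<partial>(?P \<Otimes>\<^sub>M ?Q))"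
    by (simp add: case_prod_unfold)
  also have "\<dots> = (\<integral>\<^sup>+U. (\<integral>\<^sup>+V. F (U * mat_adjoint V) \<partial>?Q) \<partial>?P)"
    using Q.nn_integral_fst[OF mUV'] by simp
  also have "\<dots> \<le> ennreal (8 * c powr (q1 + q2))"
  proof (rule nn_integral_row_sparse_law_le[OF m1(1,2) s(1)])
    have "(\<lambda>U. \<integral>\<^sup>+V. F (U * mat_adjoint V) \<partial>?Q) \<in> borel_measurable ?P"
      by (rule Q.borel_measurable_nn_integral) (rule mUV')
    then show "(\<lambda>U. \<integral>\<^sup>+V. F (U * mat_adjoint V) \<partial>?Q) \<in> borel_measurable (borel_mat n1 r)"
      by (simp cong: measurable_cong_sets)
    fix S assume S: "S \<subseteq> {..<n1}" "card S = s1"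
    \<comment> \<open>The selected rows of \<open>U0\<close> need not have orthonormal columns.
      \<open>Q\<close> supplies an orthonormal frame whose range contains theirs, and
      \<open>T\<close> moves into the reference point for \<open>V\<close>. Neither depends on the
      support of \<open>V\<close>.\<close>
    obtain Q T where Q: "Q \<in> stiefel s1 r" and T: "T \<in> carrier_mat r r" and QT: "select_rows S U0 = Q * T"
      using QR_decomposition[OF _ r(2), of "select_rows S U0"] select_rows_carrier[OF U0c, of S] S by auto
    have [measurable]: "(\<lambda>W. fro2 (mat_adjoint Q * W)) \<in> borel_measurable \<mu>1"
      using stiefelD(1)[OF Q] m1(2)
      by (intro measurable_fro2[of _ _ r r] measurable_mat_mult[of _ _ r s1]) (auto intro: measurable_ident_sets)
    have "(\<integral>\<^sup>+W. (\<integral>\<^sup>+V. F (place_rows n1 S W * mat_adjoint V) \<partial>?Q) \<partial>\<mu>1)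
       \<le> (\<integral>\<^sup>+W. ennreal (4 * c powr q2) * ennreal (exp (- (\<theta> / 2) * (real r - fro2 (mat_adjoint Q * W)))) \<partial>\<mu>1)"
      using m1(3) inner[OF S _ Q T QT] by (intro nn_integral_mono_AE) auto
    also have "\<dots> = ennreal (4 * c powr q2) * (\<integral>\<^sup>+W. ennreal (exp (- (\<theta> / 2) * (real r - fro2 (mat_adjoint Q * W)))) \<partial>\<mu>1)"
      by (rule nn_integral_cmult) measurable
    also have "\<dots> \<le> ennreal (4 * c powr q2) * ennreal (2 * (12 * real s1 / (\<theta> / 2)) powr q1)"
      unfolding q1_def using \<theta> by (intro mult_left_mono stiefel_laplace_subspace_powr[OF \<mu>1 r(1,2) _ Q]) auto
    also have "\<dots> \<le> ennreal (4 * c powr q2) * ennreal (2 * c powr q1)"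
      by (intro mult_left_mono ennreal_leI powr_mono2 q(1) c1) (use \<theta> in auto)
    also have "\<dots> = ennreal (8 * c powr (q1 + q2))"
      by (subst ennreal_mult'[symmetric]) (auto simp: powr_add mult_ac)
    finally show "(\<integral>\<^sup>+W. (\<integral>\<^sup>+V. F (place_rows n1 S W * mat_adjoint V) \<partial>?Q) \<partial>\<mu>1) \<le> ennreal (8 * c powr (q1 + q2))" .
  qed
  also have "q1 + q2 = (real s1 + real s2) * real r - 3 * (real r)\<^sup>2 / 2"
    by (simp add: q1_def q2_def algebra_simps)
  finally show ?thesis by (simp only: F_def c_def)
qed

section \<open>Choice of the Laplace parameter and of the universal constant\<close>

lemma stiefel_channel_bound:
  assumes s: "s1 \<le> n1" "s2 \<le> n2" and r: "0 < r" "r \<le> s1" "r \<le> s2" and \<sigma>: "\<sigma> > 0" and D: "D > 0"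
    and \<mu>: "uniform_on_stiefel s1 r \<mu>1" "uniform_on_stiefel s2 r \<mu>2"
    and PX: "PX = product_law n1 n2 (row_sparse_law n1 s1 r \<mu>1) (row_sparse_law n2 s2 r \<mu>2)"
    and f: "f \<in> borel_mat n1 n2 \<rightarrow>\<^sub>M borel_vec m" and g: "g \<in> borel_vec m \<rightarrow>\<^sub>M borel_mat n1 n2"
    and power: "(\<integral>\<^sup>+X. ennreal ((norm2_vec (f X))\<^sup>2) \<partial>PX) \<le> ennreal (real m)"
    and range: "AE (X, Z) in PX \<Otimes>\<^sub>M complex_normal_vec m \<sigma>.
      \<exists>U\<in>stiefel n1 r. \<exists>V\<in>stiefel n2 r. g (f X + Z) = U * mat_adjoint V"
    and dist: "(\<integral>\<^sup>+(X, Z). ennreal ((frobenius_norm (g (f X + Z) - X))\<^sup>2) \<partial>(PX \<Otimes>\<^sub>M complex_normal_vec m \<sigma>))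
      \<le> ennreal (real r * D)"
  shows "((real s1 + real s2) * real r - 3 * (real r)\<^sup>2 / 2) * (ln (exp (- 10) / 96 / D) / ln (1 + 1 / \<sigma>\<^sup>2)) \<le> real m"
proof -
  let ?P = "row_sparse_law n1 s1 r \<mu>1" and ?Q = "row_sparse_law n2 s2 r \<mu>2"
  note m1 = uniform_on_stiefelD[OF \<mu>(1)] and m2 = uniform_on_stiefelD[OF \<mu>(2)]
  interpret P: prob_space ?P by (rule prob_space_row_sparse_law[OF m1(1,2) s(1)])
  interpret Q: prob_space ?Q by (rule prob_space_row_sparse_law[OF m2(1,2) s(2)])
  interpret PQ: pair_prob_space ?P ?Q ..
  have PXp: "prob_space PX"
    unfolding PX product_law_def by (rule PQ.prob_space_distr[OF measurable_product_law]) auto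
  have PXs: "sets PX = sets (borel_mat n1 n2)" by (simp add: PX product_law_def)
  define t where "t = real s1 + real s2"
  define k where "k = t * real r - 3 * (real r)\<^sup>2 / 2"
  \<comment> \<open>Chosen so that the base \<open>96 * t / \<theta>\<close> becomes
    \<open>96 * D\<close>, while \<open>\<theta>\<close> times the distortion level
    \<open>r * D\<close> is just \<open>t * r\<close>.\<close>
  define \<theta> where "\<theta> = t / D"
  define K where "K = 8 * (96 * D) powr k"
  have t: "t > 0" "t \<ge> 2 * real r" using r by (simp_all add: t_def)
  have \<theta>: "\<theta> > 0" using t D by (simp add: \<theta>_def)
  have K: "K > 0" using D by (simp add: K_def)
  \<comment> \<open>Both follow from \<open>t\<close> being at least \<open>2 r\<close>: then
    \<open>k\<close> is at least r^2 / 2, and \<open>3 t r\<close> is at least \<open>6 r^2\<close>.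
    They let \<open>k\<close> absorb all terms not proportional to it.\<close>
  have k: "t * real r \<le> 4 * k" "1 / 2 \<le> k"
  proof -
    have *: "2 * real r * real r \<le> t * real r" using t(2) by (rule mult_right_mono) simp
    then show "t * real r \<le> 4 * k" by (simp add: k_def power2_eq_square)
    have "1 * 1 \<le> real r * real r" using r by (intro mult_mono) auto
    then show "1 / 2 \<le> k" using * by (simp add: k_def power2_eq_square)
  qed
  let ?S = "{U * mat_adjoint V | U V. U \<in> stiefel n1 r \<and> V \<in> stiefel n2 r}"
  have "- \<theta> * (real r * D) - real m * ln (1 + 1 / \<sigma>\<^sup>2) \<le> ln K"
  proof (rule rate_distortion_converse[OF PXp PXs \<sigma> _ _ K f g power, where S = ?S])
    show "AE (X, Z) in PX \<Otimes>\<^sub>M complex_normal_vec m \<sigma>. g (f X + Z) \<in> ?S"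
      using range by (rule eventually_mono) auto
    show "(\<integral>\<^sup>+(X, Z). ennreal (fro2 (g (f X + Z) - X)) \<partial>(PX \<Otimes>\<^sub>M complex_normal_vec m \<sigma>)) \<le> ennreal (real r * D)"
      using dist by (simp only: frobenius_norm_power2)
    fix Y assume "Y \<in> ?S"
    then obtain U V where UV: "U \<in> stiefel n1 r" "V \<in> stiefel n2 r" "Y = U * mat_adjoint V" by blast
    have "96 * t / \<theta> = 96 * D" using t D by (simp add: \<theta>_def)
    then show "(\<integral>\<^sup>+X. ennreal (exp (- \<theta> * fro2 (Y - X))) \<partial>PX) \<le> ennreal K"
      using product_law_laplace_bound[OF \<mu> r s \<theta> UV(1,2)]
      unfolding PX UV(3) K_def k_def t_def by simp
  qed (use \<theta> D in auto)
  also have "ln K = ln 8 + k * ln (96 * D)" using D by (simp add: K_def ln_mult ln_powr)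
  \<comment> \<open>The total loss is \<open>4 * k\<close> from the distortion and
    \<open>6 * k\<close> from the factor 8; this is the 10 in \<open>exp (- 10)\<close>.\<close>
  also have "ln (8 :: real) \<le> 6 * k"
  proof -
    have "ln (8 :: real) = 3 * ln 2" using ln_realpow[of "2 :: real" 3] by simp
    also have "\<dots> \<le> 3 * 1" using ln_2_less_1 by simp
    finally show ?thesis using k(2) by simp
  qed
  finally have "- \<theta> * (real r * D) - real m * ln (1 + 1 / \<sigma>\<^sup>2) \<le> 6 * k + k * ln (96 * D)" by simp
  moreover have "\<theta> * (real r * D) = t * real r" using D by (simp add: \<theta>_def)
  moreover have "k * ln (exp (- 10) / 96 / D) = - 10 * k - k * ln (96 * D)"
    using D by (simp add: ln_div ln_mult algebra_simps)
  ultimately have "k * ln (exp (- 10) / 96 / D) \<le> real m * ln (1 + 1 / \<sigma>\<^sup>2)"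
    using k(1) by simp
  moreover have "ln (1 + 1 / \<sigma>\<^sup>2) > 0" using \<sigma> by (intro ln_gt_zero) simp
  ultimately show ?thesis by (simp add: pos_divide_le_eq k_def t_def)
qed

theorem theoremV1:
  shows "\<exists>c::real. c > 0 \<and>
    (\<forall>(n1::nat) (n2::nat) (m::nat) (s1::nat) (s2::nat) (r::nat) (\<sigma>::real) (D::real)
       (\<mu>1::complex mat measure) (\<mu>2::complex mat measure)
       (PX::complex mat measure) (PZ::complex vec measure)
       (f::complex mat \<Rightarrow> complex vec) (g::complex vec \<Rightarrow> complex mat).
       s1 \<le> n1 \<longrightarrow> s2 \<le> n2 \<longrightarrow> r \<le> min s1 s2 \<longrightarrow> \<sigma> > 0 \<longrightarrow> D > 0 \<longrightarrow>
       uniform_on_stiefel s1 r \<mu>1 \<longrightarrow> uniform_on_stiefel s2 r \<mu>2 \<longrightarrow>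
       PX = product_law n1 n2 (row_sparse_law n1 s1 r \<mu>1) (row_sparse_law n2 s2 r \<mu>2) \<longrightarrow>
       PZ = complex_normal_vec m \<sigma> \<longrightarrow>
       f \<in> borel_mat n1 n2 \<rightarrow>\<^sub>M borel_vec m \<longrightarrow>
       g \<in> borel_vec m \<rightarrow>\<^sub>M borel_mat n1 n2 \<longrightarrow>
       (\<integral>\<^sup>+ X. ennreal ((norm2_vec (f X))\<^sup>2) \<partial>PX) \<le> ennreal (real m) \<longrightarrow>
       (AE (X, Z) in PX \<Otimes>\<^sub>M PZ.
          \<exists>U\<in>stiefel n1 r. \<exists>V\<in>stiefel n2 r. g (f X + Z) = U * mat_adjoint V) \<longrightarrow>
       (\<integral>\<^sup>+ (X, Z). ennreal ((frobenius_norm (g (f X + Z) - X))\<^sup>2) \<partial>(PX \<Otimes>\<^sub>M PZ))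
         \<le> ennreal (real r * D) \<longrightarrow>
       real m \<ge> ((real s1 + real s2) * real r - 3 * (real r)\<^sup>2 / 2)
                  * (ln (c / D) / ln (1 + 1 / \<sigma>\<^sup>2)))"
proof (intro exI[of _ "exp (- 10) / 96 :: real"] conjI allI impI)
  show "(0 :: real) < exp (- 10) / 96" by simp
next
  fix n1 n2 m s1 s2 r :: nat and \<sigma> D :: real and \<mu>1 \<mu>2 PX :: "complex mat measure"
    and PZ :: "complex vec measure" and f :: "complex mat \<Rightarrow> complex vec" and g :: "complex vec \<Rightarrow> complex mat"
  assume s: "s1 \<le> n1" "s2 \<le> n2" and r: "r \<le> min s1 s2" and \<sigma>: "\<sigma> > 0" and D: "D > 0"
    and \<mu>: "uniform_on_stiefel s1 r \<mu>1" "uniform_on_stiefel s2 r \<mu>2"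
    and PX: "PX = product_law n1 n2 (row_sparse_law n1 s1 r \<mu>1) (row_sparse_law n2 s2 r \<mu>2)"
    and PZ: "PZ = complex_normal_vec m \<sigma>"
    and fg: "f \<in> borel_mat n1 n2 \<rightarrow>\<^sub>M borel_vec m" "g \<in> borel_vec m \<rightarrow>\<^sub>M borel_mat n1 n2"
    and power: "(\<integral>\<^sup>+ X. ennreal ((norm2_vec (f X))\<^sup>2) \<partial>PX) \<le> ennreal (real m)"
    and range: "AE (X, Z) in PX \<Otimes>\<^sub>M PZ. \<exists>U\<in>stiefel n1 r. \<exists>V\<in>stiefel n2 r. g (f X + Z) = U * mat_adjoint V"
    and dist: "(\<integral>\<^sup>+ (X, Z). ennreal ((frobenius_norm (g (f X + Z) - X))\<^sup>2) \<partial>(PX \<Otimes>\<^sub>M PZ)) \<le> ennreal (real r * D)"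
  show "((real s1 + real s2) * real r - 3 * (real r)\<^sup>2 / 2) * (ln (exp (- 10) / 96 / D) / ln (1 + 1 / \<sigma>\<^sup>2)) \<le> real m"
  \<comment> \<open>For \<open>r = 0\<close> the dimension factor vanishes and the bound is trivial;
    positive \<open>r\<close> is what makes the exponent at least 1/2.\<close>
  proof (cases "r = 0")
    case True
    then show ?thesis by simp
  next
    case False
    then show ?thesis
      using stiefel_channel_bound[OF s _ _ _ \<sigma> D \<mu> PX fg power range[unfolded PZ] dist[unfolded PZ]] r by simp
  qed
qed

end
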